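(* Let $E$ be a simple euclidean Jordan algebra of rank $r$, let $s$ belong to the Wallach set, let $k\in\{0,\ldots,r\}$, and put $\nu_k=s\big(k-\frac r2\big)$. Then the following are equivalent: (i) $\nu_k\in\mathbb{Z}$; (ii) $\operatorname{supp}(\operatorname{Im}\tilde\mu_s)\subseteq E\setminus W(h_k)$; (iii) $\operatorname{supp}(\operatorname{Im}\tilde\mu_s)\cap E^\times_{2k-r}=\emptyset$.
   Context: $E$ is a simple euclidean Jordan algebra (commutative, $x(x^2y)=x^2(xy)$, unit $e$, with an inner product for which all multiplication operators $L(x)y=xy$ are symmetric) of dimension $n$ and rank $r$; $c_1,\dots,c_r$ is a Jordan frame (mutually orthogonal primitive idempotents summing to $e$), and the Peirce spaces $E_{ij}=\{v: c_iv=\frac12v=c_jv\}$ ($i<j$) have common dimension $d$. $C=\{x^2:x\in E\}$ with interior $C^0$. Every $x$ has a spectral decomposition $x=\sum_j x_j\tilde c_j$ with a Jordan frame $(\tilde c_j)$; $\operatorname{ind}(x)=\sum_j\operatorname{sgn}(x_j)$, $\Delta(x)=\prod_jx_j$ (a polynomial, extended to the complexification). $E^\times$ is the set of invertible elements and $E^\times_j=\{x\in E^\times:\operatorname{ind}(x)=j\}$. The Wallach set is $\{j\frac d2: j=0,\dots,r-1\}\cup\big((r-1)\frac d2,\infty\big)$; for $s$ in it, $\mu_s$ is the Riesz measure, the positive tempered measure on the dual cone $C^\star\subseteq E^*$ with $\int e^{i\lambda(z)}d\mu_s(\lambda)=\Delta(-iz)^{-s}$ for $z\in E+iC^0$ (branch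 positive on $iC^0$). Its Fourier transform is the tempered distribution $\tilde\mu_s(\phi)=\int_{E^*}\widetilde{\overline\phi}\,d\mu_s$, $\tilde\phi(\lambda)=\int_Ee^{i\lambda(x)}\phi(x)dx$; $\operatorname{Im}\tilde\mu_s$ is the distribution with $(\operatorname{Im}\tilde\mu_s)(\phi)=\operatorname{Im}(\tilde\mu_s(\phi))$ for real-valued $\phi$. $h_k=L(c_1+\dots+c_k)-L(c_{k+1}+\dots+c_r)$, $E_j(h_k)=\ker(h_k-j)$, $C_+=C\cap E_1(h_k)$, $C_-=-C\cap E_{-1}(h_k)$ with interiors $C_\pm^0$ relative to $E_{\pm1}(h_k)$ (the interior of the cone in the zero space being $\{0\}$), and $W(h_k)=C_+^0\oplus C_-^0\oplus E_0(h_k)$. *)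

theory Defs
  imports "HOL-Analysis.Analysis" "HOL-Computational_Algebra.Polynomial"
begin

text \<open>The Jordan product is a function jm on a euclidean space 'a; the inner
product of the euclidean space is the one making all L(x) symmetric.\<close>

definition euclidean_jordan_algebra :: "('a::euclidean_space \<Rightarrow> 'a \<Rightarrow> 'a) \<Rightarrow> 'a \<Rightarrow> bool" where
  "euclidean_jordan_algebra jm e \<longleftrightarrow>
     bilinear jm \<and>
     (\<forall>x y. jm x y = jm y x) \<and>
     (\<forall>x y. jm x (jm (jm x x) y) = jm (jm x x) (jm x y)) \<and>
     (\<forall>x. jm e x = x) \<and>
     (\<forall>x y z. inner (jm x y) z = inner y (jm x z))"

definition jordan_ideal :: "('a::euclidean_space \<Rightarrow> 'a \<Rightarrow> 'a) \<Rightarrow> 'a set \<Rightarrow> bool" where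
  "jordan_ideal jm I \<longleftrightarrow> subspace I \<and> (\<forall>x\<in>I. \<forall>y. jm x y \<in> I)"

definition simple_eja :: "('a::euclidean_space \<Rightarrow> 'a \<Rightarrow> 'a) \<Rightarrow> 'a \<Rightarrow> bool" where
  "simple_eja jm e \<longleftrightarrow> euclidean_jordan_algebra jm e \<and> (UNIV::'a set) \<noteq> {0} \<and>
     (\<forall>I. jordan_ideal jm I \<longrightarrow> I = {0} \<or> I = UNIV)"

definition idempotent :: "('a::euclidean_space \<Rightarrow> 'a \<Rightarrow> 'a) \<Rightarrow> 'a \<Rightarrow> bool" where
  "idempotent jm c \<longleftrightarrow> jm c c = c"

definition primitive_idempotent :: "('a::euclidean_space \<Rightarrow> 'a \<Rightarrow> 'a) \<Rightarrow> 'a \<Rightarrow> bool" where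
  "primitive_idempotent jm c \<longleftrightarrow> idempotent jm c \<and> c \<noteq> 0 \<and>
     \<not> (\<exists>a b. idempotent jm a \<and> idempotent jm b \<and> a \<noteq> 0 \<and> b \<noteq> 0 \<and>
             jm a b = 0 \<and> c = a + b)"

definition jordan_frame :: "('a::euclidean_space \<Rightarrow> 'a \<Rightarrow> 'a) \<Rightarrow> 'a \<Rightarrow> nat \<Rightarrow> (nat \<Rightarrow> 'a) \<Rightarrow> bool" where
  "jordan_frame jm e r c \<longleftrightarrow>
     (\<forall>i\<in>{1..r}. primitive_idempotent jm (c i)) \<and>
     (\<forall>i\<in>{1..r}. \<forall>j\<in>{1..r}. i \<noteq> j \<longrightarrow> jm (c i) (c j) = 0) \<and>
     (\<Sum>i\<in>{1..r}. c i) = e"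

definition peirce_space :: "('a::euclidean_space \<Rightarrow> 'a \<Rightarrow> 'a) \<Rightarrow> (nat \<Rightarrow> 'a) \<Rightarrow> nat \<Rightarrow> nat \<Rightarrow> 'a set" where
  "peirce_space jm c i j = {v. jm (c i) v = (1/2) *\<^sub>R v \<and> jm (c j) v = (1/2) *\<^sub>R v}"

definition spectral_decomp :: "('a::euclidean_space \<Rightarrow> 'a \<Rightarrow> 'a) \<Rightarrow> 'a \<Rightarrow> nat \<Rightarrow> 'a \<Rightarrow> (nat \<Rightarrow> real) \<Rightarrow> (nat \<Rightarrow> 'a) \<Rightarrow> bool" where
  "spectral_decomp jm e r x l d \<longleftrightarrow> jordan_frame jm e r d \<and> x = (\<Sum>j\<in>{1..r}. l j *\<^sub>R d j)"

definition jdet :: "('a::euclidean_space \<Rightarrow> 'a \<Rightarrow> 'a) \<Rightarrow> 'a \<Rightarrow> nat \<Rightarrow> 'a \<Rightarrow> real" where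
  "jdet jm e r x = (THE D. \<exists>l d. spectral_decomp jm e r x l d \<and> D = (\<Prod>j\<in>{1..r}. l j))"

definition jind :: "('a::euclidean_space \<Rightarrow> 'a \<Rightarrow> 'a) \<Rightarrow> 'a \<Rightarrow> nat \<Rightarrow> 'a \<Rightarrow> int" where
  "jind jm e r x = (THE m. \<exists>l d. spectral_decomp jm e r x l d \<and>
                              real_of_int m = (\<Sum>j\<in>{1..r}. sgn (l j)))"

text \<open>Complexified determinant: cdet a b = Delta(a + i b), obtained by evaluating at i the
real polynomial t \<mapsto> Delta(a + t b).\<close>
definition cdet :: "('a::euclidean_space \<Rightarrow> 'a \<Rightarrow> 'a) \<Rightarrow> 'a \<Rightarrow> nat \<Rightarrow> 'a \<Rightarrow> 'a \<Rightarrow> complex" where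
  "cdet jm e r a b = poly (map_poly complex_of_real
        (THE p. \<forall>t. poly p t = jdet jm e r (a + t *\<^sub>R b))) \<i>"

definition invertible_elts :: "('a::euclidean_space \<Rightarrow> 'a \<Rightarrow> 'a) \<Rightarrow> 'a \<Rightarrow> 'a set" where
  "invertible_elts jm e = {x. \<exists>y. jm x y = e \<and> jm (jm x x) y = x}"

definition invertible_ind :: "('a::euclidean_space \<Rightarrow> 'a \<Rightarrow> 'a) \<Rightarrow> 'a \<Rightarrow> nat \<Rightarrow> int \<Rightarrow> 'a set" where
  "invertible_ind jm e r j = {x \<in> invertible_elts jm e. jind jm e r x = j}"

definition sym_cone :: "('a::euclidean_space \<Rightarrow> 'a \<Rightarrow> 'a) \<Rightarrow> 'a set" where
  "sym_cone jm = {jm x x | x. True}"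

text \<open>Dual cone, with E^* identified with E through the inner product.\<close>
definition dual_cone :: "'a::euclidean_space set \<Rightarrow> 'a set" where
  "dual_cone K = {l. \<forall>x\<in>K. 0 \<le> inner l x}"

definition wallach_set :: "nat \<Rightarrow> real \<Rightarrow> real set" where
  "wallach_set r d = {real j * d / 2 | j. j < r} \<union> {(real r - 1) * d / 2 <..}"

text \<open>A point z = x + i y of E + iE is represented by the pair (x,y).
The tube E + i C^0.\<close>
definition tube :: "('a::euclidean_space \<Rightarrow> 'a \<Rightarrow> 'a) \<Rightarrow> ('a \<times> 'a) set" where
  "tube jm = {(x, y). y \<in> interior (sym_cone jm)}"

text \<open>mu is a Riesz measure for s: a positive tempered measure on the dual cone such that
int e^{i lambda(z)} d mu(lambda) = Delta(-iz)^{-s} on the tube, where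
Delta(-iz)^{-s} = exp(-s L z) for a continuous logarithm L of z \<mapsto> Delta(-iz) on the tube
(note -i(x+iy) = y - i x), the branch being chosen positive on i C^0.\<close>
definition riesz_measure :: "('a::euclidean_space \<Rightarrow> 'a \<Rightarrow> 'a) \<Rightarrow> 'a \<Rightarrow> nat \<Rightarrow> real \<Rightarrow> 'a measure \<Rightarrow> bool" where
  "riesz_measure jm e r s \<mu> \<longleftrightarrow>
     sets \<mu> = sets borel \<and>
     emeasure \<mu> (UNIV - dual_cone (sym_cone jm)) = 0 \<and>
     (\<exists>N::nat. (\<integral>\<^sup>+ l. ennreal ((1 + norm l) powr (- real N)) \<partial>\<mu>) < \<infinity>) \<and>
     (\<exists>L. continuous_on (tube jm) L \<and>
          (\<forall>(x, y)\<in>tube jm. exp (L (x, y)) = cdet jm e r y (- x)) \<and>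
          (\<forall>y\<in>interior (sym_cone jm). exp (- of_real s * L (0, y)) \<in> \<real> \<and>
                                          0 < Re (exp (- of_real s * L (0, y)))) \<and>
          (\<forall>(x, y)\<in>tube jm.
              integrable \<mu> (\<lambda>l. exp (\<i> * of_real (inner l x) - of_real (inner l y))) \<and>
              (\<integral>l. exp (\<i> * of_real (inner l x) - of_real (inner l y)) \<partial>\<mu>)
                 = exp (- of_real s * L (x, y))))"

coinductive smooth_fun :: "('a::euclidean_space \<Rightarrow> real) \<Rightarrow> bool" where
  "(\<forall>x. f differentiable (at x)) \<Longrightarrow>
   (\<forall>v. smooth_fun (\<lambda>x. frechet_derivative f (at x) v)) \<Longrightarrow> smooth_fun f"

definition test_fun :: "('a::euclidean_space \<Rightarrow> real) \<Rightarrow> bool" where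
  "test_fun \<phi> \<longleftrightarrow> smooth_fun \<phi> \<and> compact (closure {x. \<phi> x \<noteq> 0})"

definition fourier :: "('a::euclidean_space \<Rightarrow> complex) \<Rightarrow> 'a \<Rightarrow> complex" where
  "fourier \<phi> l = (\<integral>x. exp (\<i> * of_real (inner l x)) * \<phi> x \<partial>lborel)"

definition measure_ft :: "'a::euclidean_space measure \<Rightarrow> ('a \<Rightarrow> complex) \<Rightarrow> complex" where
  "measure_ft \<mu> \<phi> = (\<integral>l. fourier (\<lambda>x. cnj (\<phi> x)) l \<partial>\<mu>)"

definition Im_measure_ft :: "'a::euclidean_space measure \<Rightarrow> ('a \<Rightarrow> real) \<Rightarrow> real" where
  "Im_measure_ft \<mu> \<phi> = Im (measure_ft \<mu> (\<lambda>x. complex_of_real (\<phi> x)))"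

definition distr_support :: "(('a::euclidean_space \<Rightarrow> real) \<Rightarrow> real) \<Rightarrow> 'a set" where
  "distr_support T = UNIV - \<Union>{U. open U \<and>
        (\<forall>\<phi>. test_fun \<phi> \<and> closure {x. \<phi> x \<noteq> 0} \<subseteq> U \<longrightarrow> T \<phi> = 0)}"

definition hk :: "('a::euclidean_space \<Rightarrow> 'a \<Rightarrow> 'a) \<Rightarrow> nat \<Rightarrow> (nat \<Rightarrow> 'a) \<Rightarrow> nat \<Rightarrow> 'a \<Rightarrow> 'a" where
  "hk jm r c k x = jm (\<Sum>i\<in>{1..k}. c i) x - jm (\<Sum>i\<in>{k+1..r}. c i) x"

definition eigsp :: "('a::euclidean_space \<Rightarrow> 'a) \<Rightarrow> real \<Rightarrow> 'a set" where
  "eigsp h j = {x. h x = j *\<^sub>R x}"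

definition interior_in :: "'a::euclidean_space set \<Rightarrow> 'a set \<Rightarrow> 'a set" where
  "interior_in V S = {x\<in>S. \<exists>T. open T \<and> x \<in> T \<and> T \<inter> V \<subseteq> S}"

definition W_set :: "('a::euclidean_space \<Rightarrow> 'a \<Rightarrow> 'a) \<Rightarrow> nat \<Rightarrow> (nat \<Rightarrow> 'a) \<Rightarrow> nat \<Rightarrow> 'a set" where
  "W_set jm r c k =
     (let h = hk jm r c k;
          Cp = sym_cone jm \<inter> eigsp h 1;
          Cm = uminus ` sym_cone jm \<inter> eigsp h (-1)
      in {a + b + z | a b z. a \<in> interior_in (eigsp h 1) Cp \<and>
                             b \<in> interior_in (eigsp h (-1)) Cm \<and> z \<in> eigsp h 0})"

end

theory Submission
  imports Defs
begin

text \<open>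
  Write \<open>l\<^sub>1, \<dots>, l\<^sub>r\<close> for the eigenvalues of \<open>x\<close>. The Laplace transform formula of the Riesz measure
  is only needed at the points \<open>x + i\<epsilon>e\<close> of the tube, where \<open>\<Delta>(\<epsilon>e - ix) = \<Prod>\<^sub>j (\<epsilon> - i l\<^sub>j)\<close> is
  immediate from a spectral decomposition, and where following the logarithm along the segment from
  \<open>0\<close> to \<open>x\<close> turns \<open>\<Delta>(-iz)\<^sup>-\<^sup>s\<close> into a product of principal powers. Letting \<open>\<epsilon> \<rightarrow> 0\<close>,
  the Fourier transform of the Riesz measure coincides on the invertible elements of index \<open>m\<close> with the function
  \<open>exp (i\<pi>sm/2) |\<Delta>(x)|\<^sup>-\<^sup>s\<close>, whose imaginary part vanishes iff \<open>sm/2\<close> is an integer; for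
  \<open>m = 2k - r\<close> this number is \<open>\<nu>\<^sub>k\<close>. The index is locally constant because the sum of the
  \<open>arctan (l\<^sub>j / \<epsilon>)\<close> is, up to a constant, the imaginary part of the continuous logarithm.

  The set \<open>W(h\<^sub>k)\<close> lies in the invertible elements of index \<open>2k - r\<close>: it is convex and contains
  \<open>c\<^sub>1 + \<dots> + c\<^sub>k - c\<^sub>k\<^sub>+\<^sub>1 - \<dots> - c\<^sub>r\<close>, and if \<open>x = a + b + z \<in> W(h\<^sub>k)\<close> annihilates an idempotent \<open>d\<close>
  with Peirce components \<open>d\<^sub>1, d\<^sub>1\<^sub>/\<^sub>2, d\<^sub>0\<close>, then \<open>\<langle>a, d\<^sub>1\<rangle> + \<langle>-b, d\<^sub>0\<rangle> = 0\<close> is a sum of two nonnegative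
  terms, which forces \<open>d = 0\<close>.
\<close>

section \<open>Euclidean Jordan algebras: linearised identities and Peirce calculus\<close>

text \<open>Determinant, index and complexified determinant are definite descriptions, so none of
  them can be evaluated before every element is known to have a spectral decomposition along a frame
  of exactly \<open>r\<close> elements, with eigenvalues unique up to order. Existence needs power
  associativity, derived from the linearised Jordan identity; the common size of all frames is where
  simplicity enters. Both uniqueness statements rest on one normalisation: in a frame of size
  \<open>m\<close> every member has squared norm \<open>|e|^2 / m\<close>, so the inner product with
  \<open>e\<close> acts as a trace. On the analytic side the Fourier transform of the Riesz measure
  is given only as a distribution, and for \<open>s > 0\<close> its candidate density blows up at
  non-invertible elements. Test functions supported in one open index class avoid this: the nonzero
  idempotents form a compact set, so eigenvalues stay uniformly away from 0 on the support, and
  \<open>s >= 0\<close> gives a bound independent of the damping. Recovering integrality needs a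
  nonnegative test function concentrated near a point, hence the construction of bump
  functions.\<close>

locale euclidean_jordan =
  fixes jm :: "'a::euclidean_space \<Rightarrow> 'a \<Rightarrow> 'a" (infixl "\<odot>" 70) and e :: 'a
  assumes eja: "euclidean_jordan_algebra jm e"
begin

lemma bilin: "bilinear jm" and comm: "x \<odot> y = y \<odot> x"
  and jordan_identity: "x \<odot> ((x \<odot> x) \<odot> y) = (x \<odot> x) \<odot> (x \<odot> y)"
  and unit [simp]: "e \<odot> x = x"
  and inner_jm: "inner (x \<odot> y) z = inner y (x \<odot> z)"
  using eja unfolding euclidean_jordan_algebra_def by auto

lemma unit_right [simp]: "x \<odot> e = x"
  using unit comm by metis

lemmas jm_simps =
  bilinear_ladd[OF bilin] bilinear_radd[OF bilin] bilinear_lmul[OF bilin] bilinear_rmul[OF bilin]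
  bilinear_lsub[OF bilin] bilinear_rsub[OF bilin] bilinear_lneg[OF bilin] bilinear_rneg[OF bilin]
  bilinear_lzero[OF bilin] bilinear_rzero[OF bilin]

lemma jm_zero [simp]: "0 \<odot> x = 0" "x \<odot> 0 = 0"
  by (simp_all add: jm_simps)

lemma linear_jm: "linear (jm x)"
  using bilin unfolding bilinear_def by blast

lemma bounded_bilinear_jm: "bounded_bilinear jm"
  using bilin bilinear_conv_bounded_bilinear by blast

lemma sum_jm: "(\<Sum>i\<in>A. f i) \<odot> x = (\<Sum>i\<in>A. f i \<odot> x)"
  by (simp add: bounded_bilinear.sum_left[OF bounded_bilinear_jm])

lemma jm_sum: "x \<odot> (\<Sum>i\<in>A. f i) = (\<Sum>i\<in>A. x \<odot> f i)"
  by (simp add: bounded_bilinear.sum_right[OF bounded_bilinear_jm])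

lemma continuous_jm [continuous_intros]:
  "continuous_on S f \<Longrightarrow> continuous_on S g \<Longrightarrow> continuous_on S (\<lambda>x. f x \<odot> g x)"
  by (rule bounded_bilinear.continuous_on[OF bounded_bilinear_jm])

text \<open>Polarisation: the Jordan identity at \<open>x + y\<close> minus that at
  \<open>x - y\<close> keeps the parts odd in \<open>y\<close>, and removing the pure
  \<open>y\<close> part leaves the terms linear in \<open>y\<close>. Pairing with an arbitrary
  \<open>u\<close> turns the vector equation into linear arithmetic over the reals.\<close>

lemma jordan_linearized2:
  "2 *\<^sub>R (x \<odot> ((x \<odot> y) \<odot> w)) + y \<odot> ((x \<odot> x) \<odot> w)
     = 2 *\<^sub>R ((x \<odot> y) \<odot> (x \<odot> w)) + (x \<odot> x) \<odot> (y \<odot> w)" (is "?l = ?r")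
proof -
  have yx: "y \<odot> x = x \<odot> y" by (rule comm)
  have "inner ?l u = inner ?r u" for u
    using arg_cong[OF jordan_identity[of "x + y" w], of "\<lambda>v. inner v u"]
      arg_cong[OF jordan_identity[of "x - y" w], of "\<lambda>v. inner v u"]
      arg_cong[OF jordan_identity[of y w], of "\<lambda>v. inner v u"]
    by (simp add: jm_simps inner_simps yx)
  then show ?thesis by (metis vector_eq_rdot)
qed

text \<open>Second polarisation, replacing \<open>x\<close> by \<open>x + z\<close> in the part
  quadratic in \<open>x\<close>.\<close>

lemma jordan_linearized:
  "x \<odot> ((y \<odot> z) \<odot> w) + y \<odot> ((z \<odot> x) \<odot> w) + z \<odot> ((x \<odot> y) \<odot> w)
     = (y \<odot> z) \<odot> (x \<odot> w) + (z \<odot> x) \<odot> (y \<odot> w) + (x \<odot> y) \<odot> (z \<odot> w)" (is "?l = ?r")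
proof -
  have yx: "y \<odot> x = x \<odot> y" "z \<odot> x = x \<odot> z" "z \<odot> y = y \<odot> z" by (rule comm)+
  have "inner ?l u = inner ?r u" for u
    using arg_cong[OF jordan_linearized2[of "x + z" y w], of "\<lambda>v. inner v u"]
      arg_cong[OF jordan_linearized2[of "x" y w], of "\<lambda>v. inner v u"]
      arg_cong[OF jordan_linearized2[of z y w], of "\<lambda>v. inner v u"]
    by (simp add: jm_simps inner_simps yx)
  then show ?thesis by (metis vector_eq_rdot)
qed

text \<open>Read as an identity of operators applied to \<open>x\<close>, this expresses
  \<open>L((yz)w)\<close> through multiplications by single factors and by products of two; it
  reduces the commutation of high powers to that of low ones.\<close>

lemma mult_operator_triple:
  "((y \<odot> z) \<odot> w) \<odot> x = (y \<odot> z) \<odot> (w \<odot> x) + (y \<odot> w) \<odot> (z \<odot> x) + (z \<odot> w) \<odot> (y \<odot> x)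
     - y \<odot> (w \<odot> (z \<odot> x)) - z \<odot> (w \<odot> (y \<odot> x))"
  using jordan_linearized[of x y z w] by (simp add: comm algebra_simps)

definition opcomm :: "'a \<Rightarrow> 'a \<Rightarrow> bool" where
  "opcomm a b \<longleftrightarrow> (\<forall>w. a \<odot> (b \<odot> w) = b \<odot> (a \<odot> w))"

lemma opcomm_sym: "opcomm a b \<Longrightarrow> opcomm b a"
  by (auto simp: opcomm_def)

lemma opcommD: "opcomm a b \<Longrightarrow> a \<odot> (b \<odot> w) = b \<odot> (a \<odot> w)"
  by (auto simp: opcomm_def)

lemma opcomm_refl: "opcomm a a"
  by (auto simp: opcomm_def)

lemma opcomm_square: "opcomm x (x \<odot> x)"
  unfolding opcomm_def using jordan_identity by blast

text \<open>With \<open>x = c\<close> and \<open>y = u\<close> the linearised identity collapses to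
  \<open>(2t - 1) [L(c), L(u)] = 0\<close>.\<close>

lemma peirce_opcomm:
  assumes "c \<odot> c = c" "c \<odot> u = t *\<^sub>R u" "t \<noteq> 1/2"
  shows "opcomm c u"
  unfolding opcomm_def
proof
  fix w
  have "(2 * t - 1) *\<^sub>R (c \<odot> (u \<odot> w)) = (2 * t - 1) *\<^sub>R (u \<odot> (c \<odot> w))"
    using jordan_linearized2[of c u w] assms(1,2) by (simp add: jm_simps algebra_simps)
  then show "c \<odot> (u \<odot> w) = u \<odot> (c \<odot> w)"
    using assms(3) by auto
qed

text \<open>Exchanging the roles (\<open>x = u\<close>, \<open>y = c\<close>) makes both terms
  carrying \<open>t\<close> cancel, so the eigenvalue \<open>1/2\<close> is covered as well.\<close>

lemma peirce_opcomm_square: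
  assumes "c \<odot> u = t *\<^sub>R u"
  shows "opcomm c (u \<odot> u)"
  unfolding opcomm_def
proof
  fix w
  have cu: "u \<odot> c = t *\<^sub>R u" using assms comm by metis
  show "c \<odot> (u \<odot> u \<odot> w) = u \<odot> u \<odot> (c \<odot> w)"
    using jordan_linearized2[of u c w] by (simp add: cu jm_simps algebra_simps)
qed

text \<open>The polynomial \<open>T(2T - 1)(T - 1)\<close> annihilates \<open>T = L(c)\<close>; this
  is where the Peirce eigenvalues 0, 1/2 and 1 come from.\<close>

lemma idem_operator:
  assumes "c \<odot> c = c"
  shows "2 *\<^sub>R (c \<odot> (c \<odot> (c \<odot> x))) = 3 *\<^sub>R (c \<odot> (c \<odot> x)) - c \<odot> x"
proof -
  have "c \<odot> x = c \<odot> (c \<odot> x) + c \<odot> (c \<odot> x) + c \<odot> (c \<odot> x) - c \<odot> (c \<odot> (c \<odot> x)) - c \<odot> (c \<odot> (c \<odot> x))"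
    using mult_operator_triple[of c c c x] assms by simp
  then have "inner (2 *\<^sub>R (c \<odot> (c \<odot> (c \<odot> x)))) u = inner (3 *\<^sub>R (c \<odot> (c \<odot> x)) - c \<odot> x) u" for u
    by (drule_tac arg_cong[where f="\<lambda>v. inner v u"]) (simp add: inner_simps)
  then show ?thesis by (metis vector_eq_rdot)
qed

text \<open>Both factors operator-commute with \<open>c\<close>, so \<open>c(ab)\<close> equals
  \<open>a(cb) = 0\<close> and also \<open>b(ca) = ab\<close>.\<close>

lemma peirce_one_zero:
  assumes "c \<odot> c = c" "c \<odot> a = a" "c \<odot> b = 0"
  shows "a \<odot> b = 0"
proof -
  have "opcomm c a" "opcomm c b"
    using peirce_opcomm[of c a 1] peirce_opcomm[of c b 0] assms by auto
  then have "c \<odot> (a \<odot> b) = a \<odot> (c \<odot> b)" "c \<odot> (b \<odot> a) = b \<odot> (c \<odot> a)"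
    by (auto simp: opcomm_def)
  then show ?thesis
    using assms comm by (metis jm_zero(2))
qed

lemma inner_idem: "c \<odot> c = c \<Longrightarrow> inner c x = inner c (c \<odot> x)"
  by (metis inner_jm)

lemma idem_norm: "c \<odot> c = c \<Longrightarrow> inner c e = inner c c"
  by (metis inner_jm unit_right)

lemma orthogonal_idem_inner: "c \<odot> c = c \<Longrightarrow> c \<odot> d = 0 \<Longrightarrow> inner c d = 0"
  by (metis inner_idem inner_zero_right)

end

section \<open>Spectral decomposition\<close>

text \<open>Variational: the quadratic form is maximised on the unit sphere of \<open>V\<close>, and
  comparing the maximiser \<open>v0\<close> with \<open>v0 + h w\<close>, where \<open>w\<close>
  measures its failure to be an eigenvector, forces \<open>w = 0\<close>.\<close>

lemma symmetric_eigenvector_exists: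
  fixes T :: "'a::euclidean_space \<Rightarrow> 'a"
  assumes T: "linear T" and sym: "\<And>x y. inner (T x) y = inner x (T y)"
    and V: "subspace V" and inv: "\<And>v. v \<in> V \<Longrightarrow> T v \<in> V" and ne: "V \<noteq> {0}"
  shows "\<exists>v\<in>V. \<exists>t. v \<noteq> 0 \<and> T v = t *\<^sub>R v"
proof -
  define S where "S = V \<inter> sphere 0 1"
  obtain v where v: "v \<in> V" "v \<noteq> 0" using ne V subspace_0 by blast
  then have "v /\<^sub>R norm v \<in> S"
    by (simp add: S_def subspace_scale[OF V])
  then have "S \<noteq> {}" by blast
  moreover have "compact S"
    unfolding S_def using closed_subspace[OF V] by (simp add: closed_Int_compact)
  moreover have "continuous_on S (\<lambda>x. inner (T x) x)"
    by (intro continuous_intros linear_continuous_on T linear_conv_bounded_linear[THEN iffD1])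
  ultimately obtain v0 where v0: "v0 \<in> S" "\<And>y. y \<in> S \<Longrightarrow> inner (T y) y \<le> inner (T v0) v0"
    using continuous_attains_sup[of S "\<lambda>x. inner (T x) x"] by blast
  define t where "t = inner (T v0) v0"
  have v0V: "v0 \<in> V" and n1: "inner v0 v0 = 1"
    using v0(1) by (auto simp: S_def norm_eq_1)
  have le: "inner (T y) y \<le> t * inner y y" if "y \<in> V" for y
  proof (cases "y = 0")
    case True then show ?thesis using T by (simp add: linear_0)
  next
    case False
    then have "y /\<^sub>R norm y \<in> S" using that by (simp add: S_def subspace_scale[OF V])
    from v0(2)[OF this] have "inner (T y) y / (norm y)\<^sup>2 \<le> t"
      by (simp add: linear_cmul[OF T] t_def power2_eq_square divide_simps)
    then show ?thesis
      using False by (simp add: divide_simps power2_norm_eq_inner split: if_splits)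
  qed
  define w where "w = T v0 - t *\<^sub>R v0"
  have wV: "w \<in> V" unfolding w_def by (intro subspace_diff V inv v0V subspace_scale)
  have ineq: "2 * h * inner w w \<le> h\<^sup>2 * (t * inner w w - inner (T w) w)" for h
  proof -
    have "inner (T (v0 + h *\<^sub>R w)) (v0 + h *\<^sub>R w) \<le> t * inner (v0 + h *\<^sub>R w) (v0 + h *\<^sub>R w)"
      by (intro le subspace_add V v0V subspace_scale wV)
    moreover have "inner (T w) v0 = inner (T v0) w" by (metis sym inner_commute)
    moreover have "inner w v0 = inner v0 w" by (rule inner_commute)
    ultimately have "2 * h * inner (T v0) w + h\<^sup>2 * inner (T w) w \<le> t * (2 * h * inner v0 w + h\<^sup>2 * inner w w)"
      using n1 by (simp add: linear_add[OF T] linear_cmul[OF T] inner_add_left inner_add_right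
          power2_eq_square t_def[symmetric] algebra_simps)
    moreover have "inner w w = inner (T v0) w - t * inner v0 w"
      by (subst (1) w_def) (simp add: inner_diff_left)
    then have "2 * h * inner w w = 2 * h * inner (T v0) w - 2 * h * (t * inner v0 w)"
      by (metis right_diff_distrib)
    ultimately show ?thesis by (simp add: algebra_simps)
  qed
  have "inner w w \<le> 0"
  proof (rule ccontr)
    assume "\<not> inner w w \<le> 0"
    then have p: "inner w w > 0" by linarith
    define b where "b = \<bar>t * inner w w - inner (T w) w\<bar> + 1"
    have b: "b > 0" "t * inner w w - inner (T w) w \<le> b" by (auto simp: b_def)
    \<comment> \<open>For this step length the quadratic term in \<open>ineq\<close> is at most half
      the linear one, which is impossible for nonzero \<open>w\<close>.\<close>
    define h where "h = inner w w / b"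
    have h: "h > 0" using p b by (simp add: h_def)
    have "2 * h * inner w w \<le> h\<^sup>2 * b"
      using ineq[of h] b mult_left_mono[OF b(2), of "h\<^sup>2"] by simp
    also have "\<dots> = h * inner w w" using b by (simp add: h_def power2_eq_square)
    finally show False using h p by simp
  qed
  then have "w = 0" by (metis inner_gt_zero_iff not_le)
  then show ?thesis
    using v0V n1 unfolding w_def by (intro bexI[of _ v0] exI[of _ t]) auto
qed

text \<open>The orthogonal complement of the eigenvector span inside \<open>V\<close> is again
  invariant; if nonzero it would contain an eigenvector, which would be orthogonal to
  itself.\<close>

lemma symmetric_eigenvectors_span:
  fixes T :: "'a::euclidean_space \<Rightarrow> 'a"
  assumes T: "linear T" and sym: "\<And>x y. inner (T x) y = inner x (T y)"
    and V: "subspace V" and inv: "\<And>v. v \<in> V \<Longrightarrow> T v \<in> V"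
  shows "V \<subseteq> span {v\<in>V. \<exists>t. T v = t *\<^sub>R v}"
proof (rule ccontr)
  define U where "U = span {v\<in>V. \<exists>t. T v = t *\<^sub>R v}"
  assume "\<not> V \<subseteq> span {v\<in>V. \<exists>t. T v = t *\<^sub>R v}"
  then obtain x where x: "x \<in> V" "x \<notin> U" by (auto simp: U_def)
  have UV: "U \<subseteq> V" unfolding U_def by (rule span_minimal) (use V in auto)
  have Uinv: "T u \<in> U" if "u \<in> U" for u
    using that unfolding U_def
  proof (induction rule: span_induct)
    case base
    show ?case using T by (auto simp: subspace_def linear_0 linear_add linear_cmul span_0 span_add span_scale)
  next
    case (step u)
    then obtain t where "T u = t *\<^sub>R u" by blast
    then show ?case using step by (simp add: span_base span_scale)
  qed
  obtain y z where yz: "y \<in> span U" "\<And>w. w \<in> span U \<Longrightarrow> orthogonal z w" "x = y + z"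
    using orthogonal_subspace_decomp_exists[of U x] by blast
  have spU: "span U = U" by (simp add: U_def)
  define V' where "V' = V \<inter> {z. \<forall>u\<in>U. inner z u = 0}"
  have sub': "subspace V'"
    unfolding V'_def by (intro subspace_inter V) (auto simp: subspace_def inner_simps)
  have "z = x - y" using yz by simp
  then have "z \<in> V" using yz(1) x(1) UV spU subspace_diff[OF V] by blast
  then have "z \<in> V'" using yz(2) spU by (simp add: V'_def orthogonal_def)
  moreover have "z \<noteq> 0" using yz x spU by auto
  ultimately have "V' \<noteq> {0}" by blast
  moreover have "T v \<in> V'" if "v \<in> V'" for v
    using that inv Uinv by (auto simp: V'_def sym)
  ultimately obtain v t where v: "v \<in> V'" "v \<noteq> 0" "T v = t *\<^sub>R v"
    using symmetric_eigenvector_exists[OF T sym sub'] by blast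
  then have "v \<in> U" unfolding U_def V'_def by (auto intro: span_base)
  then have "inner v v = 0" using v(1) by (auto simp: V'_def)
  then show False using v(2) by simp
qed

text \<open>Components are indexed by the eigenvalue itself, as a function on all reals that
  vanishes off \<open>\<Lambda>\<close>. Vectors with equal eigenvalue are thereby merged, and
  distinct indices mean distinct eigenvalues.\<close>

lemma symmetric_eigen_decomposition:
  fixes T :: "'a::euclidean_space \<Rightarrow> 'a"
  assumes T: "linear T" and sym: "\<And>x y. inner (T x) y = inner x (T y)"
    and V: "subspace V" and inv: "\<And>v. v \<in> V \<Longrightarrow> T v \<in> V" and x: "x \<in> V"
  shows "\<exists>f \<Lambda>. finite \<Lambda> \<and> (\<forall>t. f t \<in> V \<and> T (f t) = t *\<^sub>R f t) \<and> (\<forall>t. t \<notin> \<Lambda> \<longrightarrow> f t = 0) \<and> x = (\<Sum>t\<in>\<Lambda>. f t)"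
proof -
  have "x \<in> span {v\<in>V. \<exists>t. T v = t *\<^sub>R v}"
    using symmetric_eigenvectors_span[OF T sym V inv] x by blast
  then show ?thesis
  proof (induction rule: span_induct_alt)
    case base
    show ?case by (rule exI[of _ "\<lambda>_. 0"], rule exI[of _ "{}"]) (use V T in \<open>auto simp: subspace_0 linear_0\<close>)
  next
    case (step c v y)
    then obtain f \<Lambda> where f: "finite \<Lambda>" "\<And>t. f t \<in> V" "\<And>t. T (f t) = t *\<^sub>R f t"
      "\<And>t. t \<notin> \<Lambda> \<Longrightarrow> f t = 0" "y = (\<Sum>t\<in>\<Lambda>. f t)" by blast
    obtain m where m: "T v = m *\<^sub>R v" and vV: "v \<in> V" using step by blast
    define g where "g = f(m := f m + c *\<^sub>R v)"
    have "c *\<^sub>R v + y = (\<Sum>t\<in>insert m \<Lambda>. g t)"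
    proof -
      have "(\<Sum>t\<in>insert m \<Lambda>. g t) = g m + (\<Sum>t\<in>\<Lambda> - {m}. g t)"
        using f(1) by (simp add: sum.insert_remove)
      also have "(\<Sum>t\<in>\<Lambda> - {m}. g t) = (\<Sum>t\<in>\<Lambda> - {m}. f t)"
        by (rule sum.cong) (auto simp: g_def)
      also have "g m + \<dots> = c *\<^sub>R v + (f m + (\<Sum>t\<in>\<Lambda> - {m}. f t))" by (simp add: g_def)
      also have "f m + (\<Sum>t\<in>\<Lambda> - {m}. f t) = y"
        using f by (cases "m \<in> \<Lambda>") (auto simp: sum.remove)
      finally show ?thesis by simp
    qed
    moreover have "\<forall>t. g t \<in> V \<and> T (g t) = t *\<^sub>R g t"
      using f vV m V by (auto simp: g_def subspace_add subspace_scale linear_add[OF T] linear_cmul[OF T] algebra_simps)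
    ultimately show ?case
      using f by (intro exI[of _ g] exI[of _ "insert m \<Lambda>"]) (auto simp: g_def)
  qed
qed

section \<open>Power associativity and the spectral theorem inside the Peirce 1-space of an
  idempotent\<close>

context euclidean_jordan begin

text \<open>The zeroth power is \<open>c\<close>, the unit of its own Peirce 1-space, instead of
  \<open>e\<close>. One spectral theorem then serves both \<open>c = e\<close> with arbitrary
  \<open>u\<close> and primitive \<open>c\<close>.\<close>

primrec pw :: "'a \<Rightarrow> 'a \<Rightarrow> nat \<Rightarrow> 'a" where
  "pw c u 0 = c"
| "pw c u (Suc n) = u \<odot> pw c u n"

text \<open>Two-step induction: \<open>u^(n+2) = (u u^n) u\<close> is a triple product, and
  \<open>mult_operator_triple\<close> writes its multiplication operator in terms of those of
  \<open>u u^n\<close>, \<open>u^n\<close>, \<open>u u\<close> and \<open>u\<close>, all of which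
  commute with that of \<open>a\<close>.\<close>

lemma opcomm_pw:
  assumes cu: "c \<odot> u = u" and a: "opcomm a c" "opcomm a u" "opcomm a (u \<odot> u)"
  shows "opcomm a (pw c u n)"
proof (induction n rule: induct_nat_012)
  case 1
  then show ?case using a cu by (simp add: comm)
next
  case (ge2 n)
  define p where "p = pw c u n"
  have p: "opcomm a p" "opcomm a (u \<odot> p)" using ge2 by (auto simp: p_def)
  note [simp] = opcommD[OF p(1)] opcommD[OF p(2)] opcommD[OF a(2)] opcommD[OF a(3)]
  have "pw c u (Suc (Suc n)) = (u \<odot> p) \<odot> u"
    by (simp add: p_def comm)
  moreover have "opcomm a ((u \<odot> p) \<odot> u)"
    unfolding opcomm_def mult_operator_triple comm[of p u] by (simp add: jm_simps)
  ultimately show ?case by simp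
qed (use a in simp)

context
  fixes c u
  assumes c: "c \<odot> c = c" and cu: "c \<odot> u = u"
begin

text \<open>\<open>opcomm_pw\<close> is used twice: with \<open>c\<close>, \<open>u\<close> and
  \<open>u u\<close> as the fixed operator, and then, by symmetry of commutation, with
  \<open>pw c u m\<close> itself.\<close>

lemma opcomm_pw_pw: "opcomm (pw c u m) (pw c u n)"
proof -
  have 1: "opcomm c u" using peirce_opcomm[of c u 1] c cu by simp
  have 2: "opcomm c (u \<odot> u)" using peirce_opcomm_square[of c u 1] cu by simp
  have 3: "opcomm u (u \<odot> u)" by (rule opcomm_square)
  have "opcomm c (pw c u m)" "opcomm u (pw c u m)" "opcomm (u \<odot> u) (pw c u m)"
    using 1 2 3 opcomm_refl opcomm_sym by (auto intro!: opcomm_pw[OF cu])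
  then show ?thesis
    by (intro opcomm_pw[OF cu]) (auto intro: opcomm_sym)
qed

lemma pw_one: "pw c u (Suc 0) = u"
  using cu comm by simp

lemma unit_pw: "c \<odot> pw c u n = pw c u n"
proof (induction n)
  case (Suc n)
  have "opcomm c u" using peirce_opcomm[of c u 1] c cu by simp
  then show ?case using Suc by (simp add: opcommD[of c u])
qed (use c in simp)

text \<open>Commuting operators allow \<open>u^n (u^m u)\<close> to be rearranged to
  \<open>u^m (u^n u)\<close>, which moves one factor from the first power to the second.\<close>

lemma pw_mult: "pw c u m \<odot> pw c u n = pw c u (m + n)"
proof (induction m arbitrary: n)
  case 0
  then show ?case by (simp add: unit_pw)
next
  case (Suc m)
  have "pw c u (Suc m) \<odot> pw c u n = pw c u n \<odot> (pw c u m \<odot> pw c u (Suc 0))"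
    unfolding pw_one by (simp add: comm)
  also have "\<dots> = pw c u m \<odot> (pw c u n \<odot> pw c u (Suc 0))"
    using opcomm_pw_pw opcommD by blast
  also have "pw c u n \<odot> pw c u (Suc 0) = pw c u (Suc n)"
    unfolding pw_one by (simp add: comm)
  finally show ?case by (simp only: Suc.IH add_Suc_right add_Suc)
qed

definition "pw_span = span (range (pw c u))"

lemma pw_span_mult:
  assumes "a \<in> pw_span" "b \<in> pw_span"
  shows "a \<odot> b \<in> pw_span"
proof -
  have 1: "pw c u m \<odot> b \<in> pw_span" for m
    using assms(2) unfolding pw_span_def
  proof (induction rule: span_induct)
    case base
    show ?case by (auto simp: subspace_def jm_simps span_0 span_add span_scale)
  next
    case (step x)
    then show ?case using pw_mult by (auto intro: span_base)
  qed
  show ?thesis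
    using assms(1) unfolding pw_span_def
  proof (induction rule: span_induct)
    case base
    show ?case by (auto simp: subspace_def jm_simps span_0 span_add span_scale)
  next
    case (step x)
    then show ?case using 1 by (auto simp: pw_span_def)
  qed
qed

lemma opcomm_pw_span:
  assumes "a \<in> pw_span" "b \<in> pw_span"
  shows "opcomm a b"
proof -
  have 1: "opcomm (pw c u m) b" for m
    using assms(2) unfolding pw_span_def
  proof (induction rule: span_induct)
    case base
    show ?case by (auto simp: subspace_def jm_simps opcomm_def)
  next
    case (step x)
    then show ?case using opcomm_pw_pw by auto
  qed
  show ?thesis
    using assms(1) unfolding pw_span_def
  proof (induction rule: span_induct)
    case base
    show ?case by (auto simp: subspace_def jm_simps opcomm_def)
  next
    case (step x)
    then show ?case using 1 by auto
  qed
qed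

lemma unit_pw_span: "a \<in> pw_span \<Longrightarrow> c \<odot> a = a"
  unfolding pw_span_def
proof (induction rule: span_induct)
  case base
  show ?case by (auto simp: subspace_def jm_simps)
qed (use unit_pw in auto)

text \<open>The vector split along the eigenspaces of \<open>L(u)\<close> is the unit
  \<open>c\<close>, not \<open>u\<close>. Its components are orthogonal since \<open>L(u)\<close>
  can be moved onto either factor of a product, and multiplying a component by \<open>c\<close>, the
  sum of all of them, shows that it is idempotent.\<close>

lemma spectral_idempotents:
  "\<exists>f \<Lambda>. finite \<Lambda> \<and> (\<forall>t\<in>\<Lambda>. f t \<noteq> 0 \<and> f t \<odot> f t = f t) \<and>
     (\<forall>t\<in>\<Lambda>. \<forall>t'\<in>\<Lambda>. t \<noteq> t' \<longrightarrow> f t \<odot> f t' = 0) \<and> (\<Sum>t\<in>\<Lambda>. f t) = c \<and>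
     u = (\<Sum>t\<in>\<Lambda>. t *\<^sub>R f t)"
proof -
  have V: "subspace pw_span" by (simp add: pw_span_def)
  have cV: "c \<in> pw_span" unfolding pw_span_def by (metis pw.simps(1) rangeI span_base)
  have uV: "u \<in> pw_span" unfolding pw_span_def by (metis pw_one rangeI span_base)
  obtain f \<Lambda> where f: "finite \<Lambda>" "\<And>t. f t \<in> pw_span" "\<And>t. u \<odot> f t = t *\<^sub>R f t"
      "\<And>t. t \<notin> \<Lambda> \<Longrightarrow> f t = 0" "c = (\<Sum>t\<in>\<Lambda>. f t)"
    using symmetric_eigen_decomposition[OF linear_jm _ V _ cV, of u] uV pw_span_mult inner_jm
    by (metis (no_types) inner_commute)
  have orth: "f t \<odot> f t' = 0" if "t \<noteq> t'" for t t'
  proof -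
    have "t *\<^sub>R (f t \<odot> f t') = f t' \<odot> (u \<odot> f t)"
      unfolding f(3) by (simp add: jm_simps comm)
    also have "\<dots> = u \<odot> (f t \<odot> f t')"
      unfolding comm[of "f t"] using opcommD[OF opcomm_pw_span[OF f(2)[of t'] uV]] by simp
    also have "\<dots> = f t \<odot> (u \<odot> f t')"
      using opcommD[OF opcomm_pw_span[OF f(2)[of t] uV]] by simp
    also have "\<dots> = t' *\<^sub>R (f t \<odot> f t')"
      unfolding f(3) by (simp add: jm_simps)
    finally show ?thesis using that by auto
  qed
  have idem: "f t \<odot> f t = f t" for t
  proof (cases "t \<in> \<Lambda>")
    case True
    have "f t = f t \<odot> (\<Sum>t\<in>\<Lambda>. f t)" using unit_pw_span[OF f(2)] f(5) comm by metis
    also have "\<dots> = (\<Sum>t'\<in>\<Lambda>. if t' = t then f t \<odot> f t else 0)"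
      unfolding jm_sum by (rule sum.cong) (auto simp: orth)
    also have "\<dots> = f t \<odot> f t" using True f(1) by simp
    finally show ?thesis by simp
  qed (use f in simp)
  define \<Lambda>' where "\<Lambda>' = {t\<in>\<Lambda>. f t \<noteq> 0}"
  have sum': "(\<Sum>t\<in>\<Lambda>'. f t) = c"
    unfolding f(5) \<Lambda>'_def using f(1) by (intro sum.mono_neutral_left) auto
  have "u = u \<odot> c" using cu comm by simp
  also have "\<dots> = (\<Sum>t\<in>\<Lambda>'. t *\<^sub>R f t)"
    unfolding sum'[symmetric] jm_sum f(3) ..
  finally have "u = (\<Sum>t\<in>\<Lambda>'. t *\<^sub>R f t)" .
  then show ?thesis
    using f(1) orth idem sum' by (intro exI[of _ f] exI[of _ \<Lambda>']) (auto simp: \<Lambda>'_def)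
qed

end

end

section \<open>Jordan frames and their norms\<close>

context euclidean_jordan begin

lemma jm_orth_sum:
  assumes "\<And>j. j \<in> A \<Longrightarrow> j \<noteq> i \<Longrightarrow> f i \<odot> f j = 0" "f i \<odot> f i = f i" "finite A"
  shows "f i \<odot> (\<Sum>j\<in>A. f j) = (if i \<in> A then f i else 0)"
proof -
  have "f i \<odot> (\<Sum>j\<in>A. f j) = (\<Sum>j\<in>A. if j = i then f i else 0)"
    unfolding jm_sum using assms by (intro sum.cong) auto
  then show ?thesis using assms(3) by simp
qed

lemma idem_orth_sum:
  assumes "\<And>i j. i \<in> A \<Longrightarrow> j \<in> A \<Longrightarrow> i \<noteq> j \<Longrightarrow> f i \<odot> f j = 0" "\<And>i. i \<in> A \<Longrightarrow> f i \<odot> f i = f i" "finite A"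
  shows "(\<Sum>j\<in>A. f j) \<odot> (\<Sum>j\<in>A. f j) = (\<Sum>j\<in>A. f j)"
  unfolding sum_jm[of f A] using assms by (intro sum.cong) (auto simp: jm_orth_sum)

lemma primitiveD:
  assumes "primitive_idempotent jm c"
  shows "c \<odot> c = c" "c \<noteq> 0"
    "\<And>a b. a \<odot> a = a \<Longrightarrow> b \<odot> b = b \<Longrightarrow> a \<odot> b = 0 \<Longrightarrow> c = a + b \<Longrightarrow> a = 0 \<or> b = 0"
  using assms unfolding primitive_idempotent_def idempotent_def by blast+

text \<open>The spectral idempotents of \<open>u\<close> within the Peirce 1-space of
  \<open>c\<close> add up to \<open>c\<close>, so primitivity leaves room for only one.\<close>

lemma primitive_peirce_one:
  assumes p: "primitive_idempotent jm c" and u: "c \<odot> u = u"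
  shows "\<exists>t. u = t *\<^sub>R c"
proof -
  obtain f \<Lambda> where f: "finite \<Lambda>" "\<And>t. t\<in>\<Lambda> \<Longrightarrow> f t \<noteq> 0" "\<And>t. t\<in>\<Lambda> \<Longrightarrow> f t \<odot> f t = f t"
    "\<And>t t'. t\<in>\<Lambda> \<Longrightarrow> t'\<in>\<Lambda> \<Longrightarrow> t \<noteq> t' \<Longrightarrow> f t \<odot> f t' = 0" "(\<Sum>t\<in>\<Lambda>. f t) = c"
    "u = (\<Sum>t\<in>\<Lambda>. t *\<^sub>R f t)"
    using spectral_idempotents[OF primitiveD(1)[OF p] u] by blast
  have "\<Lambda> \<noteq> {}" using f(5) primitiveD(2)[OF p] by auto
  then obtain t where t: "t \<in> \<Lambda>" by blast
  define b where "b = (\<Sum>t\<in>\<Lambda> - {t}. f t)"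
  have c: "c = f t + b" using f(1,5) t by (simp add: b_def sum.remove)
  have "b \<odot> b = b" unfolding b_def by (rule idem_orth_sum) (use f in auto)
  moreover have "f t \<odot> b = 0" unfolding b_def using f t by (subst jm_orth_sum) auto
  ultimately have b0: "b = 0" using primitiveD(3)[OF p f(3)[OF t] _ _ c] f(2)[OF t] by blast
  have "\<Lambda> - {t} = {}"
  proof (rule ccontr)
    assume "\<Lambda> - {t} \<noteq> {}"
    then obtain t' where t': "t' \<in> \<Lambda> - {t}" by blast
    then have "f t' \<odot> b = f t'" unfolding b_def using f by (subst jm_orth_sum) auto
    then show False using b0 f(2)[of t'] t' by auto
  qed
  then have "\<Lambda> = {t}" using t by blast
  then show ?thesis using f(5,6) by auto
qed

lemma peirce_orth:
  assumes "c \<odot> a = s *\<^sub>R a" "c \<odot> b = t *\<^sub>R b" "s \<noteq> t"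
  shows "inner a b = 0"
proof -
  have "s * inner a b = t * inner a b"
    using inner_jm[of c a b] assms by simp
  then show ?thesis using assms(3) by simp
qed

text \<open>The components come from the Lagrange polynomials \<open>2T^2 - T\<close>,
  \<open>4T - 4T^2\<close> and \<open>1 - 3T + 2T^2\<close> for the nodes 1, 1/2 and 0, evaluated at
  \<open>T = L(c)\<close>.\<close>

lemma peirce_decomposition:
  assumes c: "c \<odot> c = c"
  obtains x1 xh x0 where "x = x1 + xh + x0" "c \<odot> x1 = x1" "c \<odot> xh = (1/2) *\<^sub>R xh" "c \<odot> x0 = 0"
proof
  note i = idem_operator[OF c, of x]
  have j: "c \<odot> (c \<odot> (c \<odot> x)) = (1/2) *\<^sub>R (3 *\<^sub>R (c \<odot> (c \<odot> x)) - c \<odot> x)"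
    unfolding i[symmetric] by simp
  show "x = (2 *\<^sub>R (c \<odot> (c \<odot> x)) - c \<odot> x) + (4 *\<^sub>R (c \<odot> x) - 4 *\<^sub>R (c \<odot> (c \<odot> x)))
      + (x - 3 *\<^sub>R (c \<odot> x) + 2 *\<^sub>R (c \<odot> (c \<odot> x)))" (is "_ = ?s")
  proof -
    have "inner x u = inner ?s u" for u by (simp add: inner_simps)
    then show ?thesis by (metis vector_eq_rdot)
  qed
  show "c \<odot> (2 *\<^sub>R (c \<odot> (c \<odot> x)) - c \<odot> x) = 2 *\<^sub>R (c \<odot> (c \<odot> x)) - c \<odot> x" (is "?l = ?r")
  proof -
    have "inner ?l u = inner ?r u" for u by (simp add: jm_simps j inner_simps)
    then show ?thesis by (metis vector_eq_rdot)
  qed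
  show "c \<odot> (4 *\<^sub>R (c \<odot> x) - 4 *\<^sub>R (c \<odot> (c \<odot> x))) = (1/2) *\<^sub>R (4 *\<^sub>R (c \<odot> x) - 4 *\<^sub>R (c \<odot> (c \<odot> x)))" (is "?l = ?r")
  proof -
    have "inner ?l u = inner ?r u" for u by (simp add: jm_simps j inner_simps)
    then show ?thesis by (metis vector_eq_rdot)
  qed
  show "c \<odot> (x - 3 *\<^sub>R (c \<odot> x) + 2 *\<^sub>R (c \<odot> (c \<odot> x))) = 0" (is "?l = _")
  proof -
    have "inner ?l u = inner 0 u" for u by (simp add: jm_simps j inner_simps)
    then show ?thesis by (metis vector_eq_rdot)
  qed
qed

lemma idem_psd:
  assumes c: "c \<odot> c = c"
  shows "0 \<le> inner x (c \<odot> x)"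
proof -
  obtain x1 xh x0 where x: "x = x1 + xh + x0" "c \<odot> x1 = x1" "c \<odot> xh = (1/2) *\<^sub>R xh" "c \<odot> x0 = 0"
    using peirce_decomposition[OF c] by metis
  have "inner x1 xh = 0" "inner xh x0 = 0" "inner x1 x0 = 0"
    using peirce_orth[of c x1 1 xh "1/2"] peirce_orth[of c xh "1/2" x0 0] peirce_orth[of c x1 1 x0 0] x by auto
  then have "inner x (c \<odot> x) = inner x1 x1 + inner xh xh / 2"
    using x by (simp add: jm_simps inner_simps inner_commute)
  then show ?thesis by simp
qed

text \<open>\<open>v^2\<close> lies in the Peirce 1-space of \<open>a + b\<close> and equals
  \<open>\<alpha> a + \<beta> b\<close>. Symmetry of multiplication gives
  \<open>\<alpha> |a|^2 = |v|^2 / 2 = \<beta> |b|^2\<close>, and the Jordan identity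
  \<open>v (v^2 v) = v^2 v^2\<close>, compared at \<open>a\<close>, gives
  \<open>\<alpha> = \<beta>\<close>.\<close>

lemma connected_primitives_norm:
  assumes a: "primitive_idempotent jm a" and b: "primitive_idempotent jm b" and ab: "a \<odot> b = 0"
    and va: "a \<odot> v = (1/2) *\<^sub>R v" and vb: "b \<odot> v = (1/2) *\<^sub>R v" and v: "v \<noteq> 0"
  shows "inner a a = inner b b"
proof -
  note aa = primitiveD(1)[OF a] and bb = primitiveD(1)[OF b]
  have "a \<odot> ((v \<odot> v) \<odot> a) = (v \<odot> v) \<odot> a" "b \<odot> ((v \<odot> v) \<odot> b) = (v \<odot> v) \<odot> b"
    using opcommD[OF peirce_opcomm_square[OF va], of a] opcommD[OF peirce_opcomm_square[OF vb], of b] aa bb by auto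
  then obtain \<alpha> \<beta> where \<alpha>: "a \<odot> (v \<odot> v) = \<alpha> *\<^sub>R a" and \<beta>: "b \<odot> (v \<odot> v) = \<beta> *\<^sub>R b"
    using primitive_peirce_one[OF a, of "(v \<odot> v) \<odot> a"] primitive_peirce_one[OF b, of "(v \<odot> v) \<odot> b"] comm by metis
  have "(a + b) \<odot> (a + b) = a + b" using aa bb ab comm[of b a] by (simp add: jm_simps)
  moreover have ab_v: "(a + b) \<odot> v = v" using va vb by (simp add: jm_simps flip: scaleR_add_left)
  ultimately have "opcomm (a + b) v" using peirce_opcomm[of "a + b" v 1] by simp
  then have "(a + b) \<odot> (v \<odot> v) = v \<odot> v" using ab_v opcommD by metis
  then have vv: "v \<odot> v = \<alpha> *\<^sub>R a + \<beta> *\<^sub>R b" using \<alpha> \<beta> by (simp add: jm_simps)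
  have ina: "\<alpha> * inner a a = inner v v / 2"
    using inner_jm[of v v a] va vv orthogonal_idem_inner[OF aa ab]
    by (simp add: inner_simps comm[of v a] inner_commute)
  have inb: "\<beta> * inner b b = inner v v / 2"
    using inner_jm[of v v b] vb vv orthogonal_idem_inner[OF aa ab]
    by (simp add: inner_simps comm[of v b] inner_commute)
  have "\<alpha> * inner a a > 0" unfolding ina using v by simp
  then have \<alpha>0: "\<alpha> \<noteq> 0" "inner a a \<noteq> 0" by auto
  have "v \<odot> v \<odot> v = ((\<alpha> + \<beta>) / 2) *\<^sub>R v"
    unfolding vv using va vb by (simp add: jm_simps algebra_simps add_divide_distrib)
  then have "((\<alpha> + \<beta>) / 2) *\<^sub>R (v \<odot> v) = (v \<odot> v) \<odot> (v \<odot> v)"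
    using jordan_identity[of v v] by (simp add: jm_simps)
  also have "\<dots> = (\<alpha>\<^sup>2) *\<^sub>R a + (\<beta>\<^sup>2) *\<^sub>R b"
    unfolding vv using aa bb ab comm[of b a] by (simp add: jm_simps power2_eq_square)
  finally have "inner (((\<alpha> + \<beta>) / 2) *\<^sub>R (v \<odot> v)) a = inner ((\<alpha>\<^sup>2) *\<^sub>R a + (\<beta>\<^sup>2) *\<^sub>R b) a" by simp
  then have "((\<alpha> + \<beta>) / 2) * (\<alpha> * inner a a) = \<alpha>\<^sup>2 * inner a a"
    unfolding vv using orthogonal_idem_inner[OF aa ab] by (simp add: inner_simps inner_commute[of b a])
  then have "((\<alpha> + \<beta>) / 2) * (\<alpha> * inner a a) = \<alpha> * (\<alpha> * inner a a)"
    by (simp add: power2_eq_square)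
  then have "(\<alpha> + \<beta>) / 2 = \<alpha>" using \<alpha>0 by simp
  then have "\<alpha> = \<beta>" by simp
  then show ?thesis using ina inb \<alpha>0 by (metis mult_left_cancel)
qed

text \<open>In \<open>a (b x)\<close> only the Peirce-1/2 part of \<open>x\<close> with respect to
  \<open>a\<close> survives: \<open>L(a)\<close> commutes with \<open>L(b)\<close> and kills the
  0-part, while \<open>b\<close> annihilates the 1-part \<open>w\<close>.\<close>

lemma orth_idem_half_component:
  assumes a: "a \<odot> a = a" and ab: "a \<odot> b = 0"
  shows "a \<odot> (a \<odot> (b \<odot> x)) = (1/2) *\<^sub>R (a \<odot> (b \<odot> x))"
proof -
  have oc: "opcomm a b" using peirce_opcomm[of a b 0] a ab by simp
  define w where "w = 2 *\<^sub>R (a \<odot> (a \<odot> x)) - a \<odot> x"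
  have "inner (a \<odot> w) u = inner w u" for u
    using arg_cong[OF idem_operator[OF a, of x], of "\<lambda>v. inner v u"] unfolding w_def
    by (simp add: jm_simps inner_simps)
  then have "a \<odot> w = w" by (metis vector_eq_rdot)
  then have "w \<odot> b = 0" using peirce_one_zero[OF a _ ab] by blast
  then have "2 *\<^sub>R (b \<odot> (a \<odot> (a \<odot> x))) = b \<odot> (a \<odot> x)"
    unfolding comm[of w b] by (simp add: w_def jm_simps)
  then show ?thesis using opcommD[OF oc] by (metis (no_types) scaleR_half_double scaleR_2 scaleR_scaleR scaleR_add_right)
qed

text \<open>Evaluating the norm of \<open>c \<odot> d\<close> as \<open>\<langle>d, c(cd)\<rangle>\<close> and as \<open>\<langle>c, d(dc)\<rangle>\<close> gives \<open>P(c)d = tc\<close> and \<open>P(d)c = td\<close>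
  with the same \<open>t\<close>.\<close>
lemma nonorthogonal_primitives_norm:
  assumes c: "primitive_idempotent jm c" and d: "primitive_idempotent jm d" and cd: "inner c d \<noteq> 0"
  shows "inner c c = inner d d"
proof -
  have E1: "\<exists>t. a \<odot> (a \<odot> x) = (1/2) *\<^sub>R (t *\<^sub>R a + a \<odot> x)" if a: "primitive_idempotent jm a" for a x
  proof -
    define w where "w = 2 *\<^sub>R (a \<odot> (a \<odot> x)) - a \<odot> x"
    have "inner (a \<odot> w) u = inner w u" for u
      using arg_cong[OF idem_operator[OF primitiveD(1)[OF a], of x], of "\<lambda>v. inner v u"] unfolding w_def
      by (simp add: jm_simps inner_simps)
    then have "a \<odot> w = w" by (metis vector_eq_rdot)
    then obtain t where "w = t *\<^sub>R a" using primitive_peirce_one[OF a] by blast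
    then have "t *\<^sub>R a + a \<odot> x = 2 *\<^sub>R (a \<odot> (a \<odot> x))" unfolding w_def by (metis diff_add_cancel)
    then show ?thesis by (intro exI[of _ t]) simp
  qed
  note cc = primitiveD(1)[OF c] and dd = primitiveD(1)[OF d]
  obtain t where t: "c \<odot> (c \<odot> d) = (1/2) *\<^sub>R (t *\<^sub>R c + c \<odot> d)" using E1[OF c] by blast
  obtain t' where t': "d \<odot> (d \<odot> c) = (1/2) *\<^sub>R (t' *\<^sub>R d + d \<odot> c)" using E1[OF d] by blast
  have "inner c (c \<odot> (c \<odot> d)) = inner c d" "inner d (d \<odot> (d \<odot> c)) = inner c d"
    using inner_idem[OF cc] inner_idem[OF dd] by (metis inner_commute)+
  then have tt: "t * inner c c = inner c d" "t' * inner d d = inner c d"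
    unfolding t t' using inner_idem[OF cc, of d] inner_idem[OF dd, of c]
    by (simp_all add: inner_simps inner_commute)
  have "inner (c \<odot> d) (c \<odot> d) = inner d (c \<odot> (c \<odot> d))" by (rule inner_jm)
  also have "\<dots> = (t + 1) / 2 * inner c d"
    unfolding t using inner_idem[OF dd, of c] by (simp add: inner_simps inner_commute comm[of c d] algebra_simps)
  finally have 1: "inner (c \<odot> d) (c \<odot> d) = (t + 1) / 2 * inner c d" .
  have "inner (d \<odot> c) (d \<odot> c) = inner c (d \<odot> (d \<odot> c))" by (rule inner_jm)
  also have "\<dots> = (t' + 1) / 2 * inner c d"
    unfolding t' using inner_idem[OF cc, of d] by (simp add: inner_simps inner_commute comm[of d c] algebra_simps)
  finally have "(t + 1) / 2 * inner c d = (t' + 1) / 2 * inner c d" using 1 by (simp add: comm)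
  then have "t = t'" using cd by simp
  then show ?thesis using tt cd by (metis mult_left_cancel mult_zero_left)
qed

section \<open>Complete systems of orthogonal idempotents and their refinement to frames\<close>

definition orth_system :: "nat \<Rightarrow> (nat \<Rightarrow> 'a) \<Rightarrow> bool" where
  "orth_system m d \<longleftrightarrow> (\<forall>i\<in>{1..m}. d i \<noteq> 0 \<and> d i \<odot> d i = d i) \<and>
     (\<forall>i\<in>{1..m}. \<forall>j\<in>{1..m}. i \<noteq> j \<longrightarrow> d i \<odot> d j = 0) \<and> (\<Sum>i\<in>{1..m}. d i) = e"

lemma orth_system_bound:
  assumes "orth_system m d" shows "m \<le> DIM('a)"
proof -
  have d: "\<And>i. i\<in>{1..m} \<Longrightarrow> d i \<noteq> 0" "\<And>i. i\<in>{1..m} \<Longrightarrow> d i \<odot> d i = d i"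
    "\<And>i j. i\<in>{1..m} \<Longrightarrow> j\<in>{1..m} \<Longrightarrow> i \<noteq> j \<Longrightarrow> d i \<odot> d j = 0"
    using assms by (auto simp: orth_system_def)
  have "inj_on d {1..m}"
    by (rule inj_onI, rule ccontr) (metis d)
  then have "card (d ` {1..m}) = m" by (simp add: card_image)
  moreover have "pairwise orthogonal (d ` {1..m})"
    unfolding pairwise_def orthogonal_def using d orthogonal_idem_inner by auto blast
  then have "independent (d ` {1..m})"
    by (rule pairwise_orthogonal_independent) (use d in auto)
  ultimately show ?thesis using independent_bound by force
qed

lemma orth_system_exists:
  "\<exists>m d l. orth_system m d \<and> x = (\<Sum>i\<in>{1..m}. l i *\<^sub>R d i)"
proof -
  obtain f \<Lambda> where f: "finite \<Lambda>" "\<And>t. t\<in>\<Lambda> \<Longrightarrow> f t \<noteq> 0" "\<And>t. t\<in>\<Lambda> \<Longrightarrow> f t \<odot> f t = f t"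
    "\<And>t t'. t\<in>\<Lambda> \<Longrightarrow> t'\<in>\<Lambda> \<Longrightarrow> t \<noteq> t' \<Longrightarrow> f t \<odot> f t' = 0" "(\<Sum>t\<in>\<Lambda>. f t) = e"
    "x = (\<Sum>t\<in>\<Lambda>. t *\<^sub>R f t)"
    using spectral_idempotents[OF unit[of e] unit[of x]] by blast
  obtain l where l: "bij_betw l {1..card \<Lambda>} \<Lambda>"
    using f(1) ex_bij_betw_nat_finite_1 by blast
  have "orth_system (card \<Lambda>) (f \<circ> l)"
    unfolding orth_system_def o_def
  proof (intro conjI ballI impI)
    fix i j assume "i \<in> {1..card \<Lambda>}" "j \<in> {1..card \<Lambda>}" "i \<noteq> j"
    then show "f (l i) \<odot> f (l j) = 0"
      using bij_betwE[OF l] inj_onD[OF bij_betw_imp_inj_on[OF l]] by (intro f(4)) blast+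
  next
    show "(\<Sum>i\<in>{1..card \<Lambda>}. f (l i)) = e"
      using sum.reindex_bij_betw[OF l, of f] f(5) by simp
  qed (use f(2,3) bij_betwE[OF l] in blast)+
  moreover have "x = (\<Sum>i\<in>{1..card \<Lambda>}. l i *\<^sub>R (f \<circ> l) i)"
    using f(6) sum.reindex_bij_betw[OF l, of "\<lambda>t. t *\<^sub>R f t"] by simp
  ultimately show ?thesis by blast
qed

text \<open>A splitting \<open>d i = a + b\<close> puts \<open>a\<close> in slot \<open>i\<close>
  and \<open>b\<close> in the new slot, both with the coefficient \<open>l i\<close>, so
  \<open>x\<close> does not change. Orthogonality to the other members holds because
  \<open>a\<close> and \<open>b\<close> lie in the Peirce 1-space of \<open>d i\<close> and the
  others in its 0-space.\<close>

lemma orth_system_refine: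
  assumes d: "orth_system m d" and x: "x = (\<Sum>i\<in>{1..m}. l i *\<^sub>R d i)" and i: "i \<in> {1..m}"
    and ni: "\<not> primitive_idempotent jm (d i)"
  shows "\<exists>d l. orth_system (Suc m) d \<and> x = (\<Sum>i\<in>{1..Suc m}. l i *\<^sub>R d i)"
proof -
  note D = d[unfolded orth_system_def]
  obtain a b where ab: "a \<odot> a = a" "b \<odot> b = b" "a \<noteq> 0" "b \<noteq> 0" "a \<odot> b = 0" "d i = a + b"
    using ni D i unfolding primitive_idempotent_def idempotent_def by blast
  have ba: "b \<odot> a = 0" using ab comm by metis
  have "d i \<odot> a = a" "d i \<odot> b = b" using ab ba by (auto simp: jm_simps)
  then have orth: "a \<odot> d j = 0" "b \<odot> d j = 0" if "j \<in> {1..m}" "j \<noteq> i" for j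
    using peirce_one_zero[of "d i" _ "d j"] D i that by auto
  then have orth': "d j \<odot> a = 0" "d j \<odot> b = 0" if "j \<in> {1..m}" "j \<noteq> i" for j
    using that comm by metis+
  define d' where "d' = d(i := a, Suc m := b)"
  define l' where "l' = l(Suc m := l i)"
  have split2: "(\<Sum>j\<in>{1..m}. g j) = g i + (\<Sum>j\<in>{1..m} - {i}. g j)" for g :: "nat \<Rightarrow> 'a"
    by (rule sum.remove[OF _ i]) simp
  have split: "(\<Sum>j\<in>{1..Suc m}. g j) = g i + (\<Sum>j\<in>{1..m} - {i}. g j) + g (Suc m)" for g :: "nat \<Rightarrow> 'a"
    unfolding split2[symmetric] by simp
  have "(\<Sum>j\<in>{1..Suc m}. d' j) = (\<Sum>j\<in>{1..m}. d j)"
    unfolding split split2 using i ab(6) by (auto simp: d'_def intro!: sum.cong)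
  moreover have "(\<Sum>j\<in>{1..Suc m}. l' j *\<^sub>R d' j) = x"
    unfolding split split2 x using i ab(6) by (auto simp: d'_def l'_def algebra_simps intro!: sum.cong)
  moreover have "d' j \<noteq> 0 \<and> d' j \<odot> d' j = d' j" if "j \<in> {1..Suc m}" for j
    using that D ab i by (auto simp: d'_def)
  moreover have "d' j \<odot> d' j' = 0" if "j \<in> {1..Suc m}" "j' \<in> {1..Suc m}" "j \<noteq> j'" for j j'
    using that D ab ba orth orth' by (auto simp: d'_def)
  ultimately show ?thesis
    using D by (intro exI[of _ d'] exI[of _ l']) (simp add: orth_system_def)
qed

text \<open>A longest system that still represents \<open>x\<close> cannot be refined, so its
  members are primitive. At this stage the length may still depend on \<open>x\<close>.\<close>

lemma spectral_decomp_some_rank: "\<exists>m l d. spectral_decomp jm e m x l d"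
proof -
  define P where "P m \<longleftrightarrow> (\<exists>d l. orth_system m d \<and> x = (\<Sum>i\<in>{1..m}. l i *\<^sub>R d i))" for m
  have ex: "\<exists>m. P m" using orth_system_exists by (auto simp: P_def)
  have bd: "\<forall>m. P m \<longrightarrow> m \<le> DIM('a)" using orth_system_bound by (auto simp: P_def)
  define m where "m = (GREATEST m. P m)"
  have m: "P m" unfolding m_def using GreatestI_ex_nat[OF ex] bd by blast
  have mx: "\<not> P (Suc m)" unfolding m_def using Greatest_le_nat[of P] bd
    by (metis m_def not_less_eq_eq order_refl)
  obtain d l where d: "orth_system m d" "x = (\<Sum>i\<in>{1..m}. l i *\<^sub>R d i)" using m by (auto simp: P_def)
  have "primitive_idempotent jm (d i)" if "i \<in> {1..m}" for i
    using orth_system_refine[OF d that] mx by (auto simp: P_def)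
  then have "spectral_decomp jm e m x l d"
    using d by (auto simp: spectral_decomp_def jordan_frame_def orth_system_def)
  then show ?thesis by blast
qed

end

section \<open>Simplicity: one norm for all members of a frame, one size for all frames\<close>

locale simple_euclidean_jordan = euclidean_jordan jm e
  for jm :: "'a::euclidean_space \<Rightarrow> 'a \<Rightarrow> 'a" (infixl "\<odot>" 70) and e :: 'a +
  assumes simple: "simple_eja jm e"
begin

lemma e_nonzero: "e \<noteq> 0"
proof
  assume "e = 0"
  then have "x = 0" for x :: 'a using unit[of x] by simp
  then show False using simple unfolding simple_eja_def by auto
qed

lemma frameD:
  assumes "jordan_frame jm e m d"
  shows "i \<in> {1..m} \<Longrightarrow> primitive_idempotent jm (d i)" "i \<in> {1..m} \<Longrightarrow> d i \<odot> d i = d i"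
    "i \<in> {1..m} \<Longrightarrow> d i \<noteq> 0"
    "i \<in> {1..m} \<Longrightarrow> j \<in> {1..m} \<Longrightarrow> i \<noteq> j \<Longrightarrow> d i \<odot> d j = 0" "(\<Sum>i\<in>{1..m}. d i) = e"
  using assms unfolding jordan_frame_def by (auto simp: primitiveD)

text \<open>Peirce spaces between frame elements of different norm vanish, so the frame elements of one given norm
  add up to an idempotent whose Peirce-1 space is an ideal.\<close>
lemma frame_norm_eq:
  assumes d: "jordan_frame jm e m d" and ij: "i \<in> {1..m}" "j \<in> {1..m}"
  shows "inner (d i) (d i) = inner (d j) (d j)"
proof -
  note D = frameD[OF d]
  define I where "I = {k \<in> {1..m}. inner (d k) (d k) = inner (d i) (d i)}"
  define p where "p = (\<Sum>k\<in>I. d k)"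
  define q where "q = (\<Sum>k\<in>{1..m} - I. d k)"
  have I: "I \<subseteq> {1..m}" "finite I" by (auto simp: I_def)
  have pq: "p + q = e" unfolding p_def q_def D(5)[symmetric]
    using sum.subset_diff[OF I(1), of d] by simp
  have pp: "p \<odot> p = p" unfolding p_def 
    by (rule idem_orth_sum) (use D(2)[OF subsetD[OF I(1)]] D(4)[OF subsetD[OF I(1)] subsetD[OF I(1)]] I(2) in auto)
  have half0: "x = 0" if x: "p \<odot> x = (1/2) *\<^sub>R x" for x
  proof -
    have zero: "d a \<odot> (d b \<odot> x) = 0" if "a \<in> I" "b \<in> {1..m} - I" for a b
    proof (rule ccontr)
      define v where "v = d a \<odot> (d b \<odot> x)"
      assume "d a \<odot> (d b \<odot> x) \<noteq> 0"
      then have "v \<noteq> 0" by (simp add: v_def)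
      have A: "a \<in> {1..m}" "b \<in> {1..m}" "a \<noteq> b" using that I by auto
      have ab: "d a \<odot> d b = 0" "d b \<odot> d a = 0" using D(4) A by auto
      have "d a \<odot> v = (1/2) *\<^sub>R v"
        unfolding v_def by (rule orth_idem_half_component) (use D A ab in auto)
      moreover have "v = d b \<odot> (d a \<odot> x)"
        unfolding v_def by (rule opcommD, rule peirce_opcomm[of "d a" "d b" 0]) (use D(2) A ab in auto)
      then have "d b \<odot> v = (1/2) *\<^sub>R v"
        using orth_idem_half_component[of "d b" "d a" x] D A ab by auto
      ultimately have "inner (d a) (d a) = inner (d b) (d b)"
        using connected_primitives_norm[OF D(1)[OF A(1)] D(1)[OF A(2)] ab(1)] \<open>v \<noteq> 0\<close> by blast
      then show False using that by (auto simp: I_def)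
    qed
    have "p \<odot> (q \<odot> x) = 0"
      unfolding p_def q_def by (simp add: jm_sum sum_jm zero)
    moreover have "q \<odot> x = (1/2) *\<^sub>R x"
    proof -
      have "q \<odot> x = x - p \<odot> x" using pq by (metis add_diff_cancel_left' bilinear_lsub[OF bilin] unit)
      also have "\<dots> = (1/2) *\<^sub>R x" unfolding x by (simp add: scaleR_left_diff_distrib[of 1 "1/2" x, simplified, symmetric])
      finally show ?thesis .
    qed
    ultimately show "x = 0" using x by (simp add: jm_simps)
  qed
  have "jordan_ideal jm {x. p \<odot> x = x}"
    unfolding jordan_ideal_def
  proof (intro conjI ballI allI)
    show "subspace {x. p \<odot> x = x}" by (auto simp: subspace_def jm_simps)
  next
    fix x y assume "x \<in> {x. p \<odot> x = x}"
    then have x: "p \<odot> x = x" by simp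
    obtain y1 yh y0 where y: "y = y1 + yh + y0" "p \<odot> y1 = y1" "p \<odot> yh = (1/2) *\<^sub>R yh" "p \<odot> y0 = 0"
      using peirce_decomposition[OF pp] by metis
    have "yh = 0" using half0 y(3) by blast
    moreover have "x \<odot> y0 = 0" using peirce_one_zero[OF pp x y(4)] .
    ultimately have "x \<odot> y = x \<odot> y1" using y(1) by (simp add: jm_simps)
    moreover have "opcomm p x" using peirce_opcomm[of p x 1] pp x by simp
    ultimately show "x \<odot> y \<in> {x. p \<odot> x = x}" 
      using opcommD[of p x y1] y(2) by simp
  qed
  moreover have dp: "d k \<odot> p = (if k \<in> I then d k else 0)" if "k \<in> {1..m}" for k
    unfolding p_def
    by (rule jm_orth_sum) (use D(2)[OF that] D(4)[OF that subsetD[OF I(1)]] I(2) in auto)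
  have "d i \<in> {x. p \<odot> x = x}"
  proof -
    have "d i \<odot> p = d i" using dp[OF ij(1)] ij(1) by (simp add: I_def)
    then show ?thesis by (simp add: comm)
  qed
  then have "{x. p \<odot> x = x} \<noteq> {0}" using D(3)[OF ij(1)] by blast
  ultimately have "{x. p \<odot> x = x} = UNIV" using simple unfolding simple_eja_def by blast
  then have "p \<odot> d j = d j" by blast
  then have "d j \<odot> p \<noteq> 0" using D(3)[OF ij(2)] comm by metis
  then have "j \<in> I" using dp[OF ij(2)] by (auto split: if_splits)
  then show ?thesis by (auto simp: I_def)
qed

text \<open>\<open>inner (d j) e\<close> is the squared norm of \<open>d j\<close>, and these all
  agree, so the size of a frame can be read off from the norm of any member.\<close>

lemma frame_norm:
  assumes d: "jordan_frame jm e m d" and i: "i \<in> {1..m}"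
  shows "real m * inner (d i) (d i) = inner e e"
proof -
  have "inner e e = (\<Sum>j\<in>{1..m}. inner (d j) e)"
    using frameD(5)[OF d] by (metis inner_sum_left)
  also have "\<dots> = (\<Sum>j\<in>{1..m}. inner (d i) (d i))"
    using frame_norm_eq[OF d i] idem_norm frameD(2)[OF d] by (intro sum.cong) auto
  finally show ?thesis by simp
qed

text \<open>Some \<open>d j\<close> is not orthogonal to \<open>c 1\<close>, because the
  \<open>d j\<close> add up to \<open>e\<close> and \<open>inner (c 1) e\<close> is nonzero. Such a
  pair has equal norms, and \<open>frame_norm\<close> turns this into equal sizes.\<close>

lemma frame_size_unique:
  assumes c: "jordan_frame jm e r c" and d: "jordan_frame jm e m d"
  shows "m = r"
proof -
  have "r \<noteq> 0" using frameD(5)[OF c] e_nonzero by (cases r) auto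
  then have 1: "1 \<in> {1..r}" by simp
  have "inner (c 1) e = (\<Sum>j\<in>{1..m}. inner (c 1) (d j))"
    using frameD(5)[OF d] by (metis inner_sum_right)
  moreover have "inner (c 1) e \<noteq> 0"
    using idem_norm frameD(2,3)[OF c 1] by simp
  ultimately obtain j where j: "j \<in> {1..m}" "inner (c 1) (d j) \<noteq> 0"
    by (metis (mono_tags, lifting) sum.neutral)
  have "inner (c 1) (c 1) = inner (d j) (d j)"
    using nonorthogonal_primitives_norm frameD(1)[OF c 1] frameD(1)[OF d j(1)] j(2) by blast
  moreover have "inner (d j) (d j) \<noteq> 0" using frameD(3)[OF d j(1)] by simp
  ultimately show ?thesis
    using frame_norm[OF c 1] frame_norm[OF d j(1)] by (metis mult_right_cancel of_nat_eq_iff)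
qed

end

section \<open>Eigenvalues, invertible elements and the symmetric cone\<close>

context euclidean_jordan begin

lemma jm_norm_bound: "\<exists>K>0. \<forall>x y. norm (x \<odot> y) \<le> K * norm x * norm y"
  using bounded_bilinear.pos_bounded[OF bounded_bilinear_jm] by (simp add: mult_ac)

lemma idem_norm_le: "d \<odot> d = d \<Longrightarrow> norm d \<le> norm e"
proof -
  assume d: "d \<odot> d = d"
  have "norm d * norm d \<le> norm d * norm e"
    using norm_cauchy_schwarz[of d e] idem_norm[OF d] by (simp add: norm_eq_sqrt_inner)
  then show ?thesis by (cases "d = 0") auto
qed

text \<open>Zero is isolated among the idempotents: for nonzero \<open>d\<close> the equation
  \<open>d = d d\<close> forces \<open>norm d >= 1/K\<close>, where \<open>K\<close> bounds the
  product. Removing 0 therefore keeps the set closed.\<close>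

lemma compact_idempotents: "compact {d. d \<odot> d = d \<and> d \<noteq> 0}"
proof -
  obtain K where K: "K > 0" "\<And>x y. norm (x \<odot> y) \<le> K * norm x * norm y" using jm_norm_bound by blast
  have "norm d \<ge> 1 / K" if "d \<odot> d = d" "d \<noteq> 0" for d
    using K(2)[of d d] that K(1) by (simp add: field_simps)
  then have eq: "{d. d \<odot> d = d \<and> d \<noteq> 0} = {d. d \<odot> d = d} \<inter> {d. norm d \<ge> 1 / K}"
    using K(1) by fastforce
  have "closed {d. d \<odot> d = d}" by (intro closed_Collect_eq continuous_intros)
  moreover have "closed {d::'a. norm d \<ge> 1 / K}" by (intro closed_Collect_le continuous_intros)
  ultimately have "closed {d. d \<odot> d = d \<and> d \<noteq> 0}" unfolding eq by blast
  moreover have "bounded {d. d \<odot> d = d \<and> d \<noteq> 0}"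
    by (rule boundedI[of _ "norm e"]) (use idem_norm_le in auto)
  ultimately show ?thesis by (simp add: compact_eq_bounded_closed)
qed

lemma idem_inner_peirce:
  assumes p: "p \<odot> p = p" and d: "d \<odot> d = d"
    and x: "d = d1 + dh + d0" "p \<odot> d1 = d1" "p \<odot> dh = (1/2) *\<^sub>R dh" "p \<odot> d0 = 0"
  shows "inner p d = inner d1 d1 + inner dh dh / 2"
proof -
  have "inner d1 dh = 0" "inner dh d0 = 0" "inner d1 d0 = 0"
    using peirce_orth[of p d1 1 dh "1/2"] peirce_orth[of p dh "1/2" d0 0] peirce_orth[of p d1 1 d0 0] x by auto
  then have "inner d (p \<odot> d) = inner d1 d1 + inner dh dh / 2"
    using x by (simp add: jm_simps inner_simps inner_commute)
  moreover have "inner p d = inner d (p \<odot> d)"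
    using inner_jm[of d d p] d comm[of d p] by (simp add: inner_commute)
  ultimately show ?thesis by simp
qed

end

lemma map_poly_of_real_prod:
  "map_poly complex_of_real (\<Prod>j\<in>A. f j) = (\<Prod>j\<in>A. map_poly complex_of_real (f j))"
proof -
  have "map_poly complex_of_real (p * q) = map_poly complex_of_real p * map_poly complex_of_real q" for p q
    by (rule poly_eqI) (simp add: coeff_map_poly coeff_mult)
  then show ?thesis
    by (induction A rule: infinite_finite_induct) (simp_all add: map_poly_1')
qed

lemma interior_in_ball:
  "x \<in> interior_in V S \<longleftrightarrow> x \<in> S \<and> (\<exists>\<rho>>0. ball x \<rho> \<inter> V \<subseteq> S)"
proof
  assume "x \<in> interior_in V S"
  then obtain T where T: "x \<in> S" "open T" "x \<in> T" "T \<inter> V \<subseteq> S" by (auto simp: interior_in_def)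
  then obtain \<rho> where "\<rho> > 0" "ball x \<rho> \<subseteq> T" using openE by blast
  then show "x \<in> S \<and> (\<exists>\<rho>>0. ball x \<rho> \<inter> V \<subseteq> S)" using T by blast
next
  assume "x \<in> S \<and> (\<exists>\<rho>>0. ball x \<rho> \<inter> V \<subseteq> S)"
  then show "x \<in> interior_in V S"
    unfolding interior_in_def using centre_in_ball open_ball by blast
qed

text \<open>Applying one and the same small displacement \<open>w\<close> to both end points
  displaces their convex combination by \<open>w\<close>.\<close>

lemma convex_interior_in:
  assumes V: "subspace V" and S: "convex S" "S \<subseteq> V"
  shows "convex (interior_in V S)"
proof (rule convexI)
  fix a b and u v :: real assume ab: "a \<in> interior_in V S" "b \<in> interior_in V S" and uv: "0 \<le> u" "0 \<le> v" "u + v = 1"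
  obtain \<rho> where \<rho>: "\<rho> > 0" "ball a \<rho> \<inter> V \<subseteq> S" using ab(1) by (auto simp: interior_in_ball)
  obtain \<sigma> where \<sigma>: "\<sigma> > 0" "ball b \<sigma> \<inter> V \<subseteq> S" using ab(2) by (auto simp: interior_in_ball)
  have abS: "a \<in> S" "b \<in> S" using ab by (auto simp: interior_in_ball)
  define x where "x = u *\<^sub>R a + v *\<^sub>R b"
  have xS: "x \<in> S" using S(1) abS uv by (auto simp: x_def convex_def)
  have "ball x (min \<rho> \<sigma>) \<inter> V \<subseteq> S"
  proof
    fix y assume y: "y \<in> ball x (min \<rho> \<sigma>) \<inter> V"
    define w where "w = y - x"
    have wV: "w \<in> V" unfolding w_def using y xS S(2) by (intro subspace_diff V) auto
    have wn: "norm w < \<rho>" "norm w < \<sigma>" using y by (auto simp: w_def dist_norm norm_minus_commute)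
    have "a + w \<in> V" "b + w \<in> V" using wV abS S(2) by (auto intro!: subspace_add[OF V])
    then have "a + w \<in> S" "b + w \<in> S" using \<rho>(2) \<sigma>(2) wn by (auto simp: dist_norm subset_iff)
    moreover have y_eq: "y = u *\<^sub>R (a + w) + v *\<^sub>R (b + w)"
    proof -
      have "u *\<^sub>R (a + w) + v *\<^sub>R (b + w) = x + (u + v) *\<^sub>R w" by (simp add: x_def algebra_simps)
      then show ?thesis using uv(3) by (simp add: w_def)
    qed
    ultimately show "y \<in> S" using convexD[OF S(1) _ _ uv] by metis
  qed
  then show "u *\<^sub>R a + v *\<^sub>R b \<in> interior_in V S"
    using xS \<rho>(1) \<sigma>(1) unfolding interior_in_ball x_def[symmetric] by (auto intro!: exI[of _ "min \<rho> \<sigma>"])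
qed

section \<open>Eigenvalues, determinant, invertibility and cone for a fixed rank\<close>

locale ranked_euclidean_jordan = simple_euclidean_jordan jm e
  for jm :: "'a::euclidean_space \<Rightarrow> 'a \<Rightarrow> 'a" (infixl "\<odot>" 70) and e :: 'a +
  fixes r :: nat and c :: "nat \<Rightarrow> 'a"
  assumes frame: "jordan_frame jm e r c"
begin

lemma rank_pos: "r > 0"
  using frameD(5)[OF frame] e_nonzero by (cases "r = 0") simp_all

lemma spectral_exists: "\<exists>l d. spectral_decomp jm e r x l d"
proof -
  obtain m l d where s: "spectral_decomp jm e m x l d" using spectral_decomp_some_rank by blast
  then have "jordan_frame jm e m d" by (simp add: spectral_decomp_def)
  then have "m = r" by (rule frame_size_unique[OF frame])
  then show ?thesis using s by blast
qed

lemma frame_mult: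
  assumes d: "jordan_frame jm e r d"
  shows "(\<Sum>j\<in>{1..r}. a j *\<^sub>R d j) \<odot> (\<Sum>j\<in>{1..r}. b j *\<^sub>R d j) = (\<Sum>j\<in>{1..r}. (a j * b j) *\<^sub>R d j)"
proof -
  have "(\<Sum>j\<in>{1..r}. a j *\<^sub>R d j) \<odot> (\<Sum>j\<in>{1..r}. b j *\<^sub>R d j)
      = (\<Sum>i\<in>{1..r}. \<Sum>j\<in>{1..r}. if j = i then (a i * b i) *\<^sub>R d i else 0)"
    unfolding sum_jm[where A="{1..r}"] jm_sum
    using frameD(2,4)[OF d] by (intro sum.cong) (auto simp: jm_simps)
  then show ?thesis by simp
qed

lemma spectral_eigen:
  assumes "spectral_decomp jm e r x l d" and j: "j \<in> {1..r}"
  shows "x \<odot> d j = l j *\<^sub>R d j"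
proof -
  have d: "jordan_frame jm e r d" and x: "x = (\<Sum>j\<in>{1..r}. l j *\<^sub>R d j)"
    using assms by (auto simp: spectral_decomp_def)
  have "x \<odot> d j = (\<Sum>i\<in>{1..r}. if i = j then l j *\<^sub>R d j else 0)"
    unfolding x sum_jm using frameD(2,4)[OF d] j by (intro sum.cong) (auto simp: jm_simps)
  then show ?thesis using j by simp
qed

text \<open>Eigenvectors \<open>d j\<close> and \<open>d' i\<close> for different eigenvalues are orthogonal, so both sums equal
  the same double sum over \<open>inner (d j) (d' i)\<close>.\<close>
lemma spectral_sum_unique:
  assumes s: "spectral_decomp jm e r x l d" and s': "spectral_decomp jm e r x l' d'"
  shows "(\<Sum>j\<in>{1..r}. f (l j)) = (\<Sum>j\<in>{1..r}. f (l' j) :: real)"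
proof -
  have d: "jordan_frame jm e r d" "jordan_frame jm e r d'" using s s' by (auto simp: spectral_decomp_def)
  have tr: "real r * (\<Sum>j\<in>{1..r}. f (l j) * inner (d j) e) = (\<Sum>j\<in>{1..r}. f (l j)) * inner e e"
    if "jordan_frame jm e r d" for l d
    unfolding sum_distrib_left sum_distrib_right
  proof (rule sum.cong[OF refl])
    fix j assume j: "j \<in> {1..r}"
    show "real r * (f (l j) * inner (d j) e) = f (l j) * inner e e"
      using frame_norm[OF that j] idem_norm[OF frameD(2)[OF that j]] by (metis mult.left_commute)
  qed
  have ex: "inner (d j) e = (\<Sum>i\<in>{1..r}. inner (d j) (d' i))" "inner (d' j) e = (\<Sum>i\<in>{1..r}. inner (d i) (d' j))" for j
    using frameD(5)[OF d(1)] frameD(5)[OF d(2)] by (metis inner_sum_right inner_sum_left inner_commute)+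
  have "(\<Sum>j\<in>{1..r}. f (l j) * inner (d j) e) = (\<Sum>j\<in>{1..r}. \<Sum>i\<in>{1..r}. f (l j) * inner (d j) (d' i))"
    unfolding ex(1) sum_distrib_left ..
  also have "\<dots> = (\<Sum>j\<in>{1..r}. \<Sum>i\<in>{1..r}. f (l' i) * inner (d j) (d' i))"
  proof (intro sum.cong refl)
    fix i j assume ij: "j \<in> {1..r}" "i \<in> {1..r}"
    have "l j * inner (d j) (d' i) = l' i * inner (d j) (d' i)"
      using inner_jm[of x "d j" "d' i"] spectral_eigen[OF s ij(1)] spectral_eigen[OF s' ij(2)] by simp
    then show "f (l j) * inner (d j) (d' i) = f (l' i) * inner (d j) (d' i)" by auto
  qed
  also have "\<dots> = (\<Sum>i\<in>{1..r}. \<Sum>j\<in>{1..r}. f (l' i) * inner (d j) (d' i))" by (rule sum.swap)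
  also have "\<dots> = (\<Sum>i\<in>{1..r}. f (l' i) * inner (d' i) e)" unfolding ex(2) sum_distrib_left ..
  finally have "(\<Sum>j\<in>{1..r}. f (l j)) * inner e e = (\<Sum>j\<in>{1..r}. f (l' j)) * inner e e"
    using tr[OF d(1)] tr[OF d(2)] by metis
  then show ?thesis using e_nonzero by simp
qed

text \<open>Applied to the indicator function of a single value, \<open>spectral_sum_unique\<close>
  compares multiplicities.\<close>

lemma spectral_mset_unique:
  assumes s: "spectral_decomp jm e r x l d" and s': "spectral_decomp jm e r x l' d'"
  shows "image_mset l (mset_set {1..r}) = image_mset l' (mset_set {1..r})"
proof (rule multiset_eqI)
  fix a
  have cnt: "real (count (image_mset l (mset_set {1..r})) a) = (\<Sum>j\<in>{1..r}. if l j = a then 1 else 0)" for l :: "nat \<Rightarrow> real"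
    by (simp add: count_image_mset vimage_def Int_def flip: sum.inter_filter)
      (auto intro!: arg_cong[where f=card])
  show "count (image_mset l (mset_set {1..r})) a = count (image_mset l' (mset_set {1..r})) a"
    using spectral_sum_unique[OF s s', of "\<lambda>t. if t = a then 1 else 0"] cnt[of l] cnt[of l'] by linarith
qed

lemma spectral_prod_unique:
  assumes s: "spectral_decomp jm e r x l d" and s': "spectral_decomp jm e r x l' d'"
  shows "(\<Prod>j\<in>{1..r}. f (l j)) = (\<Prod>j\<in>{1..r}. f (l' j))"
  using arg_cong[OF spectral_mset_unique[OF s s'], of "\<lambda>m. prod_mset (image_mset f m)"]
  by (simp add: prod_unfold_prod_mset multiset.map_comp o_def)

lemma jdet_spectral:
  assumes s: "spectral_decomp jm e r x l d"
  shows "jdet jm e r x = (\<Prod>j\<in>{1..r}. l j)"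
  unfolding jdet_def
proof (rule the_equality)
  show "\<exists>l' d. spectral_decomp jm e r x l' d \<and> (\<Prod>j\<in>{1..r}. l j) = (\<Prod>j\<in>{1..r}. l' j)"
    using s by blast
next
  fix D assume "\<exists>l d. spectral_decomp jm e r x l d \<and> D = (\<Prod>j\<in>{1..r}. l j)"
  then show "D = (\<Prod>j\<in>{1..r}. l j)"
    using spectral_prod_unique[OF s, of _ _ "\<lambda>t. t"] by auto
qed

lemma jind_spectral:
  assumes s: "spectral_decomp jm e r x l d"
  shows "real_of_int (jind jm e r x) = (\<Sum>j\<in>{1..r}. sgn (l j))"
proof -
  define m where "m = (\<Sum>j\<in>{1..r}. if l j > 0 then 1 else if l j < 0 then -1 else 0 :: int)"
  have m: "real_of_int m = (\<Sum>j\<in>{1..r}. sgn (l j))"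
    unfolding m_def of_int_sum by (rule sum.cong) (auto simp: sgn_if)
  have "jind jm e r x = m"
    unfolding jind_def
  proof (rule the_equality)
    show "\<exists>l d. spectral_decomp jm e r x l d \<and> real_of_int m = (\<Sum>j\<in>{1..r}. sgn (l j))"
      using s m by blast
  next
    fix m' assume "\<exists>l d. spectral_decomp jm e r x l d \<and> real_of_int m' = (\<Sum>j\<in>{1..r}. sgn (l j))"
    then have "real_of_int m' = real_of_int m"
      using m spectral_sum_unique[OF s, of _ _ sgn] by metis
    then show "m' = m" by simp
  qed
  then show ?thesis using m by simp
qed

lemma spectral_affine:
  assumes s: "spectral_decomp jm e r x l d"
  shows "spectral_decomp jm e r (a *\<^sub>R e + t *\<^sub>R x) (\<lambda>j. a + t * l j) d"
proof -
  have d: "jordan_frame jm e r d" and x: "x = (\<Sum>j\<in>{1..r}. l j *\<^sub>R d j)"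
    using s by (auto simp: spectral_decomp_def)
  have "a *\<^sub>R e + t *\<^sub>R x = (\<Sum>j\<in>{1..r}. (a + t * l j) *\<^sub>R d j)"
    unfolding x frameD(5)[OF d, symmetric] by (simp add: scaleR_sum_right scaleR_add_left sum.distrib)
  then show ?thesis using d by (simp add: spectral_decomp_def)
qed

text \<open>All elements \<open>a e - t x\<close> share one frame, so the determinant along this
  line is the real polynomial with linear factors \<open>a - t l_j\<close>. A polynomial is
  determined by its values on the reals, which settles the definite description; evaluation at
  \<open>i\<close> is then explicit.\<close>

lemma cdet_spectral:
  assumes s: "spectral_decomp jm e r x l d"
  shows "cdet jm e r (a *\<^sub>R e) (- x) = (\<Prod>j\<in>{1..r}. complex_of_real a - \<i> * complex_of_real (l j))"
proof -
  define p where "p = (\<Prod>j\<in>{1..r}. [:a, - l j:])"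
  have "jdet jm e r (a *\<^sub>R e + t *\<^sub>R (- x)) = poly p t" for t
    using jdet_spectral[OF spectral_affine[OF s, of a "- t"]] by (simp add: p_def poly_prod)
  then have "(THE p. \<forall>t. poly p t = jdet jm e r (a *\<^sub>R e + t *\<^sub>R (- x))) = p"
    by (intro the_equality) (auto simp: poly_eq_poly_eq_iff fun_eq_iff[symmetric])
  moreover have "map_poly complex_of_real p = (\<Prod>j\<in>{1..r}. [:complex_of_real a, - complex_of_real (l j):])"
    unfolding p_def by (simp add: map_poly_of_real_prod map_poly_pCons)
  ultimately show ?thesis by (simp add: cdet_def poly_prod)
qed

text \<open>Invertibility is recast as a condition on idempotents because the nonzero ones range
  over a compact set. If \<open>x y = e\<close> and \<open>x d = 0\<close>, then
  \<open>|d|^2 = <d, e> = <x d, y> = 0\<close>; conversely no eigenvalue is zero and the inverse is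
  taken along the frame.\<close>

lemma invertible_iff: "x \<in> invertible_elts jm e \<longleftrightarrow> (\<forall>d. d \<odot> d = d \<longrightarrow> x \<odot> d = 0 \<longrightarrow> d = 0)"
proof
  assume "x \<in> invertible_elts jm e"
  then obtain y where y: "x \<odot> y = e" by (auto simp: invertible_elts_def)
  show "\<forall>d. d \<odot> d = d \<longrightarrow> x \<odot> d = 0 \<longrightarrow> d = 0"
  proof (intro allI impI)
    fix d assume d: "d \<odot> d = d" "x \<odot> d = 0"
    then have "inner d d = 0" using idem_norm[OF d(1)] inner_jm[of x d y] y by simp
    then show "d = 0" by simp
  qed
next
  assume R: "\<forall>d. d \<odot> d = d \<longrightarrow> x \<odot> d = 0 \<longrightarrow> d = 0"
  obtain l d where s: "spectral_decomp jm e r x l d" using spectral_exists by blast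
  then have d: "jordan_frame jm e r d" and x: "x = (\<Sum>j\<in>{1..r}. l j *\<^sub>R d j)"
    by (auto simp: spectral_decomp_def)
  have nz: "l j \<noteq> 0" if "j \<in> {1..r}" for j
    using R frameD(2,3)[OF d that] spectral_eigen[OF s that] by auto
  define y where "y = (\<Sum>j\<in>{1..r}. inverse (l j) *\<^sub>R d j)"
  have "x \<odot> y = e"
    unfolding x y_def frame_mult[OF d] frameD(5)[OF d, symmetric] by (rule sum.cong) (use nz in auto)
  moreover have "x \<odot> x \<odot> y = x"
    unfolding x y_def frame_mult[OF d] by (rule sum.cong) (use nz in auto)
  ultimately show "x \<in> invertible_elts jm e" by (auto simp: invertible_elts_def)
qed

lemma invertible_eigenvalues_nonzero:
  assumes "x \<in> invertible_elts jm e" "spectral_decomp jm e r x l d" "j \<in> {1..r}"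
  shows "l j \<noteq> 0"
proof -
  have "jordan_frame jm e r d" using assms(2) by (simp add: spectral_decomp_def)
  then show ?thesis
    using frameD(2,3)[of r d j] spectral_eigen[OF assms(2,3)] assms(1,3) unfolding invertible_iff
    by (metis scaleR_zero_left)
qed

text \<open>The bound is the minimum of \<open>norm (x \<odot> d)\<close> over the compact product
  of \<open>K\<close> with the nonzero idempotents.\<close>

lemma invertible_bound:
  assumes K: "compact K" "K \<subseteq> invertible_elts jm e"
  shows "\<exists>\<delta>>0. \<forall>x\<in>K. \<forall>d. d \<odot> d = d \<longrightarrow> d \<noteq> 0 \<longrightarrow> \<delta> \<le> norm (x \<odot> d)"
proof (cases "K = {}")
  case True
  then show ?thesis by (auto intro: exI[of _ 1])
next
  case False
  define I where "I = {d. d \<odot> d = d \<and> d \<noteq> 0}"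
  have "e \<in> I" using e_nonzero by (simp add: I_def)
  then have ne: "K \<times> I \<noteq> {}" using False by blast
  have "compact (K \<times> I)" using K compact_idempotents by (auto simp: I_def intro: compact_Times)
  moreover have "continuous_on (K \<times> I) (\<lambda>z. norm (fst z \<odot> snd z))" by (intro continuous_intros)
  ultimately obtain z where z: "z \<in> K \<times> I" "\<And>w. w \<in> K \<times> I \<Longrightarrow> norm (fst z \<odot> snd z) \<le> norm (fst w \<odot> snd w)"
    using continuous_attains_inf[of "K \<times> I" "\<lambda>z. norm (fst z \<odot> snd z)"] ne by blast
  have "fst z \<odot> snd z \<noteq> 0" using z(1) K(2) by (auto simp: I_def invertible_iff subset_iff)
  then show ?thesis
    using z(2) by (intro exI[of _ "norm (fst z \<odot> snd z)"]) (force simp: I_def)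
qed

lemma eigenvalue_bound:
  assumes K: "compact K" "K \<subseteq> invertible_elts jm e"
  shows "\<exists>\<delta>>0. \<forall>x\<in>K. \<forall>l d. spectral_decomp jm e r x l d \<longrightarrow> (\<forall>j\<in>{1..r}. \<delta> \<le> \<bar>l j\<bar>)"
proof -
  obtain \<delta> where \<delta>: "\<delta> > 0" "\<And>x d. x \<in> K \<Longrightarrow> d \<odot> d = d \<Longrightarrow> d \<noteq> 0 \<Longrightarrow> \<delta> \<le> norm (x \<odot> d)"
    using invertible_bound[OF K] by blast
  have "\<delta> / norm e \<le> \<bar>l j\<bar>" if "x \<in> K" and s: "spectral_decomp jm e r x l d" and j: "j \<in> {1..r}" for x l d j
  proof -
    have d: "jordan_frame jm e r d" using s by (simp add: spectral_decomp_def)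
    have "\<delta> \<le> norm (x \<odot> d j)" using \<delta>(2) that frameD(2,3)[OF d j] by blast
    also have "\<dots> = \<bar>l j\<bar> * norm (d j)" using spectral_eigen[OF s j] by simp
    also have "\<dots> \<le> \<bar>l j\<bar> * norm e" by (intro mult_left_mono idem_norm_le frameD(2)[OF d j]) auto
    finally show ?thesis using e_nonzero by (simp add: divide_simps)
  qed
  then show ?thesis using \<delta>(1) e_nonzero by (intro exI[of _ "\<delta> / norm e"]) auto
qed

lemma open_invertible: "open (invertible_elts jm e)"
  unfolding open_contains_ball
proof
  fix x assume "x \<in> invertible_elts jm e"
  then obtain \<delta> where \<delta>: "\<delta> > 0" "\<And>d. d \<odot> d = d \<Longrightarrow> d \<noteq> 0 \<Longrightarrow> \<delta> \<le> norm (x \<odot> d)"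
    using invertible_bound[of "{x}"] by auto
  obtain K where K: "K > 0" "\<And>x y. norm (x \<odot> y) \<le> K * norm x * norm y" using jm_norm_bound by blast
  \<comment> \<open>A move by less than this radius changes \<open>x \<odot> d\<close> by less than
    \<open>\<delta>\<close>, uniformly in the idempotent \<open>d\<close>, whose norm is at most
    \<open>norm e\<close>.\<close>
  have "y \<in> invertible_elts jm e" if y: "y \<in> ball x (\<delta> / (K * norm e))" for y
    unfolding invertible_iff
  proof (intro allI impI, rule ccontr)
    fix d assume d: "d \<odot> d = d" "y \<odot> d = 0" "d \<noteq> 0"
    have "\<delta> \<le> norm ((x - y) \<odot> d)" using \<delta>(2)[OF d(1,3)] d(2) by (simp add: jm_simps)
    also have "\<dots> \<le> K * norm (x - y) * norm d" by (rule K)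
    also have "\<dots> \<le> K * norm (x - y) * norm e" using K(1) by (intro mult_left_mono idem_norm_le d) auto
    also have "\<dots> < K * (\<delta> / (K * norm e)) * norm e"
      using y K(1) e_nonzero by (intro mult_strict_right_mono mult_strict_left_mono) (auto simp: dist_norm)
    also have "\<dots> = \<delta>" using K(1) e_nonzero by simp
    finally show False by simp
  qed
  then show "\<exists>\<rho>>0. ball x \<rho> \<subseteq> invertible_elts jm e"
    using \<delta>(1) K(1) e_nonzero by (intro exI[of _ "\<delta> / (K * norm e)"]) auto
qed

text \<open>A form of self-duality in which only idempotents are tested. A square \<open>y y\<close>
  gives \<open><y, d y>\<close>, nonnegative by \<open>idem_psd\<close>; conversely, testing against
  the frame of \<open>x\<close> shows that its eigenvalues are nonnegative, so \<open>x\<close> has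
  a square root.\<close>

lemma sym_cone_iff: "x \<in> sym_cone jm \<longleftrightarrow> (\<forall>d. d \<odot> d = d \<longrightarrow> 0 \<le> inner x d)"
proof
  assume "x \<in> sym_cone jm"
  then obtain y where y: "x = y \<odot> y" by (auto simp: sym_cone_def)
  show "\<forall>d. d \<odot> d = d \<longrightarrow> 0 \<le> inner x d"
    unfolding y inner_jm using idem_psd[of _ y] by (simp add: comm[of y])
next
  assume R: "\<forall>d. d \<odot> d = d \<longrightarrow> 0 \<le> inner x d"
  obtain l d where s: "spectral_decomp jm e r x l d" using spectral_exists by blast
  then have d: "jordan_frame jm e r d" and x: "x = (\<Sum>j\<in>{1..r}. l j *\<^sub>R d j)"
    by (auto simp: spectral_decomp_def)
  have nn: "l j \<ge> 0" if "j \<in> {1..r}" for j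
  proof -
    have "0 \<le> inner x (d j \<odot> d j)" using R frameD(2)[OF d that] by simp
    also have "\<dots> = inner (x \<odot> d j) (d j)" by (metis inner_jm comm inner_commute)
    also have "\<dots> = l j * inner (d j) (d j)" using spectral_eigen[OF s that] by simp
    finally show ?thesis using frameD(3)[OF d that] by (metis inner_gt_zero_iff zero_le_mult_iff not_le)
  qed
  have "x = (\<Sum>j\<in>{1..r}. sqrt (l j) *\<^sub>R d j) \<odot> (\<Sum>j\<in>{1..r}. sqrt (l j) *\<^sub>R d j)"
    unfolding frame_mult[OF d] unfolding x by (rule sum.cong) (use nn in auto)
  then show "x \<in> sym_cone jm" by (auto simp: sym_cone_def)
qed

lemma convex_sym_cone: "convex (sym_cone jm)"
  by (rule convexI) (simp add: sym_cone_iff inner_simps)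

text \<open>For a perturbation \<open>u\<close> in the Peirce 1-space of \<open>p\<close> only
  \<open>w = d1 + dh\<close> matters: \<open><u, d> = <u w, w>\<close>, bounded by
  \<open>K |u| |w|^2\<close>. Against it stands \<open><p, d> >= |w|^2 / 2\<close>, and the radius
  \<open>1/(2K)\<close> balances the two.\<close>

lemma idem_interior_in:
  assumes p: "p \<odot> p = p"
  shows "p \<in> interior_in {x. p \<odot> x = x} (sym_cone jm \<inter> {x. p \<odot> x = x})"
proof -
  obtain K where K: "K > 0" "\<And>x y. norm (x \<odot> y) \<le> K * norm x * norm y" using jm_norm_bound by blast
  have "y \<in> sym_cone jm" if y: "y \<in> ball p (1 / (2 * K))" "p \<odot> y = y" for y
    unfolding sym_cone_iff
  proof (intro allI impI)
    fix d assume d: "d \<odot> d = d"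
    define u where "u = y - p"
    have pu: "p \<odot> u = u" using p y by (simp add: u_def jm_simps)
    have nu: "norm u \<le> 1 / (2 * K)" using y(1) by (simp add: u_def dist_norm norm_minus_commute)
    obtain d1 dh d0 where x: "d = d1 + dh + d0" "p \<odot> d1 = d1" "p \<odot> dh = (1/2) *\<^sub>R dh" "p \<odot> d0 = 0"
      using peirce_decomposition[OF p] by metis
    define w where "w = d1 + dh"
    have "inner d1 dh = 0"
      using peirce_orth[of p d1 1 dh "1/2"] x by auto
    then have ww: "inner w w = inner d1 d1 + inner dh dh" by (simp add: w_def inner_simps inner_commute)
    have ud0: "u \<odot> d0 = 0" using peirce_one_zero[OF p pu x(4)] .
    have "inner u d = inner d (u \<odot> d)"
      using inner_jm[of d d u] d comm[of d u] by (simp add: inner_commute)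
    also have "u \<odot> d = u \<odot> w" using x(1) ud0 by (simp add: w_def jm_simps)
    also have "inner d (u \<odot> w) = inner (u \<odot> d) w" by (simp add: inner_jm)
    also have "u \<odot> d = u \<odot> w" using x(1) ud0 by (simp add: w_def jm_simps)
    finally have "\<bar>inner u d\<bar> \<le> norm (u \<odot> w) * norm w" using Cauchy_Schwarz_ineq2 by metis
    also have "\<dots> \<le> (K * norm u * norm w) * norm w" by (intro mult_right_mono K) auto
    also have "\<dots> = (K * norm u) * inner w w" by (simp add: dot_square_norm power2_eq_square)
    also have "\<dots> \<le> (1 / 2) * inner w w" using nu K(1) by (intro mult_right_mono) (auto simp: field_simps)
    finally have "inner u d \<ge> - (inner w w / 2)" by linarith
    moreover have "inner p d = inner d1 d1 + inner dh dh / 2" by (rule idem_inner_peirce[OF p d x])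
    moreover have "inner y d = inner p d + inner u d" by (simp add: u_def inner_simps)
    ultimately show "0 \<le> inner y d" using ww inner_ge_zero[of d1] by linarith
  qed
  moreover have "p \<in> sym_cone jm" using p by (auto simp: sym_cone_def intro: exI[of _ p])
  ultimately show ?thesis
    unfolding interior_in_ball using p K(1) by (auto intro!: exI[of _ "1 / (2 * K)"])
qed

lemma e_interior_cone: "e \<in> interior (sym_cone jm)"
  using idem_interior_in[of e] unfolding interior_in_ball mem_interior by auto

section \<open>The convex set \<open>W(h_k)\<close> described by two complementary
  idempotents\<close>

context
  fixes k :: nat
  assumes k: "k \<le> r"
begin

private definition "p = (\<Sum>i\<in>{1..k}. c i)"
private definition "q = (\<Sum>i\<in>{k+1..r}. c i)"

private lemma pq: "p + q = e"
proof -
  have "{1..r} = {1..k} \<union> {k+1..r}" using k by auto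
  then show ?thesis unfolding p_def q_def frameD(5)[OF frame, symmetric] by (simp add: sum.union_disjoint)
qed

private lemma pp: "p \<odot> p = p"
  unfolding p_def by (rule idem_orth_sum; (rule frameD(2,4)[OF frame])?) (use k in auto)

private lemma q_eq: "q = e - p"
  unfolding pq[symmetric] by simp

private lemma qq: "q \<odot> q = q"
  by (simp add: q_eq jm_simps pp)

text \<open>\<open>h_k\<close> is \<open>2 L(p) - 1\<close>, so its eigenspaces for 1, 0 and -1 are
  the Peirce spaces of \<open>p\<close> for 1, 1/2 and 0, the last of which is the Peirce 1-space of
  \<open>q = e - p\<close>.\<close>

private lemma hk_eq: "hk jm r c k x = 2 *\<^sub>R (p \<odot> x) - x"
  unfolding hk_def p_def[symmetric] q_def[symmetric] unfolding q_eq by (simp add: jm_simps scaleR_2)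

private lemma eig1: "eigsp (hk jm r c k) 1 = {x. p \<odot> x = x}"
  by (auto simp: eigsp_def hk_eq diff_eq_eq simp flip: scaleR_2)

private lemma eigm1: "eigsp (hk jm r c k) (-1) = {x. q \<odot> x = x}"
  by (auto simp: eigsp_def hk_eq q_eq jm_simps)

private lemma eig0: "eigsp (hk jm r c k) 0 = {x. p \<odot> x = (1/2) *\<^sub>R x}"
  by (auto simp: eigsp_def hk_eq) (metis scaleR_half_double scaleR_2 scaleR_add_right)

text \<open>Replacing \<open>b\<close> by \<open>-b\<close> turns the negative cone into the cone
  itself, so that \<open>a\<close> and \<open>-b\<close> fall under the same lemmas, for
  \<open>p\<close> and for \<open>q\<close>.\<close>

private lemma W_eq: "W_set jm r c k = {a + b + z | a b z. a \<in> interior_in {x. p \<odot> x = x} (sym_cone jm \<inter> {x. p \<odot> x = x}) \<and>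
   - b \<in> interior_in {x. q \<odot> x = x} (sym_cone jm \<inter> {x. q \<odot> x = x}) \<and> p \<odot> z = (1/2) *\<^sub>R z}"
proof -
  have "b \<in> interior_in {x. q \<odot> x = x} (uminus ` sym_cone jm \<inter> {x. q \<odot> x = x}) \<longleftrightarrow>
        - b \<in> interior_in {x. q \<odot> x = x} (sym_cone jm \<inter> {x. q \<odot> x = x})" (is "?L b \<longleftrightarrow> ?R b") for b
  proof -
    have mem: "x \<in> uminus ` sym_cone jm \<inter> {x. q \<odot> x = x} \<longleftrightarrow> - x \<in> sym_cone jm \<inter> {x. q \<odot> x = x}" for x
      by (auto simp: jm_simps image_iff) (metis minus_minus)+
    have "ball b \<rho> \<inter> {x. q \<odot> x = x} \<subseteq> uminus ` sym_cone jm \<inter> {x. q \<odot> x = x} \<longleftrightarrow>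
        ball (- b) \<rho> \<inter> {x. q \<odot> x = x} \<subseteq> sym_cone jm \<inter> {x. q \<odot> x = x}" (is "?A \<longleftrightarrow> ?B") for \<rho>
    proof
      assume ?A
      show ?B
      proof
        fix x assume "x \<in> ball (- b) \<rho> \<inter> {x. q \<odot> x = x}"
        then have "- x \<in> ball b \<rho> \<inter> {x. q \<odot> x = x}" by (auto simp: jm_simps dist_norm norm_minus_commute add.commute)
        then show "x \<in> sym_cone jm \<inter> {x. q \<odot> x = x}" using \<open>?A\<close> mem[of "- x"] by auto
      qed
    next
      assume ?B
      show ?A
      proof
        fix x assume "x \<in> ball b \<rho> \<inter> {x. q \<odot> x = x}"
        then have "- x \<in> ball (- b) \<rho> \<inter> {x. q \<odot> x = x}" by (auto simp: jm_simps dist_norm norm_minus_commute add.commute)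
        then show "x \<in> uminus ` sym_cone jm \<inter> {x. q \<odot> x = x}" using \<open>?B\<close> mem[of x] by blast
      qed
    qed
    then show ?thesis unfolding interior_in_ball mem by blast
  qed
  then show ?thesis unfolding W_set_def Let_def eig1 eigm1 eig0 by auto
qed

private lemma subspace_fixed: "subspace {x. g \<odot> x = x}"
  by (auto simp: subspace_def jm_simps)

lemma convex_W: "convex (W_set jm r c k)"
proof (rule convexI)
  have cv: "convex (interior_in {x. p \<odot> x = x} (sym_cone jm \<inter> {x. p \<odot> x = x}))"
    "convex (interior_in {x. q \<odot> x = x} (sym_cone jm \<inter> {x. q \<odot> x = x}))"
    by (intro convex_interior_in subspace_fixed convex_Int convex_sym_cone subspace_imp_convex; blast)+
  fix x y and u v :: real assume xy: "x \<in> W_set jm r c k" "y \<in> W_set jm r c k" and uv: "0 \<le> u" "0 \<le> v" "u + v = 1"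
  obtain a b z where x: "x = a + b + z" "a \<in> interior_in {x. p \<odot> x = x} (sym_cone jm \<inter> {x. p \<odot> x = x})"
   "- b \<in> interior_in {x. q \<odot> x = x} (sym_cone jm \<inter> {x. q \<odot> x = x})" "p \<odot> z = (1/2) *\<^sub>R z"
    using xy(1) unfolding W_eq by blast
  obtain a' b' z' where y: "y = a' + b' + z'" "a' \<in> interior_in {x. p \<odot> x = x} (sym_cone jm \<inter> {x. p \<odot> x = x})"
   "- b' \<in> interior_in {x. q \<odot> x = x} (sym_cone jm \<inter> {x. q \<odot> x = x})" "p \<odot> z' = (1/2) *\<^sub>R z'"
    using xy(2) unfolding W_eq by blast
  have "u *\<^sub>R x + v *\<^sub>R y = (u *\<^sub>R a + v *\<^sub>R a') + (u *\<^sub>R b + v *\<^sub>R b') + (u *\<^sub>R z + v *\<^sub>R z')"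
    unfolding x(1) y(1) by (simp add: algebra_simps)
  moreover have "- (u *\<^sub>R b + v *\<^sub>R b') \<in> interior_in {x. q \<odot> x = x} (sym_cone jm \<inter> {x. q \<odot> x = x})"
    using convexD[OF cv(2) x(3) y(3) uv] by simp
  moreover have "p \<odot> (u *\<^sub>R z + v *\<^sub>R z') = (1/2) *\<^sub>R (u *\<^sub>R z + v *\<^sub>R z')"
    using x(4) y(4) by (simp add: jm_simps algebra_simps)
  ultimately show "u *\<^sub>R x + v *\<^sub>R y \<in> W_set jm r c k"
    unfolding W_eq using convexD[OF cv(1) x(2) y(2) uv] by blast
qed

text \<open>Since \<open>a\<close> is interior it can be moved by \<open>-\<eta> d1\<close> without
  leaving the cone; testing the result against \<open>d\<close> gives
  \<open><a, d1> >= \<eta> |d1|^2\<close>, from which both claims follow.\<close>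

private lemma interior_peirce_positive:
  assumes g: "g \<odot> g = g" and a: "a \<in> interior_in {x. g \<odot> x = x} (sym_cone jm \<inter> {x. g \<odot> x = x})"
    and d: "d \<odot> d = d" and x: "d = d1 + d'" "g \<odot> d1 = d1" "inner a d' = 0" "inner d1 d' = 0"
  shows "0 \<le> inner a d1" "inner a d1 = 0 \<Longrightarrow> d1 = 0"
proof -
  obtain \<rho> where \<rho>: "\<rho> > 0" "ball a \<rho> \<inter> {x. g \<odot> x = x} \<subseteq> sym_cone jm" and ga: "g \<odot> a = a"
    using a by (auto simp: interior_in_ball)
  \<comment> \<open>The added 1 covers \<open>d1 = 0\<close> and keeps the displacement strictly
    inside the ball.\<close>
  define \<eta> where "\<eta> = \<rho> / (norm d1 + 1)"
  have n1: "norm d1 + 1 > 0" using norm_ge_zero[of d1] by linarith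
  then have \<eta>: "\<eta> > 0" using \<rho>(1) by (simp add: \<eta>_def)
  have "\<eta> * (norm d1 + 1) = \<rho>" using n1 by (simp add: \<eta>_def)
  then have "\<eta> * norm d1 < \<rho>" using \<eta> by (simp add: algebra_simps)
  then have "a - \<eta> *\<^sub>R d1 \<in> sym_cone jm"
    using \<eta> ga x(2) by (intro subsetD[OF \<rho>(2)]) (auto simp: dist_norm jm_simps)
  then have "0 \<le> inner (a - \<eta> *\<^sub>R d1) d" using d by (auto simp: sym_cone_iff)
  then have *: "\<eta> * inner d1 d1 \<le> inner a d1" using x by (simp add: inner_simps)
  then show "0 \<le> inner a d1" using \<eta> by (smt (verit) inner_ge_zero mult_nonneg_nonneg)
  show "d1 = 0" if "inner a d1 = 0"
    using * \<eta> that by (simp add: mult_le_0_iff) (metis inner_eq_zero_iff inner_ge_zero order_antisym)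
qed

lemma W_invertible: "W_set jm r c k \<subseteq> invertible_elts jm e"
proof
  fix x assume "x \<in> W_set jm r c k"
  then obtain a b z where x: "x = a + b + z" and a: "a \<in> interior_in {x. p \<odot> x = x} (sym_cone jm \<inter> {x. p \<odot> x = x})"
    and b: "- b \<in> interior_in {x. q \<odot> x = x} (sym_cone jm \<inter> {x. q \<odot> x = x})" and z: "p \<odot> z = (1/2) *\<^sub>R z"
    unfolding W_eq by blast
  have pa: "p \<odot> a = a" using a by (simp add: interior_in_ball)
  have "q \<odot> (- b) = - b" using b by (simp add: interior_in_ball)
  then have pb: "p \<odot> b = 0" by (simp add: q_eq jm_simps)
  show "x \<in> invertible_elts jm e"
    unfolding invertible_iff
  proof (intro allI impI)
    fix d assume d: "d \<odot> d = d" "x \<odot> d = 0"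
    obtain d1 dh d0 where D: "d = d1 + dh + d0" "p \<odot> d1 = d1" "p \<odot> dh = (1/2) *\<^sub>R dh" "p \<odot> d0 = 0"
      using peirce_decomposition[OF pp] by metis
    note po = peirce_orth[where c=p]
    have o: "inner d1 dh = 0" "inner dh d0 = 0" "inner d1 d0 = 0" "inner a dh = 0" "inner a d0 = 0"
      "inner b d1 = 0" "inner b dh = 0" "inner z d1 = 0" "inner z d0 = 0"
      using po[of d1 1 dh "1/2"] po[of dh "1/2" d0 0] po[of d1 1 d0 0] po[of a 1 dh "1/2"] po[of a 1 d0 0]
        po[of b 0 d1 1] po[of b 0 dh "1/2"] po[of z "1/2" d1 1] po[of z "1/2" d0 0] D pa pb z by auto
    \<comment> \<open>Symmetry moves \<open>d\<close> across:
      \<open><x, d w> = <x d, w> = 0\<close>. The choices \<open>w = p\<close> and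
      \<open>w = e\<close> combine to \<open>2 d p - d = d1 - d0\<close>, which gives the
      contributions of \<open>a\<close> and \<open>-b\<close> the same sign.\<close>
    have xd: "inner x (d \<odot> w) = 0" for w
      using inner_jm[of d x w] d(2) comm[of d x] by simp
    have "2 *\<^sub>R (d \<odot> p) - d \<odot> e = d1 - d0"
      (is "?l = ?r")
    proof -
      have "inner ?l u = inner ?r u" for u
        unfolding comm[of d p] unfolding D(1) by (simp add: jm_simps D(2-4) inner_simps)
      then show ?thesis by (metis vector_eq_rdot)
    qed
    then have "inner x (d1 - d0) = 0"
      using xd[of p] xd[of e] by (metis diff_zero inner_diff_right inner_scaleR_right mult_zero_right)
    then have s0: "inner a d1 + inner (- b) d0 = 0"
      using o unfolding x by (simp add: inner_simps)
    have A: "0 \<le> inner a d1" "inner a d1 = 0 \<Longrightarrow> d1 = 0"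
      using interior_peirce_positive[OF pp a d(1), of d1 "dh + d0"] D o by (auto simp: inner_simps add.assoc)
    have B: "0 \<le> inner (- b) d0" "inner (- b) d0 = 0 \<Longrightarrow> d0 = 0"
      using interior_peirce_positive[OF qq b d(1), of d0 "d1 + dh"] D o
      by (auto simp: inner_simps add.commute add.left_commute q_eq jm_simps inner_commute)
    have "inner a d1 = 0" "inner (- b) d0 = 0" using A(1) B(1) s0 by linarith+
    then have "d1 = 0" "d0 = 0" using A(2) B(2) by blast+
    \<comment> \<open>What remains of \<open>d\<close> is a Peirce-1/2 vector, orthogonal to
      \<open>p\<close> and \<open>q\<close> and hence to \<open>e\<close>; for an idempotent
      \<open><d, e>\<close> is the squared norm.\<close>
    then have "d = dh" using D by simp
    then have "inner d p = 0" "inner d q = 0"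
      using po[of dh "1/2" p 1] po[of dh "1/2" q 0] D(3) pp by (auto simp: q_eq jm_simps)
    then have "inner d e = 0" unfolding pq[symmetric] by (simp add: inner_simps)
    then show "d = 0" using idem_norm[OF d(1)] by simp
  qed
qed

private lemma frame_point_in_W: "p - q \<in> W_set jm r c k"
  unfolding W_eq using idem_interior_in[OF pp] idem_interior_in[OF qq]
  by (intro CollectI exI[of _ p] exI[of _ "- q"] exI[of _ 0]) auto

private lemma frame_point_jind: "jind jm e r (p - q) = 2 * int k - int r"
proof -
  define l where "l j = (if j \<le> k then 1 else -1 :: real)" for j
  have split: "(\<Sum>j\<in>{1..r}. f j) = (\<Sum>j\<in>{1..k}. f j) + (\<Sum>j\<in>{k+1..r}. f j)" for f :: "nat \<Rightarrow> 'b::comm_monoid_add"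
  proof -
    have "{1..r} = {1..k} \<union> {k+1..r}" using k by auto
    then show ?thesis by (simp add: sum.union_disjoint)
  qed
  have "p - q = (\<Sum>j\<in>{1..r}. l j *\<^sub>R c j)"
    unfolding split p_def q_def by (simp add: l_def sum_negf)
  then have s: "spectral_decomp jm e r (p - q) l c" using frame by (simp add: spectral_decomp_def)
  have "real_of_int (jind jm e r (p - q)) = real_of_int (2 * int k - int r)"
    unfolding jind_spectral[OF s] split using k by (simp add: l_def of_nat_diff)
  then show ?thesis by linarith
qed

lemma W_contains_index_point: "\<exists>x\<in>W_set jm r c k. x \<in> invertible_ind jm e r (2 * int k - int r)"
  using frame_point_in_W frame_point_jind W_invertible by (auto simp: invertible_ind_def)

end

end

section \<open>Test functions and decay of their Fourier transforms\<close>

lemma smooth_fun_differentiable: "smooth_fun f \<Longrightarrow> f differentiable (at x)"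
  by (erule smooth_fun.cases) blast

lemma smooth_fun_derivative: "smooth_fun f \<Longrightarrow> smooth_fun (\<lambda>x. frechet_derivative f (at x) v)"
  by (erule smooth_fun.cases) blast

lemma smooth_fun_continuous: "smooth_fun f \<Longrightarrow> continuous_on S f"
  by (meson continuous_at_imp_continuous_on differentiable_imp_continuous_within smooth_fun_differentiable)

lemma test_fun_continuous: "test_fun \<phi> \<Longrightarrow> continuous_on S \<phi>"
  by (simp add: test_fun_def smooth_fun_continuous)

lemma test_fun_measurable: "test_fun \<phi> \<Longrightarrow> \<phi> \<in> borel_measurable borel"
  using test_fun_continuous borel_measurable_continuous_onI by blast

lemma test_fun_derivative:
  assumes "test_fun \<phi>"
  shows "test_fun (\<lambda>x. frechet_derivative \<phi> (at x) v)"
proof -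
  define S where "S = closure {x. \<phi> x \<noteq> 0}"
  have "frechet_derivative \<phi> (at x) v = 0" if "x \<notin> S" for x
  proof -
    have "(\<phi> has_derivative (\<lambda>h. 0)) (at x)"
    proof (rule has_derivative_transform_within_open[of "\<lambda>x. 0" _ _ _ "- S"])
      show "open (- S)" unfolding S_def by (intro open_Compl closed_closure)
      show "x \<in> - S" using that by simp
      show "0 = \<phi> y" if "y \<in> - S" for y
        using that closure_subset[of "{x. \<phi> x \<noteq> 0}"] by (auto simp: S_def)
    qed simp
    then have "frechet_derivative \<phi> (at x) = (\<lambda>h. 0)" using frechet_derivative_at by metis
    then show ?thesis by simp
  qed
  then have "{x. frechet_derivative \<phi> (at x) v \<noteq> 0} \<subseteq> S" by blast
  then have "closure {x. frechet_derivative \<phi> (at x) v \<noteq> 0} \<subseteq> S" by (simp add: S_def closure_minimal)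
  moreover have "compact S" using assms by (simp add: test_fun_def S_def)
  ultimately have "compact (closure {x. frechet_derivative \<phi> (at x) v \<noteq> 0})"
    using closed_closure compact_Int_closed inf.absorb_iff2 by metis
  then show ?thesis using assms by (auto simp: test_fun_def intro: smooth_fun_derivative)
qed

lemma test_fun_bounds:
  fixes \<phi> :: "'a::euclidean_space \<Rightarrow> real"
  assumes "test_fun \<phi>"
  obtains B R where "B \<ge> 0" "R \<ge> 0" "\<And>x. \<bar>\<phi> x\<bar> \<le> B" "\<And>x. norm x > R \<Longrightarrow> \<phi> x = 0"
proof -
  define S where "S = closure {x. \<phi> x \<noteq> 0}"
  have S: "compact S" using assms by (simp add: test_fun_def S_def)
  have out: "\<phi> x = 0" if "x \<notin> S" for x using that closure_subset[of "{x. \<phi> x \<noteq> 0}"] by (auto simp: S_def)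
  obtain R where R: "\<And>x. x \<in> S \<Longrightarrow> norm x \<le> R" using compact_imp_bounded[OF S] by (auto simp: bounded_iff)
  have "bounded (\<phi> ` S)" using S test_fun_continuous[OF assms] compact_continuous_image compact_imp_bounded by blast
  then obtain B where B: "\<And>x. x \<in> S \<Longrightarrow> \<bar>\<phi> x\<bar> \<le> B" by (auto simp: bounded_iff)
  show thesis
  proof
    show "\<bar>B\<bar> \<ge> 0" "\<bar>R\<bar> \<ge> 0" by auto
    show "\<bar>\<phi> x\<bar> \<le> \<bar>B\<bar>" for x using B[of x] out[of x] by (cases "x \<in> S") auto
    show "\<phi> x = 0" if "norm x > \<bar>R\<bar>" for x using R[of x] out[of x] that by (cases "x \<in> S") auto
  qed
qed

lemma integrable_bounded_support:
  fixes f :: "'a::euclidean_space \<Rightarrow> 'b::{banach, second_countable_topology}"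
  assumes "f \<in> borel_measurable borel" "\<And>x. norm (f x) \<le> B" "\<And>x. norm x > R \<Longrightarrow> f x = 0"
  shows "integrable lborel f"
proof (rule Bochner_Integration.integrable_bound)
  show "integrable lborel (\<lambda>x. B * indicator (cball (0::'a) R) x :: real)"
    by (intro integrable_mult_right integrable_real_indicator emeasure_bounded_finite bounded_cball) simp_all
  show "AE x in lborel. norm (f x) \<le> norm (B * indicator (cball (0::'a) R) x :: real)"
  proof (rule AE_I2)
    fix x
    show "norm (f x) \<le> norm (B * indicator (cball (0::'a) R) x :: real)"
      using assms(2)[of x] assms(3)[of x] by (cases "norm x \<le> R") (auto simp: indicator_def)
  qed
qed (use assms in simp)

lemma test_fun_integrable:
  fixes \<phi> :: "'a::euclidean_space \<Rightarrow> real"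
  assumes "test_fun \<phi>"
  shows "integrable lborel \<phi>"
proof -
  obtain B R where "B \<ge> 0" "R \<ge> 0" "\<And>x. \<bar>\<phi> x\<bar> \<le> B" "\<And>x. norm x > R \<Longrightarrow> \<phi> x = 0"
    using test_fun_bounds[OF assms] by metis
  then show ?thesis using test_fun_measurable[OF assms] by (intro integrable_bounded_support[of _ B R]) auto
qed

lemma lborel_integral_shift:
  fixes f :: "'a::euclidean_space \<Rightarrow> 'b::{banach, second_countable_topology}"
  assumes "f \<in> borel_measurable borel"
  shows "(\<integral>x. f (c + x) \<partial>lborel) = (\<integral>x. f x \<partial>lborel)"
proof -
  have "(\<integral>x. f x \<partial>lborel) = (\<integral>x. f x \<partial>(distr lborel borel ((+) c)))" by (simp add: lborel_distr_plus)
  also have "\<dots> = (\<integral>x. f (c + x) \<partial>lborel)" by (rule integral_distr) (use assms in auto)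
  finally show ?thesis by simp
qed

lemma directional_DERIV:
  assumes "f differentiable (at (x + t *\<^sub>R v))"
  shows "((\<lambda>t. f (x + t *\<^sub>R v)) has_real_derivative frechet_derivative f (at (x + t *\<^sub>R v)) v) (at t)"
proof -
  define f' where "f' = frechet_derivative f (at (x + t *\<^sub>R v))"
  have f': "(f has_derivative f') (at (x + t *\<^sub>R v))" unfolding f'_def using assms frechet_derivative_works by blast
  have "((\<lambda>t. x + t *\<^sub>R v) has_derivative (\<lambda>h. h *\<^sub>R v)) (at t)"
    by (auto intro!: derivative_eq_intros)
  from has_derivative_compose[OF this f'] have "((\<lambda>t. f (x + t *\<^sub>R v)) has_derivative (\<lambda>h. f' (h *\<^sub>R v))) (at t)" .
  moreover have "(\<lambda>h. f' (h *\<^sub>R v)) = (*) (f' v)"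
    using has_derivative_linear[OF f'] by (simp add: linear_cmul fun_eq_iff mult.commute)
  ultimately show ?thesis unfolding has_field_derivative_def f'_def[symmetric] by simp
qed

lemma fourier_test_integrable:
  fixes \<phi> :: "'a::euclidean_space \<Rightarrow> real"
  assumes "test_fun \<phi>"
  shows "integrable lborel (\<lambda>x. exp (\<i> * of_real (inner l x)) * of_real (\<phi> x))"
proof -
  obtain B R where "B \<ge> 0" "R \<ge> 0" "\<And>x. \<bar>\<phi> x\<bar> \<le> B" "\<And>x. norm x > R \<Longrightarrow> \<phi> x = 0"
    using test_fun_bounds[OF assms] by metis
  then show ?thesis using test_fun_measurable[OF assms]
    by (intro integrable_bounded_support[of _ B R]) (auto simp: norm_mult)
qed

text \<open>Difference quotients and translation invariance of Lebesgue measure replace integration by parts.\<close>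
lemma fourier_derivative:
  fixes \<phi> :: "'a::euclidean_space \<Rightarrow> real"
  assumes \<phi>: "test_fun \<phi>"
  shows "fourier (\<lambda>x. of_real (frechet_derivative \<phi> (at x) v)) l
     = - \<i> * of_real (inner l v) * fourier (\<lambda>x. of_real (\<phi> x)) l"
proof -
  define \<psi> where "\<psi> x = frechet_derivative \<phi> (at x) v" for x
  have \<psi>: "test_fun \<psi>" unfolding \<psi>_def by (rule test_fun_derivative[OF \<phi>])
  note [measurable] = test_fun_measurable[OF \<phi>] test_fun_measurable[OF \<psi>]
  obtain B R where B: "B \<ge> 0" "R \<ge> 0" "\<And>x. \<bar>\<psi> x\<bar> \<le> B" "\<And>x. norm x > R \<Longrightarrow> \<psi> x = 0"
    using test_fun_bounds[OF \<psi>] by metis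
  obtain B' R' where B': "B' \<ge> 0" "R' \<ge> 0" "\<And>x. \<bar>\<phi> x\<bar> \<le> B'" "\<And>x. norm x > R' \<Longrightarrow> \<phi> x = 0"
    using test_fun_bounds[OF \<phi>] by metis
  define h where "h n = inverse (real (Suc n))" for n
  have h: "h n > 0" "h n \<le> 1" for n by (auto simp: h_def divide_simps)
  have h0: "h \<longlonglongrightarrow> 0" unfolding h_def by (rule LIMSEQ_inverse_real_of_nat)
  have D: "((\<lambda>t. \<phi> (x + t *\<^sub>R v)) has_real_derivative \<psi> (x + t *\<^sub>R v)) (at t)" for x t
    unfolding \<psi>_def using \<phi> by (intro directional_DERIV smooth_fun_differentiable) (simp add: test_fun_def)
  define q where "q n x = (\<phi> (x + h n *\<^sub>R v) - \<phi> x) / h n" for n x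
  have qm [measurable]: "q n \<in> borel_measurable borel" for n unfolding q_def by measurable
  have qlim: "(\<lambda>n. q n x) \<longlonglongrightarrow> \<psi> x" for x
  proof -
    have "((\<lambda>t. (\<phi> (x + t *\<^sub>R v) - \<phi> x) / t) \<longlongrightarrow> \<psi> x) (at 0)"
      using D[of x 0] by (simp add: DERIV_def)
    moreover have "filterlim h (at 0) sequentially"
      using h0 h(1) by (auto simp: filterlim_at intro!: always_eventually) (metis less_irrefl)
    ultimately show ?thesis unfolding q_def by (rule filterlim_compose)
  qed
  have qbound: "\<bar>q n x\<bar> \<le> B" for n x
  proof -
    obtain z where "\<phi> (x + h n *\<^sub>R v) - \<phi> (x + 0 *\<^sub>R v) = (h n - 0) * \<psi> (x + z *\<^sub>R v)"
      using MVT2[OF h(1), of n "\<lambda>t. \<phi> (x + t *\<^sub>R v)" "\<lambda>t. \<psi> (x + t *\<^sub>R v)"] D by blast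
    then have "q n x = \<psi> (x + z *\<^sub>R v)" using h(1)[of n] by (simp add: q_def)
    then show ?thesis using B(3) by simp
  qed
  have qout: "q n x = 0" if "norm x > R' + norm v" for n x
  proof -
    have "norm (h n *\<^sub>R v) \<le> norm v" using h[of n] by (simp add: mult_left_le_one_le)
    then have "norm (x + h n *\<^sub>R v) > R'" using that norm_diff_ineq[of x "h n *\<^sub>R v"] by linarith
    moreover have "norm x > R'" using that norm_ge_zero[of v] by linarith
    ultimately show ?thesis using B'(4) by (simp add: q_def)
  qed
  define E where "E x = exp (\<i> * of_real (inner l x))" for x
  have Em [measurable]: "E \<in> borel_measurable borel" unfolding E_def by measurable
  have nE: "norm (E x) = 1" for x by (simp add: E_def)
  have "(\<lambda>n. \<integral>x. E x * of_real (q n x) \<partial>lborel) \<longlonglongrightarrow> (\<integral>x. E x * of_real (\<psi> x) \<partial>lborel)"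
  proof (rule integral_dominated_convergence[where w="\<lambda>x. B * indicator (cball 0 (R' + norm v)) x"])
    show "integrable lborel (\<lambda>x. B * indicator (cball (0::'a) (R' + norm v)) x :: real)"
      by (intro integrable_mult_right integrable_real_indicator emeasure_bounded_finite bounded_cball) simp_all
    show "AE x in lborel. (\<lambda>n. E x * of_real (q n x)) \<longlonglongrightarrow> E x * of_real (\<psi> x)"
      by (intro AE_I2 tendsto_intros qlim)
    show "AE x in lborel. norm (E x * of_real (q n x)) \<le> B * indicator (cball 0 (R' + norm v)) x" for n
    proof (rule AE_I2)
      fix x
      show "norm (E x * of_real (q n x)) \<le> B * indicator (cball 0 (R' + norm v)) x"
        using qbound[of n x] qout[of x n] nE by (cases "norm x \<le> R' + norm v") (auto simp: norm_mult)
    qed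
  qed simp_all
  moreover have "(\<integral>x. E x * of_real (q n x) \<partial>lborel)
      = (exp (- \<i> * of_real (inner l v) * of_real (h n)) - 1) / of_real (h n) * (\<integral>x. E x * of_real (\<phi> x) \<partial>lborel)" for n
  proof -
    have i1: "integrable lborel (\<lambda>x. E x * of_real (\<phi> x))"
      unfolding E_def by (rule fourier_test_integrable[OF \<phi>])
    have i2: "integrable lborel (\<lambda>x. E x * of_real (\<phi> (x + h n *\<^sub>R v)))"
    proof (rule integrable_bounded_support[of _ B' "R' + norm v"])
      show "norm (E x * of_real (\<phi> (x + h n *\<^sub>R v))) \<le> B'" for x using B'(3) nE by (simp add: norm_mult)
      fix x :: 'a assume *: "norm x > R' + norm v"
      have "norm (h n *\<^sub>R v) \<le> norm v" using h[of n] by (simp add: mult_left_le_one_le)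
      then have "norm (x + h n *\<^sub>R v) > R'" using * norm_diff_ineq[of x "h n *\<^sub>R v"] by linarith
      then show "E x * of_real (\<phi> (x + h n *\<^sub>R v)) = 0" using B'(4) by simp
    qed measurable
    have "(\<integral>x. E x * of_real (\<phi> (x + h n *\<^sub>R v)) \<partial>lborel)
        = (\<integral>x. exp (- \<i> * of_real (inner l v) * of_real (h n)) * (E (h n *\<^sub>R v + x) * of_real (\<phi> (h n *\<^sub>R v + x))) \<partial>lborel)"
      by (rule Bochner_Integration.integral_cong)
        (auto simp: E_def inner_add_right exp_add[symmetric] algebra_simps mult_exp_exp)
    also have "\<dots> = exp (- \<i> * of_real (inner l v) * of_real (h n)) * (\<integral>x. E x * of_real (\<phi> x) \<partial>lborel)"
      by (subst lborel_integral_shift[of "\<lambda>x. exp (- \<i> * of_real (inner l v) * of_real (h n)) * (E x * of_real (\<phi> x))"])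
        (use i1 in auto)
    finally have sh: "(\<integral>x. E x * of_real (\<phi> (x + h n *\<^sub>R v)) \<partial>lborel) = exp (- \<i> * of_real (inner l v) * of_real (h n)) * (\<integral>x. E x * of_real (\<phi> x) \<partial>lborel)" .
    have "(\<integral>x. E x * of_real (q n x) \<partial>lborel) = (\<integral>x. (E x * of_real (\<phi> (x + h n *\<^sub>R v)) - E x * of_real (\<phi> x)) / of_real (h n) \<partial>lborel)"
      by (rule Bochner_Integration.integral_cong) (auto simp: q_def algebra_simps)
    also have "\<dots> = ((\<integral>x. E x * of_real (\<phi> (x + h n *\<^sub>R v)) \<partial>lborel) - (\<integral>x. E x * of_real (\<phi> x) \<partial>lborel)) / of_real (h n)"
      using i1 i2 by simp
    finally show ?thesis unfolding sh by (simp add: algebra_simps)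
  qed
  moreover have "(\<lambda>n. (exp (- \<i> * of_real (inner l v) * of_real (h n)) - 1) / of_real (h n)) \<longlonglongrightarrow> - \<i> * of_real (inner l v)"
  proof -
    have "((\<lambda>z. exp (- \<i> * of_real (inner l v) * z)) has_field_derivative (- \<i> * of_real (inner l v))) (at 0)"
      by (auto intro!: derivative_eq_intros)
    then have "((\<lambda>z. (exp (- \<i> * of_real (inner l v) * z) - 1) / z) \<longlongrightarrow> - \<i> * of_real (inner l v)) (at 0)"
      by (simp add: DERIV_def)
    moreover have "filterlim (\<lambda>n. complex_of_real (h n)) (at 0) sequentially"
    proof -
      have "(\<lambda>n. complex_of_real (h n)) \<longlonglongrightarrow> 0" using tendsto_of_real[OF h0, where 'a=complex] by simp
      moreover have "complex_of_real (h n) \<noteq> 0" for n using h(1)[of n] by simp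
      ultimately show ?thesis by (simp add: filterlim_at)
    qed
    ultimately show ?thesis by (rule filterlim_compose)
  qed
  ultimately have "(\<integral>x. E x * of_real (\<psi> x) \<partial>lborel) = - \<i> * of_real (inner l v) * (\<integral>x. E x * of_real (\<phi> x) \<partial>lborel)"
    by (intro LIMSEQ_unique[OF _ tendsto_mult_right]) simp_all
  then show ?thesis by (simp add: fourier_def E_def \<psi>_def)
qed

lemma fourier_norm_le:
  fixes \<phi> :: "'a::euclidean_space \<Rightarrow> real"
  shows "norm (fourier (\<lambda>x. of_real (\<phi> x)) l) \<le> (\<integral>x. \<bar>\<phi> x\<bar> \<partial>lborel)"
  unfolding fourier_def by (rule order_trans[OF integral_norm_bound]) (simp add: norm_mult)

text \<open>By \<open>fourier_derivative\<close> each factor \<open>|<l, b>|\<close> costs one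
  derivative of \<open>\<phi>\<close>, and \<open>|l|\<close> is at most the sum of these factors
  over the basis. Derivatives are test functions again, so the induction runs over all
  \<open>\<phi>\<close> at once.\<close>

lemma fourier_decay:
  fixes \<phi> :: "'a::euclidean_space \<Rightarrow> real"
  assumes "test_fun \<phi>"
  shows "\<exists>C. \<forall>l. (1 + norm l) ^ N * norm (fourier (\<lambda>x. of_real (\<phi> x)) l) \<le> C"
  using assms
proof (induction N arbitrary: \<phi>)
  case 0
  then show ?case using fourier_norm_le[of \<phi>] by auto
next
  case (Suc N)
  define F where "F \<phi> l = norm (fourier (\<lambda>x. complex_of_real (\<phi> x)) l)" for \<phi> :: "'a \<Rightarrow> real" and l
  define D where "D b x = frechet_derivative \<phi> (at x) b" for b x
  have "\<exists>C. \<forall>l. (1 + norm l) ^ N * F (D b) l \<le> C" for b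
    unfolding F_def D_def by (rule Suc.IH) (rule test_fun_derivative[OF Suc.prems])
  then obtain C where C: "\<And>b l. (1 + norm l) ^ N * F (D b) l \<le> C b" by metis
  obtain C0 where C0: "\<And>l. (1 + norm l) ^ N * F \<phi> l \<le> C0"
    using Suc.IH[OF Suc.prems] unfolding F_def by blast
  have FD: "F (D b) l = \<bar>inner l b\<bar> * F \<phi> l" for b l
    unfolding F_def D_def fourier_derivative[OF Suc.prems] by (simp add: norm_mult)
  have "(1 + norm l) ^ Suc N * F \<phi> l \<le> C0 + (\<Sum>b\<in>Basis. C b)" for l
  proof -
    have "(1 + norm l) ^ Suc N * F \<phi> l = (1 + norm l) ^ N * F \<phi> l + (1 + norm l) ^ N * (norm l * F \<phi> l)"
      by (simp add: algebra_simps)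
    also have "norm l * F \<phi> l \<le> (\<Sum>b\<in>Basis. \<bar>inner l b\<bar>) * F \<phi> l"
      by (intro mult_right_mono norm_le_l1) (simp add: F_def)
    also have "(1 + norm l) ^ N * ((\<Sum>b\<in>Basis. \<bar>inner l b\<bar>) * F \<phi> l) = (\<Sum>b\<in>Basis. (1 + norm l) ^ N * F (D b) l)"
      by (simp add: FD sum_distrib_left sum_distrib_right)
    also have "\<dots> \<le> (\<Sum>b\<in>Basis. C b)" by (intro sum_mono C)
    finally show ?thesis using C0[of l] by (simp add: mult_left_mono)
  qed
  then show ?case unfolding F_def by blast
qed

section \<open>Smooth bump functions\<close>

definition exp_inv :: "nat \<Rightarrow> real \<Rightarrow> real" where
  "exp_inv m t = (if t > 0 then exp (- inverse t) * inverse t ^ m else 0)"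

lemma exp_inv_tendsto_0: "(exp_inv m \<longlongrightarrow> 0) (at 0)"
proof -
  have "((\<lambda>t. inverse t ^ m / exp (inverse t)) \<longlongrightarrow> (0::real)) (at_right 0)"
    by (rule filterlim_compose[OF tendsto_power_div_exp_0 filterlim_inverse_at_top_right])
  then have "(exp_inv m \<longlongrightarrow> 0) (at_right 0)"
    by (rule Lim_transform_eventually) (auto simp: eventually_at_right_field exp_inv_def exp_minus field_simps intro!: exI[of _ 1])
  moreover have "(exp_inv m \<longlongrightarrow> 0) (at_left 0)"
    by (rule tendsto_eventually) (auto simp: eventually_at_left_field exp_inv_def intro!: exI[of _ "-1"])
  ultimately show ?thesis by (simp add: filterlim_at_split)
qed

text \<open>The functions \<open>exp(-1/t) t^(-m)\<close>, extended by 0 to \<open>t <= 0\<close>,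
  are closed under differentiation up to linear combinations, so one formula covers all orders. At
  \<open>t = 0\<close> the difference quotient of index \<open>m\<close> is the function of index
  \<open>m + 1\<close>, which tends to 0.\<close>

lemma exp_inv_DERIV: "(exp_inv m has_real_derivative exp_inv (m + 2) t - real m * exp_inv (m + 1) t) (at t)"
proof -
  consider "t > 0" | "t < 0" | "t = 0" by linarith
  then show ?thesis
  proof cases
    case 1
    have "((\<lambda>t. exp (- inverse t) * inverse t ^ m) has_real_derivative exp_inv (m + 2) t - real m * exp_inv (m + 1) t) (at t)"
    proof (cases m)
      case 0
      then show ?thesis using 1 by (auto intro!: derivative_eq_intros simp: exp_inv_def field_simps power2_eq_square)
    next
      case (Suc k)
      show ?thesis unfolding Suc
        by (rule derivative_eq_intros refl | use 1 in \<open>simp; fail\<close>)+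
          (use 1 in \<open>simp add: exp_inv_def field_simps power2_eq_square\<close>)
    qed
    then show ?thesis
      by (rule DERIV_cong_ev[THEN iffD1, OF refl _ refl, rotated])
        (use 1 in \<open>auto simp: exp_inv_def eventually_nhds intro!: exI[of _ "{0<..}"]\<close>)
  next
    case 2
    have "((\<lambda>t. 0) has_real_derivative exp_inv (m + 2) t - real m * exp_inv (m + 1) t) (at t)"
      using 2 by (simp add: exp_inv_def)
    then show ?thesis
      by (rule DERIV_cong_ev[THEN iffD1, OF refl _ refl, rotated])
        (use 2 in \<open>auto simp: exp_inv_def eventually_nhds intro!: exI[of _ "{..<0}"]\<close>)
  next
    case 3
    have "((\<lambda>h. (exp_inv m (0 + h) - exp_inv m 0) / h) \<longlongrightarrow> 0) (at 0)"
      by (rule Lim_transform_eventually[OF exp_inv_tendsto_0[of "Suc m"]])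
        (auto simp: exp_inv_def divide_inverse eventually_at_filter)
    then show ?thesis using 3 by (simp add: DERIV_def exp_inv_def)
  qed
qed

text \<open>A class that contains the bump and is stable under directional derivatives: the
  invariant for a coinductive proof of \<open>smooth_fun\<close>.\<close>

inductive bump_algebra :: "'a::euclidean_space \<Rightarrow> real \<Rightarrow> ('a \<Rightarrow> real) \<Rightarrow> bool" for x0 :: 'a and \<rho> :: real where
  profile: "bump_algebra x0 \<rho> (\<lambda>x. exp_inv m (\<rho>\<^sup>2 - inner (x - x0) (x - x0)))"
| linear: "bump_algebra x0 \<rho> (\<lambda>x. inner (x - x0) v)"
| const: "bump_algebra x0 \<rho> (\<lambda>x. a)"
| add: "bump_algebra x0 \<rho> f \<Longrightarrow> bump_algebra x0 \<rho> g \<Longrightarrow> bump_algebra x0 \<rho> (\<lambda>x. f x + g x)"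
| mult: "bump_algebra x0 \<rho> f \<Longrightarrow> bump_algebra x0 \<rho> g \<Longrightarrow> bump_algebra x0 \<rho> (\<lambda>x. f x * g x)"

lemma bump_algebra_derivative:
  assumes "bump_algebra x0 \<rho> f"
  shows "\<exists>f'. (\<forall>x. (f has_derivative f' x) (at x)) \<and> (\<forall>v. bump_algebra x0 \<rho> (\<lambda>x. f' x v))"
  using assms
proof induction
  case (profile m)
  define f' where "f' x v = (exp_inv (m + 2) (\<rho>\<^sup>2 - inner (x - x0) (x - x0)) + (- real m) * exp_inv (m + 1) (\<rho>\<^sup>2 - inner (x - x0) (x - x0)))
    * (-2 * inner (x - x0) v)" for x v
  have "((\<lambda>x. exp_inv m (\<rho>\<^sup>2 - inner (x - x0) (x - x0))) has_derivative f' x) (at x)" for x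
  proof -
    have "((\<lambda>x. \<rho>\<^sup>2 - inner (x - x0) (x - x0)) has_derivative (\<lambda>v. -2 * inner (x - x0) v)) (at x)"
      by (auto intro!: derivative_eq_intros simp: inner_commute)
    from has_derivative_compose[OF this exp_inv_DERIV[unfolded has_field_derivative_def]]
    show ?thesis by (simp add: f'_def[abs_def])
  qed
  moreover have "bump_algebra x0 \<rho> (\<lambda>x. f' x v)" for v
    unfolding f'_def by (intro bump_algebra.intros)
  ultimately show ?case by blast
next
  case (linear v)
  have "((\<lambda>x. inner (x - x0) v) has_derivative (\<lambda>h. inner h v)) (at x)" for x
    by (auto intro!: derivative_eq_intros)
  then show ?case using bump_algebra.const by (intro exI[of _ "\<lambda>x h. inner h v"]) blast
next
  case (const a)
  then show ?case using bump_algebra.const by (intro exI[of _ "\<lambda>x h. 0"]) auto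
next
  case (add f g)
  then obtain f' g' where "\<And>x. (f has_derivative f' x) (at x)" "\<And>v. bump_algebra x0 \<rho> (\<lambda>x. f' x v)"
    "\<And>x. (g has_derivative g' x) (at x)" "\<And>v. bump_algebra x0 \<rho> (\<lambda>x. g' x v)" by blast
  then show ?case
    by (intro exI[of _ "\<lambda>x h. f' x h + g' x h"]) (auto intro: has_derivative_add bump_algebra.add)
next
  case (mult f g)
  then obtain f' g' where "\<And>x. (f has_derivative f' x) (at x)" "\<And>v. bump_algebra x0 \<rho> (\<lambda>x. f' x v)"
    "\<And>x. (g has_derivative g' x) (at x)" "\<And>v. bump_algebra x0 \<rho> (\<lambda>x. g' x v)" by blast
  note fg = this
  have "bump_algebra x0 \<rho> (\<lambda>x. f x * g' x v + f' x v * g x)" for v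
    by (rule bump_algebra.add[OF bump_algebra.mult bump_algebra.mult]) (rule mult.hyps fg)+
  then show ?case
    using has_derivative_mult[OF fg(1) fg(3)] by (intro exI[of _ "\<lambda>x h. f x * g' x h + f' x h * g x"]) blast
qed

lemma bump_algebra_smooth: "bump_algebra x0 \<rho> f \<Longrightarrow> smooth_fun f"
proof (coinduction arbitrary: f)
  case smooth_fun
  then obtain f' where f': "\<And>x. (f has_derivative f' x) (at x)" "\<And>v. bump_algebra x0 \<rho> (\<lambda>x. f' x v)"
    using bump_algebra_derivative by blast
  have "frechet_derivative f (at x) = f' x" for x using frechet_derivative_at[OF f'(1)] by simp
  then show ?case using f' by (auto simp: differentiable_def)
qed

lemma bump_test_fun:
  fixes x0 :: "'a::euclidean_space"
  assumes "\<rho> > 0"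
  shows "\<exists>\<phi>. test_fun \<phi> \<and> closure {x. \<phi> x \<noteq> 0} \<subseteq> cball x0 \<rho> \<and> (\<forall>x. \<phi> x \<ge> 0) \<and> \<phi> x0 > 0"
proof -
  define \<phi> where "\<phi> x = exp_inv 0 (\<rho>\<^sup>2 - inner (x - x0) (x - x0))" for x
  have "{x. \<phi> x \<noteq> 0} \<subseteq> cball x0 \<rho>"
  proof
    fix x assume "x \<in> {x. \<phi> x \<noteq> 0}"
    then have "(norm (x - x0))\<^sup>2 < \<rho>\<^sup>2" by (auto simp: \<phi>_def exp_inv_def power2_norm_eq_inner split: if_splits)
    then have "norm (x - x0) < \<rho>" using assms power_less_imp_less_base by fastforce
    then show "x \<in> cball x0 \<rho>" by (simp add: dist_norm norm_minus_commute)
  qed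
  then have sub: "closure {x. \<phi> x \<noteq> 0} \<subseteq> cball x0 \<rho>" by (simp add: closure_minimal)
  then have "compact (closure {x. \<phi> x \<noteq> 0})"
    using compact_cball closed_closure compact_Int_closed inf.absorb_iff2 by metis
  moreover have "smooth_fun \<phi>" unfolding \<phi>_def by (rule bump_algebra_smooth) (rule bump_algebra.profile)
  ultimately show ?thesis using sub assms by (intro exI[of _ \<phi>]) (auto simp: test_fun_def \<phi>_def exp_inv_def)
qed

section \<open>Boundary values of the Laplace transform\<close>

lemma arctan_near_half_pi:
  assumes "\<delta> > 0" "\<epsilon> > 0" "\<delta> \<le> \<bar>t\<bar>"
  shows "\<bar>arctan (t / \<epsilon>) - sgn t * (pi / 2)\<bar> \<le> \<epsilon> / \<delta>"
proof -
  have pos: "\<bar>arctan (u / \<epsilon>) - pi / 2\<bar> \<le> \<epsilon> / \<delta>" if "\<delta> \<le> u" for u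
  proof -
    have u: "u > 0" using that assms by linarith
    have "arctan (inverse (\<epsilon> / u)) = pi / 2 - arctan (\<epsilon> / u)"
      by (rule arctan_inverse) (use u assms in simp)
    then have "arctan (u / \<epsilon>) - pi / 2 = - arctan (\<epsilon> / u)" by simp
    moreover have "\<bar>arctan (\<epsilon> / u)\<bar> \<le> \<epsilon> / u" using abs_arctan_le[of "\<epsilon> / u"] u assms by simp
    moreover have "\<epsilon> / u \<le> \<epsilon> / \<delta>" using that assms u by (simp add: frac_le)
    ultimately show ?thesis by linarith
  qed
  show ?thesis
  proof (cases "t > 0")
    case True
    then show ?thesis using pos[of t] assms(3) by simp
  next
    case False
    then have "t < 0" using assms by linarith
    moreover have "arctan (t / \<epsilon>) = - arctan (- t / \<epsilon>)" by (simp add: arctan_minus)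
    ultimately show ?thesis using pos[of "- t"] assms(3) by (simp add: abs_minus_commute)
  qed
qed

lemma Ln_minus_ii_times:
  assumes "t \<noteq> 0"
  shows "Ln (- \<i> * complex_of_real t) = complex_of_real (ln \<bar>t\<bar>) - \<i> * complex_of_real (sgn t * (pi / 2))"
proof (cases "t > 0")
  case True
  then show ?thesis using Ln_times_of_real[of t "- \<i>"] by (simp add: mult.commute Ln_of_real)
next
  case False
  then have "- t > 0" using assms by linarith
  then have "Ln (complex_of_real (- t) * \<i>) = complex_of_real (ln (- t)) + \<i> * complex_of_real (pi / 2)"
    using Ln_times_of_real[of "- t" "\<i>"] Ln_of_real[of "- t"] by simp
  moreover have "- \<i> * complex_of_real t = complex_of_real (- t) * \<i>" by simp
  ultimately show ?thesis using \<open>- t > 0\<close> by (simp only:) simp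
qed

text \<open>By Markov's inequality the level sets where \<open>u\<close> is at least
  \<open>1/(n+1)\<close> have finite measure, and positivity makes them exhaust the space. Fubini
  for \<open>\<mu>\<close> relies on this, with an exponential damping factor as
  \<open>u\<close>.\<close>

lemma sigma_finite_if_positive_integrable:
  fixes u :: "'b \<Rightarrow> real"
  assumes u: "integrable M u" and pos: "\<And>x. u x > 0"
  shows "sigma_finite_measure M"
proof
  define A where "A n = {x \<in> space M. u x \<ge> inverse (real (Suc n))}" for n
  have [measurable]: "u \<in> borel_measurable M" using u by simp
  have "emeasure M (A n) \<noteq> \<infinity>" for n
  proof -
    have "emeasure M (A n) \<le> ennreal (1 / inverse (real (Suc n)) * (\<integral>x. u x \<partial>M))"
      unfolding A_def by (rule integral_Markov_inequality[OF u]) (use pos in \<open>auto intro: less_imp_le\<close>)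
    then show ?thesis by (auto simp: top_unique)
  qed
  moreover have "x \<in> (\<Union>n. A n)" if "x \<in> space M" for x
  proof -
    obtain n where "inverse (real (Suc n)) < u x" using reals_Archimedean[OF pos] by blast
    then show ?thesis using that by (auto simp: A_def intro!: exI[of _ n])
  qed
  ultimately show "\<exists>A. countable A \<and> A \<subseteq> sets M \<and> \<Union> A = space M \<and> (\<forall>a\<in>A. emeasure M a \<noteq> \<infinity>)"
    by (intro exI[of _ "range A"]) (auto simp: A_def)
qed

text \<open>The path takes values in the discrete set \<open>2 pi i Z\<close>. The lemma serves to
  compare two continuous logarithms of the same function.\<close>

lemma unit_exp_path_constant:
  fixes g :: "real \<Rightarrow> complex"
  assumes "continuous_on {0..1} g" "\<And>u. u \<in> {0..1} \<Longrightarrow> exp (g u) = 1"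
  shows "g 1 = g 0"
proof -
  have "g constant_on {0..1}"
  proof (rule continuous_discrete_range_constant)
    fix u :: real assume u: "u \<in> {0..1}"
    have "1 \<le> norm (g v - g u)" if v: "v \<in> {0..1}" "g v \<noteq> g u" for v
    proof -
      obtain m where m: "Re (g u) = 0" "Im (g u) = of_int (2 * m) * pi" using assms(2)[OF u] exp_eq_1 by blast
      obtain n where n: "Re (g v) = 0" "Im (g v) = of_int (2 * n) * pi" using assms(2)[OF v(1)] exp_eq_1 by blast
      have "n \<noteq> m" using v(2) m n by (auto simp: complex_eq_iff)
      then have "\<bar>real_of_int (n - m)\<bar> \<ge> 1" by linarith
      moreover have "Im (g v - g u) = 2 * pi * real_of_int (n - m)" using m n by (simp add: algebra_simps)
      then have "\<bar>Im (g v - g u)\<bar> = 2 * pi * \<bar>real_of_int (n - m)\<bar>" by (simp add: abs_mult)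
      moreover have "2 * pi * 1 \<le> 2 * pi * \<bar>real_of_int (n - m)\<bar>"
        using calculation(1) by (intro mult_left_mono) auto
      ultimately show ?thesis using abs_Im_le_cmod[of "g v - g u"] pi_gt3 by linarith
    qed
    then show "\<exists>\<epsilon>>0. \<forall>v. v \<in> {0..1} \<and> g v \<noteq> g u \<longrightarrow> \<epsilon> \<le> norm (g v - g u)" by (intro exI[of _ 1]) auto
  qed (use assms in auto)
  then show ?thesis by (auto simp: constant_on_def)
qed

section \<open>The transform of a Riesz measure and local constancy of the index\<close>

locale riesz_setting = ranked_euclidean_jordan jm e r c
  for jm :: "'a::euclidean_space \<Rightarrow> 'a \<Rightarrow> 'a" (infixl "\<odot>" 70) and e :: 'a and r :: nat and c :: "nat \<Rightarrow> 'a" +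
  fixes s :: real and \<mu> :: "'a measure"
  assumes riesz: "riesz_measure jm e r s \<mu>" and s_nonneg: "0 \<le> s"
begin

text \<open>Some list of eigenvalues is chosen for each \<open>x\<close>, with no regularity in
  \<open>x\<close> claimed. It enters only through symmetric expressions and through bounds valid
  for every decomposition, so the choice is immaterial.\<close>

definition ev :: "'a \<Rightarrow> nat \<Rightarrow> real" where
  "ev x = (SOME l. \<exists>d. spectral_decomp jm e r x l d)"

lemma ev_spectral: "\<exists>d. spectral_decomp jm e r x (ev x) d"
  unfolding ev_def by (rule someI_ex[of "\<lambda>l. \<exists>d. spectral_decomp jm e r x l d"]) (rule spectral_exists)

lemma sets_\<mu> [measurable_cong]: "sets \<mu> = sets borel"
  using riesz by (simp add: riesz_measure_def)

lemma AE_\<mu>_nonneg: "AE m in \<mu>. 0 \<le> inner m e"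
proof (rule AE_I)
  show "{x \<in> space \<mu>. \<not> 0 \<le> inner x e} \<subseteq> UNIV - dual_cone (sym_cone jm)"
    using interior_subset[THEN subsetD, OF e_interior_cone] by (auto simp: dual_cone_def)
  show "emeasure \<mu> (UNIV - dual_cone (sym_cone jm)) = 0" using riesz by (simp add: riesz_measure_def)
  have "dual_cone (sym_cone jm) = (\<Inter>x\<in>sym_cone jm. {l. 0 \<le> inner l x})" by (auto simp: dual_cone_def)
  moreover have "closed \<dots>"
    by (intro closed_INT ballI closed_Collect_le continuous_intros)
  ultimately have "closed (dual_cone (sym_cone jm))" by simp
  then show "UNIV - dual_cone (sym_cone jm) \<in> sets \<mu>" unfolding sets_\<mu> by (auto intro: borel_closed)
qed

lemma scaled_unit_interior:
  assumes "\<epsilon> > 0" shows "\<epsilon> *\<^sub>R e \<in> interior (sym_cone jm)"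
proof -
  obtain \<rho> where \<rho>: "\<rho> > 0" "ball e \<rho> \<subseteq> sym_cone jm" using e_interior_cone by (auto simp: mem_interior)
  have "ball (\<epsilon> *\<^sub>R e) (\<epsilon> * \<rho>) \<subseteq> sym_cone jm"
  proof
    fix y assume y: "y \<in> ball (\<epsilon> *\<^sub>R e) (\<epsilon> * \<rho>)"
    have "norm (\<epsilon> *\<^sub>R e - y) = \<epsilon> * norm (e - y /\<^sub>R \<epsilon>)"
    proof -
      have "\<epsilon> *\<^sub>R e - y = \<epsilon> *\<^sub>R (e - y /\<^sub>R \<epsilon>)" using assms by (simp add: algebra_simps)
      then show ?thesis using assms by simp
    qed
    then have "y /\<^sub>R \<epsilon> \<in> ball e \<rho>" using y assms by (simp add: dist_norm)
    then have "y /\<^sub>R \<epsilon> \<in> sym_cone jm" using \<rho>(2) by blast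
    then have "\<forall>d. d \<odot> d = d \<longrightarrow> 0 \<le> inner y d / \<epsilon>" by (simp add: sym_cone_iff divide_inverse mult.commute)
    then show "y \<in> sym_cone jm" using assms by (simp add: sym_cone_iff zero_le_divide_iff)
  qed
  then show ?thesis using \<rho>(1) assms unfolding mem_interior by (intro exI[of _ "\<epsilon> * \<rho>"]) auto
qed

lemma scaled_unit_tube: "\<epsilon> > 0 \<Longrightarrow> (x, \<epsilon> *\<^sub>R e) \<in> tube jm"
  by (simp add: tube_def scaled_unit_interior)

text \<open>Every factor \<open>\<epsilon> - i u l_j\<close> has real part
  \<open>\<epsilon> > 0\<close>, so the sum of principal logarithms is continuous in
  \<open>u\<close> and differs from \<open>L\<close> by a constant, which is read off at
  \<open>u = 0\<close>.\<close>

lemma log_branch: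
  assumes L: "continuous_on (tube jm) L" "\<And>x y. (x, y) \<in> tube jm \<Longrightarrow> exp (L (x, y)) = cdet jm e r y (- x)"
    and \<epsilon>: "\<epsilon> > 0" and sp: "spectral_decomp jm e r x l d"
  shows "L (x, \<epsilon> *\<^sub>R e) = L (0, \<epsilon> *\<^sub>R e) - of_real (real r * ln \<epsilon>)
           + (\<Sum>j\<in>{1..r}. Ln (of_real \<epsilon> - \<i> * of_real (l j)))"
proof -
  define g where "g u = L (u *\<^sub>R x, \<epsilon> *\<^sub>R e) - (\<Sum>j\<in>{1..r}. Ln (of_real \<epsilon> - \<i> * of_real (u * l j)))" for u
  have "g 1 = g 0"
  proof (rule unit_exp_path_constant)
    have "continuous_on {0..1} (\<lambda>u. L (u *\<^sub>R x, \<epsilon> *\<^sub>R e))"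
      by (rule continuous_on_compose2[OF L(1)]) (auto intro!: continuous_intros scaled_unit_tube \<epsilon>)
    moreover have "continuous_on {0..1} (\<lambda>u. Ln (of_real \<epsilon> - \<i> * of_real (u * l j)))" for j
      by (intro continuous_intros) (use \<epsilon> in \<open>auto simp: complex_nonpos_Reals_iff\<close>)
    ultimately show "continuous_on {0..1} g"
      unfolding g_def by (intro continuous_on_diff continuous_on_sum)
  next
    fix u :: real
    have nz: "complex_of_real \<epsilon> - \<i> * of_real (u * l j) \<noteq> 0" for j
      using \<epsilon> by (auto simp: complex_eq_iff)
    have "exp (L (u *\<^sub>R x, \<epsilon> *\<^sub>R e)) = (\<Prod>j\<in>{1..r}. complex_of_real \<epsilon> - \<i> * of_real (u * l j))"
      using L(2)[OF scaled_unit_tube[OF \<epsilon>]] cdet_spectral[OF spectral_affine[OF sp, of 0 u], of \<epsilon>] by simp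
    moreover have "exp (\<Sum>j\<in>{1..r}. Ln (of_real \<epsilon> - \<i> * of_real (u * l j))) = (\<Prod>j\<in>{1..r}. complex_of_real \<epsilon> - \<i> * of_real (u * l j))"
      using nz by (simp add: exp_sum)
    ultimately show "exp (g u) = 1"
      unfolding g_def exp_diff using nz by simp
  qed
  moreover have "Ln (complex_of_real \<epsilon>) = of_real (ln \<epsilon>)" using \<epsilon> by (rule Ln_of_real)
  ultimately show ?thesis by (simp add: g_def algebra_simps)
qed

lemma riesz_transform:
  assumes \<epsilon>: "\<epsilon> > 0" and sp: "spectral_decomp jm e r x l d"
  shows "(\<integral>m. exp (\<i> * of_real (inner m x) - of_real (inner m (\<epsilon> *\<^sub>R e))) \<partial>\<mu>)
           = exp (- of_real s * (\<Sum>j\<in>{1..r}. Ln (of_real \<epsilon> - \<i> * of_real (l j))))"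
    and "integrable \<mu> (\<lambda>m. exp (\<i> * of_real (inner m x) - of_real (inner m (\<epsilon> *\<^sub>R e))))"
proof -
  obtain L where L: "continuous_on (tube jm) L" "\<And>x y. (x, y) \<in> tube jm \<Longrightarrow> exp (L (x, y)) = cdet jm e r y (- x)"
    "\<And>y. y \<in> interior (sym_cone jm) \<Longrightarrow> exp (- of_real s * L (0, y)) \<in> \<real> \<and> 0 < Re (exp (- of_real s * L (0, y)))"
    "\<And>x y. (x, y) \<in> tube jm \<Longrightarrow> integrable \<mu> (\<lambda>l. exp (\<i> * of_real (inner l x) - of_real (inner l y)))"
    "\<And>x y. (x, y) \<in> tube jm \<Longrightarrow> (\<integral>l. exp (\<i> * of_real (inner l x) - of_real (inner l y)) \<partial>\<mu>) = exp (- of_real s * L (x, y))"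
    using riesz unfolding riesz_measure_def by blast
  show "integrable \<mu> (\<lambda>m. exp (\<i> * of_real (inner m x) - of_real (inner m (\<epsilon> *\<^sub>R e))))"
    by (rule L(4)[OF scaled_unit_tube[OF \<epsilon>]])
  define A where "A = L (0, \<epsilon> *\<^sub>R e)"
  obtain l0 d0 where sp0: "spectral_decomp jm e r 0 l0 d0" using spectral_exists by blast
  have "spectral_decomp jm e r 0 (\<lambda>j. 0) d0" using spectral_affine[OF sp0, of 0 0] by simp
  from cdet_spectral[OF this, of \<epsilon>] have "exp A = of_real (\<epsilon> ^ r)"
    using L(2)[OF scaled_unit_tube[OF \<epsilon>], of 0] by (simp add: A_def)
  then have "exp (Re A) = \<epsilon> ^ r" using \<epsilon> by (metis norm_exp_eq_Re norm_of_real abs_of_pos zero_less_power)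
  then have ReA: "Re A = real r * ln \<epsilon>" using \<epsilon> by (metis ln_exp ln_realpow)
  \<comment> \<open>\<open>exp A\<close> determines only the real part of \<open>A\<close>; the
    imaginary part may be any multiple of \<open>2 pi\<close>, which could leave a phase in
    \<open>exp(-s A)\<close> for non-integral \<open>s\<close>. Positivity of the branch on
    \<open>i C^0\<close> excludes it.\<close>
  have "exp (- of_real s * A) \<in> \<real>" "0 < Re (exp (- of_real s * A))"
    using L(3)[OF scaled_unit_interior[OF \<epsilon>]] by (auto simp: A_def)
  then have "exp (- of_real s * A) = of_real (norm (exp (- of_real s * A)))"
    by (metis abs_of_pos norm_of_real of_real_Re)
  also have "norm (exp (- of_real s * A)) = exp (- s * (real r * ln \<epsilon>))" by (simp add: norm_exp_eq_Re ReA)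
  finally have expA: "exp (- of_real s * A) = exp (- of_real s * of_real (real r * ln \<epsilon>))"
    by (simp only: of_real_mult of_real_minus flip: exp_of_real)
  have lb: "L (x, \<epsilon> *\<^sub>R e) = (A - of_real (real r * ln \<epsilon>)) + (\<Sum>j\<in>{1..r}. Ln (of_real \<epsilon> - \<i> * of_real (l j)))"
    unfolding A_def by (rule log_branch[OF L(1,2) \<epsilon> sp])
  have "exp (- of_real s * (A - of_real (real r * ln \<epsilon>))) = 1"
    unfolding right_diff_distrib exp_diff expA by simp
  then show "(\<integral>m. exp (\<i> * of_real (inner m x) - of_real (inner m (\<epsilon> *\<^sub>R e))) \<partial>\<mu>)
           = exp (- of_real s * (\<Sum>j\<in>{1..r}. Ln (of_real \<epsilon> - \<i> * of_real (l j))))"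
    unfolding L(5)[OF scaled_unit_tube[OF \<epsilon>]] lb distrib_left exp_add by simp
qed

lemma arctan_sum_continuous:
  assumes \<epsilon>: "\<epsilon> > 0"
  shows "continuous_on UNIV (\<lambda>x. \<Sum>j\<in>{1..r}. arctan (ev x j / \<epsilon>))"
proof -
  obtain L where L: "continuous_on (tube jm) L" "\<And>x y. (x, y) \<in> tube jm \<Longrightarrow> exp (L (x, y)) = cdet jm e r y (- x)"
    using riesz unfolding riesz_measure_def by blast
  have "(\<Sum>j\<in>{1..r}. arctan (ev x j / \<epsilon>)) = Im (L (0, \<epsilon> *\<^sub>R e)) - Im (L (x, \<epsilon> *\<^sub>R e))" for x
  proof -
    obtain d where sp: "spectral_decomp jm e r x (ev x) d" using ev_spectral by blast
    have "Im (Ln (of_real \<epsilon> - \<i> * of_real t)) = - arctan (t / \<epsilon>)" for t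
      using \<epsilon> by (subst Im_Ln_eq) (auto simp: complex_eq_iff arctan_minus)
    then have "Im (\<Sum>j\<in>{1..r}. Ln (of_real \<epsilon> - \<i> * of_real (ev x j))) = - (\<Sum>j\<in>{1..r}. arctan (ev x j / \<epsilon>))"
      by (simp add: sum_negf)
    then show ?thesis
      using arg_cong[OF log_branch[OF L \<epsilon> sp], of Im] by simp
  qed
  moreover have "continuous_on UNIV (\<lambda>x. L (x, \<epsilon> *\<^sub>R e))"
    by (rule continuous_on_compose2[OF L(1)]) (auto intro!: continuous_intros scaled_unit_tube \<epsilon>)
  ultimately show ?thesis by (simp add: continuous_on_diff continuous_on_Im)
qed

lemma jind_ev: "real_of_int (jind jm e r x) = (\<Sum>j\<in>{1..r}. sgn (ev x j))"
proof -
  obtain d where "spectral_decomp jm e r x (ev x) d" using ev_spectral by blast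
  then show ?thesis by (rule jind_spectral)
qed

lemma ev_bound:
  assumes K: "compact K" "K \<subseteq> invertible_elts jm e"
  obtains \<delta> where "\<delta> > 0" "\<And>x j. x \<in> K \<Longrightarrow> j \<in> {1..r} \<Longrightarrow> \<delta> \<le> \<bar>ev x j\<bar>"
proof -
  obtain \<delta> where \<delta>: "\<delta> > 0" "\<And>x l d j. x \<in> K \<Longrightarrow> spectral_decomp jm e r x l d \<Longrightarrow> j \<in> {1..r} \<Longrightarrow> \<delta> \<le> \<bar>l j\<bar>"
    using eigenvalue_bound[OF K] by blast
  show thesis
  proof (rule that[OF \<delta>(1)])
    fix x j assume "x \<in> K" "j \<in> {1..r}"
    moreover obtain d where "spectral_decomp jm e r x (ev x) d" using ev_spectral by blast
    ultimately show "\<delta> \<le> \<bar>ev x j\<bar>" using \<delta>(2) by blast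
  qed
qed

lemma open_invertible_ind: "open (invertible_ind jm e r i)"
  unfolding open_contains_ball
proof
  fix x0 assume x0: "x0 \<in> invertible_ind jm e r i"
  then have "x0 \<in> invertible_elts jm e" by (simp add: invertible_ind_def)
  then obtain \<rho> where \<rho>: "\<rho> > 0" "cball x0 \<rho> \<subseteq> invertible_elts jm e"
    using open_invertible open_contains_cball by blast
  obtain \<delta> where \<delta>: "\<delta> > 0" "\<And>x j. x \<in> cball x0 \<rho> \<Longrightarrow> j \<in> {1..r} \<Longrightarrow> \<delta> \<le> \<bar>ev x j\<bar>"
    using ev_bound[OF compact_cball \<rho>(2)] by blast
  \<comment> \<open>Each of the \<open>r\<close> arctangents is then within
    \<open>\<epsilon>/\<delta> = 1/(4r)\<close> of its limit, so \<open>f\<close> is within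
    \<open>1/4\<close> of \<open>pi/2\<close> times the index. Allowing \<open>f\<close> a variation
    of \<open>1/4\<close>, the scaled indices differ by at most \<open>3/4\<close>, less than the
    gap \<open>pi/2\<close> between distinct ones.\<close>
  define \<epsilon> where "\<epsilon> = \<delta> / (4 * real r)"
  have \<epsilon>: "\<epsilon> > 0" using \<delta>(1) rank_pos by (simp add: \<epsilon>_def)
  define f where "f x = (\<Sum>j\<in>{1..r}. arctan (ev x j / \<epsilon>))" for x
  have near: "\<bar>f x - real_of_int (jind jm e r x) * (pi / 2)\<bar> \<le> 1 / 4" if "x \<in> cball x0 \<rho>" for x
  proof -
    have "\<bar>f x - real_of_int (jind jm e r x) * (pi / 2)\<bar> = \<bar>\<Sum>j\<in>{1..r}. arctan (ev x j / \<epsilon>) - sgn (ev x j) * (pi / 2)\<bar>"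
      unfolding f_def jind_ev sum_distrib_right sum_subtractf ..
    also have "\<dots> \<le> (\<Sum>j\<in>{1..r}. \<epsilon> / \<delta>)"
      by (intro order_trans[OF sum_abs] sum_mono arctan_near_half_pi \<delta> \<epsilon> that)
    also have "\<dots> = 1 / 4" using \<delta>(1) rank_pos by (simp add: \<epsilon>_def)
    finally show ?thesis .
  qed
  have "continuous (at x0) f"
    using arctan_sum_continuous[OF \<epsilon>] unfolding f_def by (simp add: continuous_on_eq_continuous_at)
  then obtain \<sigma> where \<sigma>: "\<sigma> > 0" "\<And>x. dist x x0 < \<sigma> \<Longrightarrow> \<bar>f x - f x0\<bar> < 1 / 4"
    unfolding continuous_at_eps_delta by (auto simp: dist_real_def dest!: spec[of _ "1 / 4"])
  have near0: "\<bar>f x0 - real_of_int (jind jm e r x0) * (pi / 2)\<bar> \<le> 1 / 4"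
    by (rule near) (use \<rho>(1) in simp)
  have "ball x0 (min \<rho> \<sigma>) \<subseteq> invertible_ind jm e r i"
  proof
    fix x assume "x \<in> ball x0 (min \<rho> \<sigma>)"
    then have x: "x \<in> cball x0 \<rho>" "dist x x0 < \<sigma>" by (auto simp: dist_commute)
    have "\<bar>real_of_int (jind jm e r x) * (pi / 2) - real_of_int (jind jm e r x0) * (pi / 2)\<bar> \<le> 3 / 4"
      using near[OF x(1)] near0 \<sigma>(2)[OF x(2)] by linarith
    also have "\<bar>real_of_int (jind jm e r x) * (pi / 2) - real_of_int (jind jm e r x0) * (pi / 2)\<bar>
        = \<bar>real_of_int (jind jm e r x - jind jm e r x0)\<bar> * (pi / 2)"
      unfolding left_diff_distrib[symmetric] abs_mult of_int_diff by simp
    finally have *: "\<bar>real_of_int (jind jm e r x - jind jm e r x0)\<bar> * (pi / 2) \<le> 3 / 4" .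
    have "jind jm e r x = jind jm e r x0"
    proof (rule ccontr)
      assume "jind jm e r x \<noteq> jind jm e r x0"
      then have "1 \<le> \<bar>real_of_int (jind jm e r x - jind jm e r x0)\<bar>" by linarith
      then have "1 * (pi / 2) \<le> \<bar>real_of_int (jind jm e r x - jind jm e r x0)\<bar> * (pi / 2)"
        by (intro mult_right_mono) auto
      then show False using * pi_gt3 by linarith
    qed
    then show "x \<in> invertible_ind jm e r i"
      using x0 x(1) \<rho>(2) by (auto simp: invertible_ind_def)
  qed
  then show "\<exists>\<rho>>0. ball x0 \<rho> \<subseteq> invertible_ind jm e r i"
    using \<rho>(1) \<sigma>(1) by (intro exI[of _ "min \<rho> \<sigma>"]) auto
qed

text \<open>\<open>W(h_k)\<close> is connected and covered by two disjoint open sets, the class of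
  index \<open>i\<close> and the union \<open>U\<close> of all other classes; it meets the
  first.\<close>

lemma W_subset_index:
  assumes k: "k \<le> r"
  shows "W_set jm r c k \<subseteq> invertible_ind jm e r (2 * int k - int r)"
proof
  define i where "i = 2 * int k - int r"
  define W where "W = W_set jm r c k"
  fix x assume x: "x \<in> W_set jm r c k"
  obtain x0 where x0: "x0 \<in> W" "x0 \<in> invertible_ind jm e r i"
    using W_contains_index_point[OF k] by (auto simp: W_def i_def)
  define U where "U = (\<Union>j\<in>- {i}. invertible_ind jm e r j)"
  have "W \<subseteq> invertible_elts jm e" using W_invertible[OF k] by (simp add: W_def)
  then have "W \<subseteq> invertible_ind jm e r i \<union> U" by (auto simp: U_def invertible_ind_def)
  moreover have "open U" unfolding U_def by (intro open_UN ballI open_invertible_ind)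
  moreover have "invertible_ind jm e r i \<inter> U \<inter> W = {}" by (auto simp: U_def invertible_ind_def)
  moreover have "connected W" unfolding W_def by (rule convex_connected[OF convex_W[OF k]])
  ultimately have "invertible_ind jm e r i \<inter> W = {} \<or> U \<inter> W = {}"
    using open_invertible_ind connectedD by blast
  then have "U \<inter> W = {}" using x0 by blast
  then show "x \<in> invertible_ind jm e r (2 * int k - int r)"
    using x \<open>W \<subseteq> invertible_ind jm e r i \<union> U\<close> by (auto simp: W_def i_def)
qed

text \<open>On invertible elements this is \<open>|Delta(x)|^(-s)\<close>. Elsewhere
  \<open>ln 0 = 0\<close> supplies a positive default value, which meets only test functions that
  vanish there.\<close>

definition weight :: "'a \<Rightarrow> real" where
  "weight x = exp (- s * (\<Sum>j\<in>{1..r}. ln \<bar>ev x j\<bar>))"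

text \<open>The Fourier-Laplace transform at \<open>x + i e/(n+1)\<close>; a sequence of heights
  suits dominated convergence.\<close>

definition smoothed :: "nat \<Rightarrow> 'a \<Rightarrow> complex" where
  "smoothed n x = (\<integral>m. exp (\<i> * of_real (inner m x) - of_real (inner m (inverse (real (Suc n)) *\<^sub>R e))) \<partial>\<mu>)"

lemma smoothed_eq: "smoothed n x = exp (- of_real s * (\<Sum>j\<in>{1..r}. Ln (of_real (inverse (real (Suc n))) - \<i> * of_real (ev x j))))"
proof -
  obtain d where sp: "spectral_decomp jm e r x (ev x) d" using ev_spectral by blast
  show ?thesis unfolding smoothed_def by (rule riesz_transform[OF _ sp]) simp
qed

lemma smoothed_tendsto:
  assumes x: "x \<in> invertible_ind jm e r i"
  shows "(\<lambda>n. smoothed n x) \<longlonglongrightarrow> cis (pi * s * real_of_int i / 2) * of_real (weight x)"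
proof -
  have nz: "ev x j \<noteq> 0" if "j \<in> {1..r}" for j
  proof -
    obtain d where "spectral_decomp jm e r x (ev x) d" using ev_spectral by blast
    then show ?thesis
      using invertible_eigenvalues_nonzero that x unfolding invertible_ind_def by blast
  qed
  have ind: "(\<Sum>j\<in>{1..r}. sgn (ev x j)) = real_of_int i" using jind_ev[of x] x by (simp add: invertible_ind_def)
  have "(\<lambda>n. inverse (real (Suc n))) \<longlonglongrightarrow> 0" by (rule LIMSEQ_inverse_real_of_nat)
  from tendsto_of_real[OF this, where 'a=complex]
  have h0: "(\<lambda>n. complex_of_real (inverse (real (Suc n)))) \<longlonglongrightarrow> 0" by simp
  \<comment> \<open>Nonzero eigenvalues keep \<open>-i l_j\<close> off the cut of \<open>Ln\<close>,
    so every term passes to the limit.\<close>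
  have "(\<lambda>n. smoothed n x) \<longlonglongrightarrow> exp (- of_real s * (\<Sum>j\<in>{1..r}. Ln (0 - \<i> * of_real (ev x j))))"
    unfolding smoothed_eq
    by (intro tendsto_intros h0) (use nz in \<open>auto simp: complex_nonpos_Reals_iff\<close>)
  also have "(\<Sum>j\<in>{1..r}. Ln (0 - \<i> * of_real (ev x j)))
      = (\<Sum>j\<in>{1..r}. complex_of_real (ln \<bar>ev x j\<bar>) - \<i> * complex_of_real (sgn (ev x j) * (pi / 2)))"
    using Ln_minus_ii_times nz by (intro sum.cong) auto
  also have "\<dots> = of_real (\<Sum>j\<in>{1..r}. ln \<bar>ev x j\<bar>) - \<i> * of_real (real_of_int i * (pi / 2))"
    unfolding ind[symmetric] by (simp add: sum_subtractf sum_distrib_left sum_distrib_right)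
  also have "exp (- of_real s * \<dots>) = cis (pi * s * real_of_int i / 2) * of_real (weight x)"
    by (simp add: weight_def cis_conv_exp exp_of_real[symmetric] exp_add[symmetric] algebra_simps)
  finally show ?thesis .
qed

text \<open>Each factor has modulus at least \<open>|l_j| >= \<delta>\<close>, and
  \<open>s >= 0\<close> turns this into an upper bound uniform in \<open>n\<close>.\<close>

lemma smoothed_bound:
  assumes \<delta>: "\<delta> > 0" "\<And>j. j \<in> {1..r} \<Longrightarrow> \<delta> \<le> \<bar>ev x j\<bar>"
  shows "norm (smoothed n x) \<le> exp (- s * (real r * ln \<delta>))"
proof -
  define h where "h = inverse (real (Suc n))"
  have h: "h > 0" by (simp add: h_def)
  have nz: "complex_of_real h - \<i> * of_real t \<noteq> 0" for t using h by (auto simp: complex_eq_iff)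
  have "ln \<delta> \<le> ln (norm (complex_of_real h - \<i> * of_real (ev x j)))" if "j \<in> {1..r}" for j
  proof -
    have "\<delta> \<le> \<bar>Im (complex_of_real h - \<i> * of_real (ev x j))\<bar>" using \<delta>(2)[OF that] by simp
    also have "\<dots> \<le> norm (complex_of_real h - \<i> * of_real (ev x j))" by (rule abs_Im_le_cmod)
    finally show ?thesis using \<delta>(1) by (intro ln_mono) auto
  qed
  then have "(\<Sum>j\<in>{1..r}. ln \<delta>) \<le> (\<Sum>j\<in>{1..r}. ln (norm (complex_of_real h - \<i> * of_real (ev x j))))"
    by (rule sum_mono)
  then have "s * (real r * ln \<delta>) \<le> s * (\<Sum>j\<in>{1..r}. ln (norm (complex_of_real h - \<i> * of_real (ev x j))))"
    using s_nonneg by (intro mult_left_mono) auto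
  then show ?thesis
    unfolding smoothed_eq h_def[symmetric] norm_exp_eq_Re using nz by simp
qed

section \<open>Exchange of limits and integrals\<close>

lemma damped_integrable:
  assumes "\<epsilon> > 0" shows "integrable \<mu> (\<lambda>m. exp (- inner m (\<epsilon> *\<^sub>R e)))"
proof -
  obtain l d where sp: "spectral_decomp jm e r 0 l d" using spectral_exists by blast
  have "integrable \<mu> (\<lambda>m. norm (exp (\<i> * of_real (inner m 0) - of_real (inner m (\<epsilon> *\<^sub>R e)))))"
    by (rule integrable_norm[OF riesz_transform(2)[OF assms sp]])
  then show ?thesis by (simp add: norm_exp_eq_Re)
qed

lemma sigma_finite_\<mu>: "sigma_finite_measure \<mu>"
  by (rule sigma_finite_if_positive_integrable[OF damped_integrable[of 1]]) auto

text \<open>The exponent \<open>N\<close> in the temperedness of \<open>\<mu>\<close> fixes the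
  decay rate requested from the Fourier transform.\<close>

lemma fourier_integrable_\<mu>:
  assumes \<phi>: "test_fun \<phi>"
  shows "integrable \<mu> (fourier (\<lambda>x. complex_of_real (\<phi> x)))"
proof -
  obtain N :: nat where N: "(\<integral>\<^sup>+ l. ennreal ((1 + norm l) powr (- real N)) \<partial>\<mu>) < \<infinity>"
    using riesz unfolding riesz_measure_def by blast
  have int: "integrable \<mu> (\<lambda>l. (1 + norm l) powr (- real N))"
    by (rule integrableI_bounded) (use N in auto)
  obtain C where C: "\<And>l. (1 + norm l) ^ N * norm (fourier (\<lambda>x. complex_of_real (\<phi> x)) l) \<le> C"
    using fourier_decay[OF \<phi>] by blast
  note [measurable] = test_fun_measurable[OF \<phi>]
  have meas: "fourier (\<lambda>x. complex_of_real (\<phi> x)) \<in> borel_measurable \<mu>"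
    unfolding fourier_def[abs_def] by measurable
  show ?thesis
  proof (rule Bochner_Integration.integrable_bound)
    show "integrable \<mu> (\<lambda>l. C * (1 + norm l) powr (- real N))" using int by simp
    show "AE l in \<mu>. norm (fourier (\<lambda>x. complex_of_real (\<phi> x)) l) \<le> norm (C * (1 + norm l) powr (- real N))"
    proof (rule AE_I2)
      fix l :: 'a
      have p: "1 + norm l > 0" using norm_ge_zero[of l] by linarith
      have "norm (fourier (\<lambda>x. complex_of_real (\<phi> x)) l) \<le> C / (1 + norm l) ^ N"
        using C[of l] p by (simp add: pos_le_divide_eq mult.commute)
      also have "\<dots> = C * (1 + norm l) powr (- real N)"
        using p by (simp add: powr_minus powr_realpow divide_inverse)
      finally show "norm (fourier (\<lambda>x. complex_of_real (\<phi> x)) l) \<le> norm (C * (1 + norm l) powr (- real N))" by simp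
    qed
  qed (rule meas)
qed

text \<open>Damping makes the double integral absolutely convergent: \<open>norm (f m x)\<close> is
  an integrable function of \<open>m\<close> times an integrable function of
  \<open>x\<close>.\<close>

lemma smoothed_fubini:
  assumes \<phi>: "test_fun \<phi>"
  shows "(\<integral>x. of_real (\<phi> x) * smoothed n x \<partial>lborel)
     = (\<integral>m. of_real (exp (- inner m (inverse (real (Suc n)) *\<^sub>R e))) * fourier (\<lambda>x. of_real (\<phi> x)) m \<partial>\<mu>)"
proof -
  define \<epsilon> where "\<epsilon> = inverse (real (Suc n))"
  have \<epsilon>: "\<epsilon> > 0" by (simp add: \<epsilon>_def)
  note [measurable] = test_fun_measurable[OF \<phi>]
  interpret \<mu>: sigma_finite_measure \<mu> by (rule sigma_finite_\<mu>)
  interpret P: pair_sigma_finite \<mu> lborel ..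
  define f where "f m x = exp (\<i> * of_real (inner m x) - of_real (inner m (\<epsilon> *\<^sub>R e))) * complex_of_real (\<phi> x)" for m x
  have nf: "norm (f m x) = exp (- inner m (\<epsilon> *\<^sub>R e)) * \<bar>\<phi> x\<bar>" for m x
    by (simp add: f_def norm_mult norm_exp_eq_Re)
  have fm [measurable]: "case_prod f \<in> borel_measurable (\<mu> \<Otimes>\<^sub>M lborel)"
    unfolding f_def by measurable
  have "integrable (\<mu> \<Otimes>\<^sub>M lborel) (case_prod f)"
  proof (rule P.Fubini_integrable[OF fm])
    show "integrable \<mu> (\<lambda>m. \<integral>x. norm (case_prod f (m, x)) \<partial>lborel)"
      using damped_integrable[OF \<epsilon>] by (simp add: nf)
    show "AE m in \<mu>. integrable lborel (\<lambda>x. case_prod f (m, x))"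
    proof (rule AE_I2)
      fix m
      have "integrable lborel (\<lambda>x. exp (- of_real (inner m (\<epsilon> *\<^sub>R e))) * (exp (\<i> * of_real (inner m x)) * complex_of_real (\<phi> x)))"
        by (intro integrable_mult_right fourier_test_integrable \<phi>)
      then show "integrable lborel (\<lambda>x. case_prod f (m, x))"
        by (simp add: f_def exp_diff exp_minus field_simps)
    qed
  qed
  from P.Fubini_integral[OF this]
  have "(\<integral>x. \<integral>m. f m x \<partial>\<mu> \<partial>lborel) = (\<integral>m. \<integral>x. f m x \<partial>lborel \<partial>\<mu>)" .
  moreover have "(\<integral>m. f m x \<partial>\<mu>) = of_real (\<phi> x) * smoothed n x" for x
    unfolding f_def smoothed_def \<epsilon>_def[symmetric] by (simp add: mult.commute)
  moreover have "(\<integral>x. f m x \<partial>lborel) = of_real (exp (- inner m (\<epsilon> *\<^sub>R e))) * fourier (\<lambda>x. of_real (\<phi> x)) m" for m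
  proof -
    have "f m x = of_real (exp (- inner m (\<epsilon> *\<^sub>R e))) * (exp (\<i> * of_real (inner m x)) * of_real (\<phi> x))" for x
      by (simp add: f_def exp_diff exp_minus exp_of_real[symmetric] field_simps)
    then show ?thesis by (simp add: fourier_def)
  qed
  ultimately show ?thesis by (simp add: \<epsilon>_def)
qed

text \<open>Almost everywhere \<open><m, e> >= 0\<close>, so the damping factor is at most 1 and the
  undamped transform of \<open>\<phi>\<close> dominates.\<close>

lemma measure_ft_limit:
  assumes \<phi>: "test_fun \<phi>"
  shows "(\<lambda>n. \<integral>x. of_real (\<phi> x) * smoothed n x \<partial>lborel) \<longlonglongrightarrow> measure_ft \<mu> (\<lambda>x. complex_of_real (\<phi> x))"
proof -
  define F where "F = fourier (\<lambda>x. complex_of_real (\<phi> x))"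
  have F: "integrable \<mu> F" unfolding F_def by (rule fourier_integrable_\<mu>[OF \<phi>])
  then have [measurable]: "F \<in> borel_measurable \<mu>" by simp
  have "(\<lambda>n. \<integral>m. of_real (exp (- inner m (inverse (real (Suc n)) *\<^sub>R e))) * F m \<partial>\<mu>) \<longlonglongrightarrow> (\<integral>m. F m \<partial>\<mu>)"
  proof (rule integral_dominated_convergence[where w="\<lambda>m. norm (F m)"])
    show "integrable \<mu> (\<lambda>m. norm (F m))" using F by simp
    show "AE m in \<mu>. (\<lambda>n. of_real (exp (- inner m (inverse (real (Suc n)) *\<^sub>R e))) * F m) \<longlonglongrightarrow> F m"
    proof (rule AE_I2)
      fix m
      have "(\<lambda>n. complex_of_real (exp (- (inverse (real (Suc n)) * inner m e))) * F m) \<longlonglongrightarrow> of_real (exp (- (0 * inner m e))) * F m"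
        by (intro tendsto_intros LIMSEQ_inverse_real_of_nat)
      then show "(\<lambda>n. of_real (exp (- inner m (inverse (real (Suc n)) *\<^sub>R e))) * F m) \<longlonglongrightarrow> F m" by simp
    qed
    show "AE m in \<mu>. norm (of_real (exp (- inner m (inverse (real (Suc n)) *\<^sub>R e))) * F m) \<le> norm (F m)" for n
      using AE_\<mu>_nonneg by eventually_elim (auto simp: norm_mult intro!: mult_left_le_one_le)
  qed measurable
  then show ?thesis
    unfolding smoothed_fubini[OF \<phi>] measure_ft_def F_def by simp
qed

text \<open>The integrals of \<open>\<phi>\<close> against the smoothed transform form one sequence
  with two limits: the value of the distribution, and the integral of \<open>\<phi>\<close> against
  the boundary function.\<close>

lemma measure_ft_on_index_set:
  assumes \<phi>: "test_fun \<phi>" and supp: "closure {x. \<phi> x \<noteq> 0} \<subseteq> invertible_ind jm e r i"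
  shows "integrable lborel (\<lambda>x. \<phi> x * weight x)"
    and "measure_ft \<mu> (\<lambda>x. complex_of_real (\<phi> x)) = cis (pi * s * real_of_int i / 2) * of_real (\<integral>x. \<phi> x * weight x \<partial>lborel)"
proof -
  define K where "K = closure {x. \<phi> x \<noteq> 0}"
  have K: "compact K" "K \<subseteq> invertible_elts jm e"
    using \<phi> supp by (auto simp: K_def test_fun_def invertible_ind_def)
  have inK: "x \<in> K" if "\<phi> x \<noteq> 0" for x using that closure_subset[of "{x. \<phi> x \<noteq> 0}"] by (auto simp: K_def)
  obtain \<delta> where \<delta>: "\<delta> > 0" "\<And>x j. x \<in> K \<Longrightarrow> j \<in> {1..r} \<Longrightarrow> \<delta> \<le> \<bar>ev x j\<bar>"
    using ev_bound[OF K] by blast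
  define B where "B = exp (- s * (real r * ln \<delta>))"
  note [measurable] = test_fun_measurable[OF \<phi>]
  interpret \<mu>: sigma_finite_measure \<mu> by (rule sigma_finite_\<mu>)
  have [measurable]: "smoothed n \<in> borel_measurable borel" for n
    unfolding smoothed_def[abs_def] by measurable
  define w where "w = cis (pi * s * real_of_int i / 2)"
  have lim: "(\<lambda>n. of_real (\<phi> x) * smoothed n x) \<longlonglongrightarrow> w * of_real (\<phi> x * weight x)" for x
  proof (cases "\<phi> x = 0")
    case False
    then have "x \<in> invertible_ind jm e r i" using inK supp by (auto simp: K_def)
    from tendsto_mult_left[OF smoothed_tendsto[OF this], of "of_real (\<phi> x)"]
    show ?thesis by (simp add: w_def mult_ac)
  qed simp
  \<comment> \<open>Measurability is obtained for the product with \<open>\<phi>\<close>, as a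
    pointwise limit of measurable functions. The phase \<open>w\<close> is carried along and divided
    out at the end.\<close>
  have gm: "(\<lambda>x. w * of_real (\<phi> x * weight x)) \<in> borel_measurable borel"
    by (rule borel_measurable_LIMSEQ_metric[OF _ lim]) measurable
  have dom: "norm (of_real (\<phi> x) * smoothed n x) \<le> B * \<bar>\<phi> x\<bar>" for n x
  proof (cases "\<phi> x = 0")
    case False
    then have "norm (smoothed n x) \<le> B" unfolding B_def using \<delta> inK by (intro smoothed_bound) auto
    then show ?thesis by (simp add: norm_mult mult.commute[of B] mult_left_mono)
  qed simp
  have intB: "integrable lborel (\<lambda>x. B * \<bar>\<phi> x\<bar>)" using test_fun_integrable[OF \<phi>] by simp
  have gm': "(\<lambda>x. w * of_real (\<phi> x * weight x)) \<in> borel_measurable lborel"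
    and sm: "(\<lambda>x. of_real (\<phi> x) * smoothed n x) \<in> borel_measurable lborel" for n
    using gm by simp_all
  have dc1: "integrable lborel (\<lambda>x. w * of_real (\<phi> x * weight x))"
    by (rule integrable_dominated_convergence[OF gm' sm intB]) (rule AE_I2 lim dom)+
  have dc2: "(\<lambda>n. \<integral>x. of_real (\<phi> x) * smoothed n x \<partial>lborel) \<longlonglongrightarrow> (\<integral>x. w * of_real (\<phi> x * weight x) \<partial>lborel)"
    by (rule integral_dominated_convergence[OF gm' sm intB]) (rule AE_I2 lim dom)+
  have w: "w \<noteq> 0" by (simp add: w_def)
  have "integrable lborel (\<lambda>x. inverse w * (w * of_real (\<phi> x * weight x)))"
    by (intro integrable_mult_right dc1)
  then have "integrable lborel (\<lambda>x. complex_of_real (\<phi> x * weight x))"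
    unfolding mult.assoc[symmetric] using w by simp
  from integrable_Re[OF this] show int: "integrable lborel (\<lambda>x. \<phi> x * weight x)"
    by simp
  have "measure_ft \<mu> (\<lambda>x. complex_of_real (\<phi> x)) = (\<integral>x. w * of_real (\<phi> x * weight x) \<partial>lborel)"
    by (rule LIMSEQ_unique[OF measure_ft_limit[OF \<phi>] dc2])
  also have "\<dots> = w * of_real (\<integral>x. \<phi> x * weight x \<partial>lborel)"
    by (simp only: integral_mult_right_zero integral_complex_of_real)
  finally show "measure_ft \<mu> (\<lambda>x. complex_of_real (\<phi> x)) = cis (pi * s * real_of_int i / 2) * of_real (\<integral>x. \<phi> x * weight x \<partial>lborel)"
    by (simp add: w_def)
qed

lemma Im_measure_ft_on_index_set:
  assumes "test_fun \<phi>" and "closure {x. \<phi> x \<noteq> 0} \<subseteq> invertible_ind jm e r i"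
  shows "Im_measure_ft \<mu> \<phi> = sin (pi * s * real_of_int i / 2) * (\<integral>x. \<phi> x * weight x \<partial>lborel)"
  unfolding Im_measure_ft_def measure_ft_on_index_set(2)[OF assms] by simp

text \<open>A zero integral would make \<open>\<phi>\<close> vanish almost everywhere, since
  \<open>weight\<close> is positive; the closed zero set of \<open>\<phi>\<close> would then be the
  whole space.\<close>

lemma weighted_integral_nonzero:
  assumes \<phi>: "test_fun \<phi>" "closure {x. \<phi> x \<noteq> 0} \<subseteq> invertible_ind jm e r i" and nn: "\<And>x. \<phi> x \<ge> 0" and x0: "\<phi> x0 > 0"
  shows "(\<integral>x. \<phi> x * weight x \<partial>lborel) \<noteq> 0"
proof
  have wp: "weight x > 0" for x by (simp add: weight_def)
  assume "(\<integral>x. \<phi> x * weight x \<partial>lborel) = 0"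
  then have "AE x in lborel. \<phi> x * weight x = 0"
    using nn less_imp_le[OF wp]
    by (subst (asm) integral_nonneg_eq_0_iff_AE[OF measure_ft_on_index_set(1)[OF \<phi>]]) auto
  then have "AE x in lborel. x \<in> {x. \<phi> x = 0}"
    by eventually_elim (use wp in \<open>auto simp: less_le\<close>)
  then have "AE x in lebesgue. x \<in> {x. \<phi> x = 0}" by (rule AE_completion)
  moreover have "closed {x. \<phi> x = 0}" using test_fun_continuous[OF \<phi>(1)] by (intro closed_Collect_eq continuous_intros) auto
  ultimately have "x0 \<in> {x. \<phi> x = 0}" using mem_closed_if_AE_lebesgue by blast
  then show False using x0 by simp
qed

section \<open>The sine factor and the support of the imaginary part\<close>

lemma sin_zero_if_vanishing_point:
  assumes x: "x \<in> invertible_ind jm e r i" "x \<notin> distr_support (Im_measure_ft \<mu>)"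
  shows "sin (pi * s * real_of_int i / 2) = 0"
proof -
  obtain U where U: "open U" "x \<in> U" "\<And>\<phi>. test_fun \<phi> \<Longrightarrow> closure {x. \<phi> x \<noteq> 0} \<subseteq> U \<Longrightarrow> Im_measure_ft \<mu> \<phi> = 0"
    using x(2) by (auto simp: distr_support_def)
  have "open (U \<inter> invertible_ind jm e r i)" using U(1) open_invertible_ind by blast
  then obtain \<rho> where \<rho>: "\<rho> > 0" "cball x \<rho> \<subseteq> U \<inter> invertible_ind jm e r i"
    using U(2) x(1) open_contains_cball by (metis IntI)
  \<comment> \<open>A nonnegative bump at \<open>x\<close> inside both \<open>U\<close> and the
    index class: the distribution kills it, its weighted integral is nonzero, so the sine must
    vanish.\<close>
  obtain \<phi> where \<phi>: "test_fun \<phi>" "closure {y. \<phi> y \<noteq> 0} \<subseteq> cball x \<rho>" "\<And>y. \<phi> y \<ge> 0" "\<phi> x > 0"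
    using bump_test_fun[OF \<rho>(1)] by blast
  have "Im_measure_ft \<mu> \<phi> = 0" using U(3)[OF \<phi>(1)] \<phi>(2) \<rho>(2) by blast
  moreover have sub: "closure {y. \<phi> y \<noteq> 0} \<subseteq> invertible_ind jm e r i" using \<phi>(2) \<rho>(2) by blast
  ultimately show ?thesis
    using Im_measure_ft_on_index_set[OF \<phi>(1) sub] weighted_integral_nonzero[OF \<phi>(1) sub \<phi>(3,4)] by simp
qed

lemma support_avoids_index_set:
  assumes "sin (pi * s * real_of_int i / 2) = 0"
  shows "distr_support (Im_measure_ft \<mu>) \<inter> invertible_ind jm e r i = {}"
proof -
  have "Im_measure_ft \<mu> \<phi> = 0" if "test_fun \<phi>" "closure {x. \<phi> x \<noteq> 0} \<subseteq> invertible_ind jm e r i" for \<phi>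
    unfolding Im_measure_ft_on_index_set[OF that] assms by simp
  then have "invertible_ind jm e r i \<in> {U. open U \<and> (\<forall>\<phi>. test_fun \<phi> \<and> closure {x. \<phi> x \<noteq> 0} \<subseteq> U \<longrightarrow> Im_measure_ft \<mu> \<phi> = 0)}"
    using open_invertible_ind by simp
  then show ?thesis unfolding distr_support_def by blast
qed

end

theorem theorem6p12:
  fixes jm :: "'a::euclidean_space \<Rightarrow> 'a \<Rightarrow> 'a" and e :: 'a
    and c :: "nat \<Rightarrow> 'a" and r k :: nat and s :: real and \<mu> :: "'a measure"
  assumes "simple_eja jm e"
    and "jordan_frame jm e r c"
    and "s \<in> wallach_set r (real (dim (peirce_space jm c 1 2)))"
    and "riesz_measure jm e r s \<mu>"
    and "k \<le> r"
  shows "(s * (real k - real r / 2) \<in> \<int>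
            \<longleftrightarrow> distr_support (Im_measure_ft \<mu>) \<subseteq> UNIV - W_set jm r c k)
       \<and> (distr_support (Im_measure_ft \<mu>) \<subseteq> UNIV - W_set jm r c k
            \<longleftrightarrow> distr_support (Im_measure_ft \<mu>) \<inter> invertible_ind jm e r (2 * int k - int r) = {})"
proof -
  interpret ranked_euclidean_jordan jm e r c
    using assms(1,2) by unfold_locales (auto simp: simple_eja_def)
  \<comment> \<open>The half-line of the Wallach set starts at a nonnegative point since
    \<open>r >= 1\<close>; together with the nonnegative discrete points this gives
    \<open>s >= 0\<close>.\<close>
  have "(real r - 1) * real (dim (peirce_space jm c 1 2)) / 2 \<ge> 0" using rank_pos by simp
  then have "0 \<le> s" using assms(3) unfolding wallach_set_def by fastforce
  then interpret riesz_setting jm e r c s \<mu>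
    using assms(4) by unfold_locales
  define i where "i = 2 * int k - int r"
  define S where "S = distr_support (Im_measure_ft \<mu>)"
  have angle: "pi * s * real_of_int i / 2 = s * (real k - real r / 2) * pi"
    by (simp add: i_def field_simps)
  have int_iff: "s * (real k - real r / 2) \<in> \<int> \<longleftrightarrow> sin (pi * s * real_of_int i / 2) = 0"
    unfolding angle sin_zero_iff_int2 by (auto elim!: Ints_cases)
  \<comment> \<open>The implications form a cycle: integrality gives disjointness, disjointness
    gives the inclusion, and the inclusion returns integrality through one point of
    \<open>W(h_k)\<close> of known index.\<close>
  have "S \<inter> invertible_ind jm e r i = {}" if "s * (real k - real r / 2) \<in> \<int>"
    using support_avoids_index_set that int_iff by (simp add: S_def)
  moreover have "S \<subseteq> UNIV - W_set jm r c k" if "S \<inter> invertible_ind jm e r i = {}"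
    using that W_subset_index[OF assms(5)] by (auto simp: i_def)
  moreover have "s * (real k - real r / 2) \<in> \<int>" if "S \<subseteq> UNIV - W_set jm r c k"
  proof -
    obtain x where "x \<in> W_set jm r c k" "x \<in> invertible_ind jm e r i"
      using W_contains_index_point[OF assms(5)] by (auto simp: i_def)
    then show ?thesis using sin_zero_if_vanishing_point[of x i] that int_iff by (auto simp: S_def)
  qed
  ultimately show ?thesis unfolding S_def[symmetric] i_def[symmetric] by blast
qed

end
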